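(* Let $r>0$ and let $h:\overline{\mathbb D}_r\to\mathbb R^3$ be a branched minimal immersion with Weierstrass–Enneper representation $(f,g)$, where $$f(z)=\sum_{j=k}^\infty b_jz^j,\qquad g(z)=a_0+\sum_{j=m}^\infty a_jz^j,$$ with $m>0$, $a_m\neq 0$, $b_k\neq0$. If $r$ is strictly larger than the smallest positive root of the polynomial $$P_m(r)=-m|b_ka_m|^2r^{2m}+\sum_{j=0}^{m-1}(m-j)|b_{k+j}|^2(1+|a_0|^2)^2r^{2j},$$ then $h$ is unstable.
   Context: $\mathbb D_r=\{z\in\mathbb C:|z|<r\}$. A branched minimal immersion is a nonconstant smooth map that is harmonic and conformal. The Weierstrass–Enneper representation $(f,g)$ of $h=(h_1,h_2,h_3)$ (with $f$ holomorphic, $g$ meromorphic, $fg^2$ holomorphic; here both given by power series converging on a neighborhood of $\overline{\mathbb D}_r$) means $\big(\tfrac{\partial h_1}{\partial z},\tfrac{\partial h_2}{\partial z},\tfrac{\partial h_3}{\partial z}\big)=\big(\tfrac12 f(1-g^2),\tfrac i2 f(1+g^2),fg\big)$. $h$ is unstable on $\overline{\mathbb D}_r$ if there is a smooth $W:\overline{\mathbb D}_r\to\mathbb R^3$ vanishing on $\partial\mathbb D_r$ with $\frac{d^2}{dt^2}\big|_{t=0}A(h+tW)<0$, $A$ the area functional. *)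

theory Defs
  imports "HOL-Analysis.Analysis"
begin

text \<open>The plane is modelled by the complex numbers, z = x + i y.
  Ck n U f: f is n times continuously (Frechet) differentiable on U,
  expressed through iterated directional derivatives.\<close>

fun Ck :: "nat \<Rightarrow> 'a::real_normed_vector set \<Rightarrow> ('a \<Rightarrow> 'b::real_normed_vector) \<Rightarrow> bool" where
  "Ck 0 U f = continuous_on U f"
| "Ck (Suc n) U f =
     (f differentiable_on U \<and> (\<forall>v. Ck n U (\<lambda>x. frechet_derivative f (at x) v)))"

definition smooth_cdisk :: "real \<Rightarrow> (complex \<Rightarrow> 'b::real_normed_vector) \<Rightarrow> bool" where
  "smooth_cdisk r f \<longleftrightarrow> (\<exists>U. open U \<and> cball 0 r \<subseteq> U \<and> (\<forall>n. Ck n U f))"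

definition pdx :: "(complex \<Rightarrow> 'b::real_normed_vector) \<Rightarrow> complex \<Rightarrow> 'b" where
  "pdx u z = frechet_derivative u (at z) 1"

definition pdy :: "(complex \<Rightarrow> 'b::real_normed_vector) \<Rightarrow> complex \<Rightarrow> 'b" where
  "pdy u z = frechet_derivative u (at z) \<i>"

definition dz :: "(complex \<Rightarrow> real^3) \<Rightarrow> 3 \<Rightarrow> complex \<Rightarrow> complex" where
  "dz u j z = (complex_of_real (pdx u z $ j) - \<i> * complex_of_real (pdy u z $ j)) / 2"

definition harmonic_cdisk :: "real \<Rightarrow> (complex \<Rightarrow> real^3) \<Rightarrow> bool" where
  "harmonic_cdisk r u \<longleftrightarrow> (\<forall>z\<in>cball 0 r. pdx (pdx u) z + pdy (pdy u) z = 0)"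

definition conformal_cdisk :: "real \<Rightarrow> (complex \<Rightarrow> real^3) \<Rightarrow> bool" where
  "conformal_cdisk r u \<longleftrightarrow> (\<forall>z\<in>cball 0 r.
      pdx u z \<bullet> pdx u z = pdy u z \<bullet> pdy u z \<and> pdx u z \<bullet> pdy u z = 0)"

definition branched_minimal_immersion :: "real \<Rightarrow> (complex \<Rightarrow> real^3) \<Rightarrow> bool" where
  "branched_minimal_immersion r h \<longleftrightarrow>
     smooth_cdisk r h \<and> (\<exists>z\<in>cball 0 r. \<exists>w\<in>cball 0 r. h z \<noteq> h w) \<and>
     harmonic_cdisk r h \<and> conformal_cdisk r h"

definition WE_rep :: "real \<Rightarrow> (complex \<Rightarrow> real^3) \<Rightarrow> (complex \<Rightarrow> complex) \<Rightarrow> (complex \<Rightarrow> complex) \<Rightarrow> bool" where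
  "WE_rep r h f g \<longleftrightarrow> (\<forall>z\<in>cball 0 r.
      dz h 1 z = f z * (1 - (g z)\<^sup>2) / 2 \<and>
      dz h 2 z = \<i> / 2 * f z * (1 + (g z)\<^sup>2) \<and>
      dz h 3 z = f z * g z)"

definition area :: "real \<Rightarrow> (complex \<Rightarrow> real^3) \<Rightarrow> real" where
  "area r u = integral (cball 0 r) (\<lambda>z. norm (cross3 (pdx u z) (pdy u z)))"

definition unstable_cdisk :: "real \<Rightarrow> (complex \<Rightarrow> real^3) \<Rightarrow> bool" where
  "unstable_cdisk r h \<longleftrightarrow> (\<exists>W. smooth_cdisk r W \<and> (\<forall>z. norm z = r \<longrightarrow> W z = 0) \<and>
     (\<exists>A' A''. (\<forall>\<^sub>F t in nhds 0.
          ((\<lambda>s. area r (\<lambda>z. h z + s *\<^sub>R W z)) has_real_derivative A' t) (at t)) \<and>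
        (A' has_real_derivative A'') (at 0) \<and> A'' < 0))"

definition Pm :: "nat \<Rightarrow> nat \<Rightarrow> (nat \<Rightarrow> complex) \<Rightarrow> (nat \<Rightarrow> complex) \<Rightarrow> real \<Rightarrow> real" where
  "Pm m k a b x = - real m * (cmod (b k * a m))\<^sup>2 * x ^ (2 * m)
     + (\<Sum>j<m. real (m - j) * (cmod (b (k + j)))\<^sup>2 * (1 + (cmod (a 0))\<^sup>2)\<^sup>2 * x ^ (2 * j))"

definition smallest_pos_root :: "(real \<Rightarrow> real) \<Rightarrow> real \<Rightarrow> bool" where
  "smallest_pos_root P x \<longleftrightarrow> 0 < x \<and> P x = 0 \<and> (\<forall>y. 0 < y \<and> P y = 0 \<longrightarrow> x \<le> y)"

end

theory Submission
  imports Defs "HOL-Complex_Analysis.Complex_Analysis"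
begin

text \<open>For a normal variation \<open>W = \<psi> N\<close> the second derivative of the area is the index form
  \<open>\<integral> |\<nabla>\<psi>|^2 - |\<nabla>N|^2 \<psi>^2\<close>, which depends on the Gauss map \<open>g\<close> alone. Since all terms of the sum
  in \<open>Pm\<close> are nonnegative, comparing with the one for \<open>j = 0\<close> shows that every \<open>r\<close> beyond the smallest root
  satisfies \<open>|a_m| r^m > K = 1 + |a_0|^2\<close>, and this inequality is all that is used about \<open>b\<close>.

  The destabilising function is \<open>\<phi> = Re (\<epsilon> Q J)\<close>, where \<open>Q = r^(2m) / z^m - cnj z^m\<close> vanishes on the boundary and
  \<open>J = (g - a_0) (1 + a_0 cnj g) / (1 + |g|^2)\<close> is a complex Jacobi field with a zero of order \<open>m\<close> at \<open>0\<close>;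
  the unit number \<open>\<epsilon>\<close> makes \<open>\<epsilon> a_m\<close> real. Integration by parts turns its index form into
  \<open>\<integral> m^2 |z|^(2m-2) (K^2 - |a_m|^2 r^(2m))\<close> minus the integral of a nonnegative function.

  The area integrand is not differentiable at branch points, so \<open>\<phi>\<close> is multiplied by a logarithmic cutoff
  built from \<open>|f|^2\<close>. It has arbitrarily small Dirichlet energy, and makes \<open>W\<close> and its first derivatives
  \<open>O(|f|)\<close>, so that the integrand becomes \<open>|f|^2\<close> times a smooth function of \<open>t\<close>.\<close>

section \<open>Smooth functions\<close>

text \<open>Up to the factor \<open>K / 2\<close>, \<open>J\<close> is the complex component of
  \<open>N\<close> in the plane orthogonal to \<open>N(0)\<close>: components of the normal solve
  the Jacobi equation, because translations preserve area, and these vanish at the origin.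
  \<open>Q\<close> is harmonic off the origin, so the Jacobi operator applied to \<open>Q J\<close>
  leaves only the cross terms \<open>Q_z J_zbar + Q_zbar J_z\<close>, which can be integrated by
  parts again. The pole of \<open>Q\<close> is cancelled by the zero of \<open>J\<close>, but the
  quotient keeps the value \<open>a_m\<close> at the origin; together with the value
  \<open>K\<close> of \<open>K - \<sigma>\<close> there it yields the two constants of the final
  comparison. The threshold is that of the model \<open>a_0 = 0\<close>, \<open>g = a_m z^m\<close>,
  \<open>|a_m| r^m = 1\<close>: the Gauss map then covers a hemisphere, and \<open>\<phi>\<close> is
  a multiple of the component of \<open>N\<close> that vanishes on the equator. The cutoff can
  vanish at all branch points and still cost little energy because points have zero capacity in the
  plane. Taking its profile logarithmic in \<open>|f|^2\<close> makes it smooth and adapts it to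
  zeros of any order without locating them.\<close>

no_notation fps_nth (infixl "$" 75)

text \<open>Openness makes the recursion work: \<open>frechet_derivative\<close> at a point of
  \<open>U\<close> sees only nearby values, so the derivatives agree on \<open>U\<close>
  again.\<close>

lemma Ck_cong:
  assumes "open U" and "\<And>x. x \<in> U \<Longrightarrow> f x = g x" and "Ck n U f"
  shows "Ck n U g"
  using assms(2,3)
proof (induction n arbitrary: f g)
  case 0
  then show ?case by (auto cong: continuous_on_cong)
next
  case (Suc n)
  have *: "(g has_derivative frechet_derivative f (at x)) (at x)" if "x \<in> U" for x
  proof -
    have "(f has_derivative frechet_derivative f (at x)) (at x)"
      using Suc.prems(2) that assms(1)
      by (metis Ck.simps(2) differentiable_on_eq_differentiable_at frechet_derivative_works)
    then show ?thesis
      using has_derivative_transform_within_open[OF _ assms(1) that] Suc.prems(1) by blast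
  qed
  then have "g differentiable_on U"
    by (meson differentiableI differentiable_at_imp_differentiable_on)
  moreover have "Ck n U (\<lambda>x. frechet_derivative g (at x) v)" for v
  proof (rule Suc.IH)
    show "Ck n U (\<lambda>x. frechet_derivative f (at x) v)" using Suc.prems by simp
    show "frechet_derivative f (at x) v = frechet_derivative g (at x) v" if "x \<in> U" for x
      using frechet_derivative_at[OF *[OF that]] by simp
  qed
  ultimately show ?case by simp
qed

text \<open>\<open>frechet_derivative\<close> is a choice operator; with this rule an explicit
  derivative stands in for it in all closure lemmas below.\<close>

lemma Ck_SucI:
  assumes "open U" and d: "\<And>x. x \<in> U \<Longrightarrow> (f has_derivative f' x) (at x)"
    and "\<And>v. Ck n U (\<lambda>x. f' x v)"
  shows "Ck (Suc n) U f"
proof -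
  have "f differentiable_on U"
    by (meson d differentiableI differentiable_at_imp_differentiable_on)
  moreover have "Ck n U (\<lambda>x. frechet_derivative f (at x) v)" for v
    by (rule Ck_cong[OF assms(1) _ assms(3)[of v]]) (simp add: frechet_derivative_at[OF d, symmetric])
  ultimately show ?thesis by simp
qed

lemma Ck_Suc_has_derivative:
  assumes "open U" "Ck (Suc n) U f" "x \<in> U"
  shows "(f has_derivative frechet_derivative f (at x)) (at x)"
  using assms by (metis Ck.simps(2) differentiable_on_eq_differentiable_at frechet_derivative_works)

text \<open>Needed for products and quotients, in whose derivatives the undifferentiated factors
  reappear at the lower order.\<close>

lemma Ck_SucD: "Ck (Suc n) U f \<Longrightarrow> Ck n U f"
proof (induction n arbitrary: f)
  case 0
  then show ?case by (simp add: differentiable_imp_continuous_on)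
next
  case (Suc n)
  then show ?case by (metis Ck.simps(2))
qed

lemma Ck_const: "open U \<Longrightarrow> Ck n U (\<lambda>x. c)"
proof (induction n arbitrary: c)
  case (Suc n)
  show ?case by (rule Ck_SucI[OF Suc.prems, of _ "\<lambda>_ _. 0"]) (auto simp: Suc)
qed simp

lemma Ck_bounded_linear:
  assumes "open U" "bounded_linear l" "Ck n U f"
  shows "Ck n U (\<lambda>x. l (f x))"
  using assms(3)
proof (induction n arbitrary: f)
  case 0
  then show ?case using assms(2) by (simp add: bounded_linear.continuous_on)
next
  case (Suc n)
  show ?case
  proof (rule Ck_SucI[OF assms(1)])
    show "((\<lambda>x. l (f x)) has_derivative (\<lambda>v. l (frechet_derivative f (at x) v))) (at x)" if "x \<in> U" for x
      by (rule bounded_linear.has_derivative[OF assms(2) Ck_Suc_has_derivative[OF assms(1) Suc.prems that]])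
    show "Ck n U (\<lambda>x. l (frechet_derivative f (at x) v))" for v
      using Suc by simp
  qed
qed

lemma Ck_add:
  assumes "open U" "Ck n U f" "Ck n U g"
  shows "Ck n U (\<lambda>x. f x + g x)"
  using assms(2,3)
proof (induction n arbitrary: f g)
  case 0
  then show ?case by (simp add: continuous_on_add)
next
  case (Suc n)
  show ?case
  proof (rule Ck_SucI[OF assms(1)])
    show "((\<lambda>x. f x + g x) has_derivative
        (\<lambda>v. frechet_derivative f (at x) v + frechet_derivative g (at x) v)) (at x)" if "x \<in> U" for x
      by (intro has_derivative_add Ck_Suc_has_derivative[OF assms(1) _ that, of n] Suc.prems)
    show "Ck n U (\<lambda>x. frechet_derivative f (at x) v + frechet_derivative g (at x) v)" for v
      using Suc by simp
  qed
qed

lemma Ck_bilinear: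
  assumes "open U" "bounded_bilinear pr" "Ck n U f" "Ck n U g"
  shows "Ck n U (\<lambda>x. pr (f x) (g x))"
  using assms(3,4)
proof (induction n arbitrary: f g)
  case 0
  then show ?case using bounded_bilinear.continuous_on[OF assms(2)] by simp
next
  case (Suc n)
  show ?case
  proof (rule Ck_SucI[OF assms(1)])
    show "((\<lambda>x. pr (f x) (g x)) has_derivative
        (\<lambda>v. pr (f x) (frechet_derivative g (at x) v) + pr (frechet_derivative f (at x) v) (g x))) (at x)"
      if "x \<in> U" for x
      by (intro bounded_bilinear.FDERIV[OF assms(2)] Ck_Suc_has_derivative[OF assms(1) _ that, of n] Suc.prems)
    show "Ck n U (\<lambda>x. pr (f x) (frechet_derivative g (at x) v) + pr (frechet_derivative f (at x) v) (g x))" for v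
      using Suc Ck_SucD[OF Suc.prems(1)] Ck_SucD[OF Suc.prems(2)]
      by (intro Ck_add assms(1)) auto
  qed
qed

lemmas Ck_mult = Ck_bilinear[OF _ bounded_bilinear_mult]
lemmas Ck_scaleR = Ck_bilinear[OF _ bounded_bilinear_scaleR]

lemma Ck_uminus: "open U \<Longrightarrow> Ck n U f \<Longrightarrow> Ck n U (\<lambda>x. - f x)"
  by (rule Ck_bounded_linear[where l = uminus]) (auto intro: bounded_linear_minus bounded_linear_ident)

lemma Ck_diff: "open U \<Longrightarrow> Ck n U f \<Longrightarrow> Ck n U g \<Longrightarrow> Ck n U (\<lambda>x. f x - g x)"
  using Ck_add[OF _ _ Ck_uminus] by fastforce

lemma Ck_power:
  fixes f :: "'a::real_normed_vector \<Rightarrow> 'b::real_normed_field"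
  shows "open U \<Longrightarrow> Ck n U f \<Longrightarrow> Ck n U (\<lambda>x. f x ^ k)"
  by (induction k) (auto intro: Ck_const Ck_mult)

lemma Ck_inverse:
  fixes f :: "'a::real_normed_vector \<Rightarrow> 'b::real_normed_field"
  assumes "open U" "Ck n U f" "\<And>x. x \<in> U \<Longrightarrow> f x \<noteq> 0"
  shows "Ck n U (\<lambda>x. inverse (f x))"
  using assms(2)
proof (induction n)
  case 0
  then show ?case using assms(3) by (auto intro: continuous_on_inverse)
next
  case (Suc n)
  show ?case
  proof (rule Ck_SucI[OF assms(1)])
    show "((\<lambda>x. inverse (f x)) has_derivative
        (\<lambda>v. - (inverse (f x) * frechet_derivative f (at x) v * inverse (f x)))) (at x)" if "x \<in> U" for x
      by (intro Deriv.has_derivative_inverse assms(3) that Ck_Suc_has_derivative[OF assms(1) Suc.prems])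
    show "Ck n U (\<lambda>x. - (inverse (f x) * frechet_derivative f (at x) v * inverse (f x)))" for v
      using Suc Ck_SucD[OF Suc.prems] by (intro Ck_uminus Ck_mult assms(1)) auto
  qed
qed

lemma Ck_divide:
  fixes f :: "'a::real_normed_vector \<Rightarrow> 'b::real_normed_field"
  assumes "open U" "Ck n U f" "Ck n U g" "\<And>x. x \<in> U \<Longrightarrow> g x \<noteq> 0"
  shows "Ck n U (\<lambda>x. f x / g x)"
  unfolding divide_inverse using assms by (intro Ck_mult Ck_inverse)

text \<open>A case split replaces induction: the derivative of \<open>ln\<close> is a reciprocal,
  which \<open>Ck_inverse\<close> handles at every order.\<close>

lemma Ck_ln:
  fixes f :: "'a::real_normed_vector \<Rightarrow> real"
  assumes "open U" "Ck n U f" "\<And>x. x \<in> U \<Longrightarrow> f x > 0"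
  shows "Ck n U (\<lambda>x. ln (f x))"
proof (cases n)
  case 0
  then show ?thesis using assms by (force intro: continuous_on_ln)
next
  case (Suc k)
  show ?thesis unfolding Suc
  proof (rule Ck_SucI[OF assms(1)])
    show "((\<lambda>x. ln (f x)) has_derivative
        (\<lambda>v. frechet_derivative f (at x) v * inverse (f x))) (at x)" if "x \<in> U" for x
      using has_derivative_ln[OF assms(3)[OF that] Ck_Suc_has_derivative[OF assms(1) assms(2)[unfolded Suc] that]]
      by simp
    show "Ck k U (\<lambda>x. frechet_derivative f (at x) v * inverse (f x))" for v
      using assms Ck_SucD[of k U f] Suc
      by (intro Ck_mult Ck_inverse assms(1)) (auto dest: assms(3))
  qed
qed

lemma Ck_holomorphic:
  assumes "open U" "f holomorphic_on U"
  shows "Ck n U f"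
  using assms(2)
proof (induction n arbitrary: f)
  case 0
  then show ?case by (simp add: holomorphic_on_imp_continuous_on)
next
  case (Suc n)
  show ?case
  proof (rule Ck_SucI[OF assms(1)])
    show "(f has_derivative (\<lambda>v. deriv f x * v)) (at x)" if "x \<in> U" for x
      using holomorphic_derivI[OF Suc.prems assms(1) that] by (simp add: has_field_derivative_def)
    show "Ck n U (\<lambda>x. deriv f x * v)" for v
      by (intro Ck_mult Ck_const assms(1) Suc.IH holomorphic_deriv Suc.prems)
  qed
qed

lemma Ck_vec3:
  assumes "open U" and "\<And>i. Ck n U (\<lambda>x. f x $ i)"
  shows "Ck n U (f :: _ \<Rightarrow> real^3)"
proof -
  have "Ck n U (\<lambda>x. f x $ 1 *\<^sub>R axis 1 1 + f x $ 2 *\<^sub>R axis 2 1 + f x $ 3 *\<^sub>R (axis 3 1 :: real^3))"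
    by (intro Ck_add Ck_scaleR Ck_const assms)
  then show ?thesis
    by (rule Ck_cong[OF assms(1), rotated]) (simp add: vec_eq_iff forall_3 axis_def)
qed

section \<open>A divergence theorem for fields vanishing on the boundary circle\<close>

lemma integral_lborel_translate:
  fixes F :: "'a::euclidean_space \<Rightarrow> 'b::euclidean_space"
  assumes "integrable lborel F"
  shows "integrable lborel (\<lambda>z. F (c + z))" "(\<integral>z. F (c + z) \<partial>lborel) = (\<integral>z. F z \<partial>lborel)"
proof -
  have m: "F \<in> borel_measurable borel" using borel_measurable_integrable[OF assms] by simp
  show "integrable lborel (\<lambda>z. F (c + z))"
    using integrable_distr_eq[of "\<lambda>z. c + z" lborel borel F] m assms by (simp add: lborel_distr_plus)
  show "(\<integral>z. F (c + z) \<partial>lborel) = (\<integral>z. F z \<partial>lborel)"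
    using integral_distr[of "\<lambda>z. c + z" lborel borel F] m by (simp add: lborel_distr_plus)
qed

text \<open>The extension of \<open>F\<close> by zero is Lipschitz and its translates all have the same integral; the
  claim is the derivative of this invariance.\<close>

lemma has_integral_directional_derivative_cball:
  fixes F :: "'a::euclidean_space \<Rightarrow> 'b::euclidean_space"
  assumes d: "\<And>z. norm z \<le> r \<Longrightarrow> (F has_derivative F' z) (at z)"
    and K: "\<And>z v. norm z \<le> r \<Longrightarrow> norm (F' z v) \<le> K * norm v"
    and zero: "\<And>z. norm z = r \<Longrightarrow> F z = 0"
  shows "((\<lambda>z. F' z v) has_integral 0) (cball 0 r)"
proof (cases "r > 0")
  case False
  have "negligible (cball (0::'a) r)"
    using False by (cases "r = 0") auto
  then show ?thesis by (rule has_integral_negligible) auto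
next
  case True
  define K' where "K' = max K 0"
  define G where "G z = (if norm z \<le> r then F z else 0)" for z
  have lipF: "norm (F x - F y) \<le> K' * norm (x - y)" if "norm x \<le> r" "norm y \<le> r" for x y
  proof (rule differentiable_bound[of "cball 0 r" F F'])
    show "(F has_derivative F' z) (at z within cball 0 r)" if "z \<in> cball 0 r" for z
      using d[of z] that by (auto intro: has_derivative_at_withinI)
    show "onorm (F' z) \<le> K'" if "z \<in> cball 0 r" for z
    proof (rule onorm_bound)
      show "norm (F' z v) \<le> K' * norm v" for v
        using K[of z v] that mult_right_mono[of K K' "norm v"] by (simp add: K'_def)
    qed (simp add: K'_def)
  qed (use that in auto)
  \<comment> \<open>Across the boundary: the segment from \<open>x\<close> to \<open>y\<close> meets
    the sphere at a point \<open>p\<close> where \<open>F\<close> vanishes, and \<open>p\<close> is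
    no farther from \<open>x\<close> than \<open>y\<close> is.\<close>
  have lip1: "norm (F x) \<le> K' * norm (x - y)" if xy: "norm x \<le> r" "norm y > r" for x y
  proof -
    have "\<exists>p\<in>closed_segment x y. norm p = r"
    proof -
      have "connected (norm ` closed_segment x y)"
        by (intro connected_continuous_image continuous_intros connected_segment)
      then have "r \<in> norm ` closed_segment x y"
        using connectedD_interval[of "norm ` closed_segment x y" "norm x" "norm y" r] xy by auto
      then show ?thesis by auto
    qed
    then obtain p where p: "p \<in> closed_segment x y" "norm p = r" by auto
    have "norm (F x) = norm (F x - F p)" using zero[OF p(2)] by simp
    also have "\<dots> \<le> K' * norm (x - p)" using p xy by (intro lipF) auto
    also have "\<dots> \<le> K' * norm (x - y)"
      using segment_bound(1)[OF p(1)] by (intro mult_left_mono) (auto simp: K'_def norm_minus_commute)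
    finally show ?thesis .
  qed
  have lipG: "norm (G x - G y) \<le> K' * norm (x - y)" for x y
    using lipF[of x y] lip1[of x y] lip1[of y x]
    by (auto simp: G_def norm_minus_commute K'_def)
  have contG: "continuous_on UNIV G"
  proof (rule continuous_on_iff[THEN iffD2], intro ballI allI impI)
    fix x :: 'a and e :: real assume "e > 0"
    show "\<exists>d>0. \<forall>x'\<in>UNIV. dist x' x < d \<longrightarrow> dist (G x') (G x) < e"
    proof (intro exI conjI ballI impI)
      show "e / (K' + 1) > 0" using \<open>e > 0\<close> by (simp add: K'_def)
      fix y assume "dist y x < e / (K' + 1)"
      then have "(K' + 1) * norm (y - x) < e"
        by (simp add: dist_norm K'_def pos_less_divide_eq mult.commute)
      moreover have "K' * norm (y - x) \<le> (K' + 1) * norm (y - x)"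
        by (intro mult_right_mono) auto
      ultimately show "dist (G y) (G x) < e"
        using lipG[of y x] by (simp add: dist_norm)
    qed
  qed
  have "integrable lborel (\<lambda>z. indicator (cball 0 r) z *\<^sub>R G z)"
    by (intro borel_integrable_compact continuous_on_subset[OF contG]) auto
  moreover have "(\<lambda>z. indicator (cball 0 r) z *\<^sub>R G z) = G"
    by (auto simp: G_def indicator_def)
  ultimately have intG: "integrable lborel G" by simp
  \<comment> \<open>Difference quotients along \<open>v\<close> with step
    \<open>1 / (n + 1)\<close>; translation invariance gives each of them integral 0.\<close>
  define D where "D n z = real (Suc n) *\<^sub>R (G (v /\<^sub>R real (Suc n) + z) - G z)" for n z
  have intD: "integrable lborel (D n)" for n
    unfolding D_def by (intro integrable_scaleR_right Bochner_Integration.integrable_diff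
        integral_lborel_translate(1) intG)
  have "(\<integral>z. D n z \<partial>lborel) = 0" for n
    unfolding D_def using intG integral_lborel_translate[OF intG] by simp
  then have D0: "(D n has_integral 0) UNIV" for n
    using has_integral_integral_lborel[OF intD[of n]] by simp
  \<comment> \<open>Only on the sphere can the extension by zero fail to be differentiable; it is a
    null set and is removed.\<close>
  define S where "S = - sphere (0::'a) r"
  have neg: "negligible (UNIV - S)" 
    unfolding S_def using negligible_sphere[of "0::'a" r] by (simp add: Diff_eq)
  have iff: "(f has_integral y) UNIV \<longleftrightarrow> (f has_integral y) S" for f :: "'a \<Rightarrow> 'c::banach" and y
    by (rule has_integral_spike_set_eq) (auto intro: negligible_subset[OF neg])
  have DS: "(D n has_integral 0) S" for n
    using D0[of n] iff by blast
  define g where "g z = (if norm z < r then F' z v else 0)" for z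
  \<comment> \<open>Dominating function: the shift is at most \<open>norm v\<close>, so every
    quotient lives in the ball of radius \<open>r + norm v\<close>, where the Lipschitz bound gives
    \<open>K' * norm v\<close>.\<close>
  define H where "H z = (if norm z \<le> r + norm v then K' * norm v else 0)" for z :: 'a
  have "(g has_integral 0) S"
  proof (rule has_integral_dominated_convergence[OF DS])
    have "(\<lambda>z. K' * norm v) integrable_on cball (0::'a) (r + norm v)"
      by (intro integrable_on_const lmeasurable_cball)
    then have "H integrable_on UNIV"
      unfolding H_def using integrable_restrict_UNIV[of "cball (0::'a) (r + norm v)" "\<lambda>z. K' * norm v"] by simp
    then show "H integrable_on S"
      using iff by (auto simp: integrable_on_def)
    show "\<forall>z\<in>S. norm (D n z) \<le> H z" for n
    proof
      fix z
      show "norm (D n z) \<le> H z"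
      proof (cases "norm z \<le> r + norm v")
        case True
        have "norm (D n z) \<le> real (Suc n) * (K' * norm (v /\<^sub>R real (Suc n)))"
          unfolding D_def norm_scaleR using lipG[of "v /\<^sub>R real (Suc n) + z" z]
          by (intro mult_mono) auto
        also have "\<dots> = K' * norm v" by simp
        finally show ?thesis using True by (simp add: H_def)
      next
        case False
        have "norm (v /\<^sub>R real (Suc n)) \<le> norm v"
          by (simp add: divide_simps mult_left_le mult_le_cancel_left1)
        then have "norm (v /\<^sub>R real (Suc n) + z) > r"
          using False norm_triangle_ineq2[of z "- (v /\<^sub>R real (Suc n))"] by (simp add: add.commute)
        moreover have "norm z > r" using False norm_ge_zero[of v] by linarith
        ultimately show ?thesis using False by (simp add: D_def G_def H_def)
      qed
    qed
    show "\<forall>z\<in>S. (\<lambda>n. D n z) \<longlonglongrightarrow> g z"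
    proof
      fix z assume "z \<in> S"
      then consider "norm z < r" | "norm z > r" by (force simp: S_def)
      then have G': "(G has_derivative (if norm z < r then F' z else (\<lambda>_. 0))) (at z)"
      proof cases
        case 1
        have "(G has_derivative F' z) (at z)"
          by (rule has_derivative_transform_within_open[OF d[of z], of "ball 0 r"])
             (use 1 in \<open>auto simp: G_def\<close>)
        then show ?thesis using 1 by simp
      next
        case 2
        have "(G has_derivative (\<lambda>_. 0)) (at z)"
          by (rule has_derivative_transform_within_open[of "\<lambda>_. 0" _ _ _ "- cball 0 r"])
             (use 2 in \<open>auto simp: G_def\<close>)
        then show ?thesis using 2 by simp
      qed
      have "((\<lambda>t. G (z + t *\<^sub>R v)) has_vector_derivative g z) (at 0)"
      proof -
        have l: "linear (if norm z < r then F' z else (\<lambda>_. 0))"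
          using G' has_derivative_linear by blast
        have "((\<lambda>t. z + t *\<^sub>R v) has_derivative (\<lambda>t. t *\<^sub>R v)) (at 0)"
          by (auto intro!: derivative_eq_intros)
        then have "((\<lambda>t. G (z + t *\<^sub>R v)) has_derivative
            (\<lambda>t. (if norm z < r then F' z else (\<lambda>_. 0)) (t *\<^sub>R v))) (at 0)"
          using has_derivative_compose[of "\<lambda>t. z + t *\<^sub>R v" "\<lambda>t. t *\<^sub>R v" 0 UNIV G] G' by simp
        moreover have "(\<lambda>t. (if norm z < r then F' z else (\<lambda>_. 0)) (t *\<^sub>R v)) = (\<lambda>t. t *\<^sub>R g z)"
          using linear_scale[OF l] by (auto simp: g_def)
        ultimately show ?thesis by (simp add: has_vector_derivative_def)
      qed
      then have lim: "((\<lambda>t. (G (z + t *\<^sub>R v) - G z) /\<^sub>R t) \<longlongrightarrow> g z) (at 0)"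
      proof -
        have "(\<lambda>t. norm (G (z + t *\<^sub>R v) - G z - t *\<^sub>R g z) / norm t) \<midarrow>0\<rightarrow> 0"
          using \<open>((\<lambda>t. G (z + t *\<^sub>R v)) has_vector_derivative g z) (at 0)\<close>
          by (simp add: has_vector_derivative_def has_derivative_at)
        moreover have "norm (G (z + t *\<^sub>R v) - G z - t *\<^sub>R g z) / norm t
            = norm ((G (z + t *\<^sub>R v) - G z) /\<^sub>R t - g z)" if "t \<noteq> 0" for t
        proof -
          have "(G (z + t *\<^sub>R v) - G z) /\<^sub>R t - g z = (G (z + t *\<^sub>R v) - G z - t *\<^sub>R g z) /\<^sub>R t"
            using that by (simp add: scaleR_diff_right)
          then show ?thesis by (simp add: divide_inverse)
        qed
        ultimately have "(\<lambda>t. norm ((G (z + t *\<^sub>R v) - G z) /\<^sub>R t - g z)) \<midarrow>0\<rightarrow> 0"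
          by (elim Lim_transform_eventually) (auto simp: eventually_at_filter)
        then show ?thesis
          by (rule LIM_zero_cancel[OF tendsto_norm_zero_cancel])
      qed
      have "filterlim (\<lambda>n. inverse (real (Suc n))) (at 0) sequentially"
        by (rule filterlim_atI[OF LIMSEQ_inverse_real_of_nat]) auto
      from filterlim_compose[OF lim this]
      show "(\<lambda>n. D n z) \<longlonglongrightarrow> g z"
        by (simp add: D_def add.commute o_def)
    qed
  qed auto
  then have "(g has_integral 0) UNIV"
    using iff by blast
  then have "((\<lambda>z. if z \<in> ball 0 r then F' z v else 0) has_integral 0) UNIV"
    by (simp add: g_def[abs_def])
  then have "((\<lambda>z. F' z v) has_integral 0) (ball 0 r)"
    using has_integral_restrict_UNIV by blast
  moreover have "((\<lambda>z. F' z v) has_integral 0) (ball 0 r) \<longleftrightarrow> ((\<lambda>z. F' z v) has_integral 0) (cball 0 r)"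
    by (rule has_integral_spike_set_eq) (auto intro: negligible_subset[OF negligible_sphere[of 0 r]])
  ultimately show ?thesis by blast
qed

section \<open>Wirtinger derivatives\<close>

lemma integrable_on_compact_continuous:
  fixes f :: "'a::euclidean_space \<Rightarrow> 'b::euclidean_space"
  assumes "compact K" "continuous_on K f"
  shows "f absolutely_integrable_on K" "f integrable_on K"
proof -
  have "integrable lborel (\<lambda>x. indicator K x *\<^sub>R f x)"
    by (rule borel_integrable_compact[OF assms])
  then show "f absolutely_integrable_on K"
    unfolding set_integrable_def using integrable_completion[of _ lborel]
    by (simp add: borel_measurable_integrable integrable_completion)
  then show "f integrable_on K" by (rule set_lebesgue_integral_eq_integral)
qed

text \<open>The real derivative in the basis \<open>v\<close>, \<open>cnj v\<close>, so that
  \<open>p\<close> and \<open>q\<close> are the derivatives in \<open>z\<close> and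
  \<open>cnj z\<close>. A relation rather than two operators, so that rules compute both by
  unification.\<close>

definition has_wirt :: "(complex \<Rightarrow> complex) \<Rightarrow> complex \<Rightarrow> complex \<Rightarrow> complex \<Rightarrow> bool" where
  "has_wirt F p q z \<longleftrightarrow> (F has_derivative (\<lambda>v. p * v + q * cnj v)) (at z)"

named_theorems wirt

text \<open>Applied first, it leaves schematic derivatives for the rules to fill in and two purely
  algebraic goals for the claimed ones.\<close>

lemma has_wirt_eqI: "has_wirt F p q z \<Longrightarrow> p = p' \<Longrightarrow> q = q' \<Longrightarrow> has_wirt F p' q' z"
  by simp

lemma has_wirt_const [wirt]: "has_wirt (\<lambda>z. c) 0 0 z"
  by (simp add: has_wirt_def)

lemma has_wirt_ident [wirt]: "has_wirt (\<lambda>z. z) 1 0 z"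
  by (simp add: has_wirt_def)

lemma has_wirt_field [wirt]: "(F has_field_derivative F') (at z) \<Longrightarrow> has_wirt F F' 0 z"
  by (simp add: has_wirt_def has_field_derivative_def)

lemma has_wirt_cnj [wirt]: "has_wirt F p q z \<Longrightarrow> has_wirt (\<lambda>z. cnj (F z)) (cnj q) (cnj p) z"
  unfolding has_wirt_def
  by (drule bounded_linear.has_derivative[OF bounded_linear_cnj]) (simp add: add.commute)

lemma has_wirt_add [wirt]:
  "has_wirt F p q z \<Longrightarrow> has_wirt G p' q' z \<Longrightarrow> has_wirt (\<lambda>z. F z + G z) (p + p') (q + q') z"
  unfolding has_wirt_def
  by (drule (1) has_derivative_add) (simp add: algebra_simps)

lemma has_wirt_diff [wirt]:
  "has_wirt F p q z \<Longrightarrow> has_wirt G p' q' z \<Longrightarrow> has_wirt (\<lambda>z. F z - G z) (p - p') (q - q') z"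
  unfolding has_wirt_def
  by (drule (1) has_derivative_diff) (simp add: algebra_simps)

lemma has_wirt_uminus [wirt]: "has_wirt F p q z \<Longrightarrow> has_wirt (\<lambda>z. - F z) (- p) (- q) z"
  using has_wirt_diff[OF has_wirt_const[of 0]] by simp

lemma has_wirt_mult [wirt]:
  "has_wirt F p q z \<Longrightarrow> has_wirt G p' q' z \<Longrightarrow>
    has_wirt (\<lambda>z. F z * G z) (p * G z + F z * p') (q * G z + F z * q') z"
  unfolding has_wirt_def
  by (drule (1) has_derivative_mult) (simp add: algebra_simps)

lemma has_wirt_inverse [wirt]:
  assumes "has_wirt F p q z" "F z \<noteq> 0"
  shows "has_wirt (\<lambda>z. inverse (F z)) (- p / (F z)\<^sup>2) (- q / (F z)\<^sup>2) z"
  unfolding has_wirt_def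
  by (rule has_derivative_eq_rhs[OF Deriv.has_derivative_inverse[OF assms(2) assms(1)[unfolded has_wirt_def]]])
     (simp add: fun_eq_iff power2_eq_square field_simps assms(2))

lemma has_wirt_divide [wirt]:
  assumes "has_wirt F p q z" "has_wirt G p' q' z" "G z \<noteq> 0"
  shows "has_wirt (\<lambda>z. F z / G z) ((p * G z - F z * p') / (G z)\<^sup>2) ((q * G z - F z * q') / (G z)\<^sup>2) z"
  unfolding divide_inverse
  by (rule has_wirt_eqI[OF has_wirt_mult[OF assms(1) has_wirt_inverse[OF assms(2,3)]]])
     (use assms(3) in \<open>auto simp: power2_eq_square field_simps\<close>)

lemma has_wirt_power [wirt]:
  assumes "has_wirt F p q z"
  shows "has_wirt (\<lambda>z. F z ^ n) (of_nat n * F z ^ (n - 1) * p) (of_nat n * F z ^ (n - 1) * q) z"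
  using has_derivative_power[OF assms[unfolded has_wirt_def], of n]
  unfolding has_wirt_def by (rule has_derivative_eq_rhs) (simp add: fun_eq_iff algebra_simps)

lemma has_wirt_frechet:
  assumes "has_wirt F p q z"
  shows "frechet_derivative F (at z) v = p * v + q * cnj v"
  using frechet_derivative_at[OF assms[unfolded has_wirt_def]] by (simp add: fun_eq_iff)

lemma Ck_cnj: "open U \<Longrightarrow> Ck n U f \<Longrightarrow> Ck n U (\<lambda>x. cnj (f x))"
  by (rule Ck_bounded_linear[OF _ bounded_linear_cnj])

lemma frechet_derivative_complex:
  assumes "(F has_derivative F') (at z)"
  shows "F' v = Re v *\<^sub>R F' 1 + Im v *\<^sub>R F' \<i>"
proof -
  have l: "linear F'" using assms has_derivative_linear by blast
  have "v = Re v *\<^sub>R 1 + Im v *\<^sub>R \<i>" by (simp add: complex_eq_iff)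
  then show ?thesis by (metis l linear_add linear_scale)
qed

lemma Ck_continuous: "Ck n U f \<Longrightarrow> continuous_on U f"
  by (cases n) (auto simp: differentiable_imp_continuous_on)

lemma Ck_Suc_continuous_pd:
  assumes "open U" "Ck (Suc n) U u"
  shows "continuous_on U (pdx u)" "continuous_on U (pdy u)"
proof -
  have "continuous_on U (\<lambda>x. frechet_derivative u (at x) v)" for v
    using assms(2) by (intro Ck_continuous[of n]) simp
  then show "continuous_on U (pdx u)" "continuous_on U (pdy u)"
    by (auto simp: pdx_def[abs_def] pdy_def[abs_def])
qed

lemma has_integral_pd_cball:
  fixes F :: "complex \<Rightarrow> 'b::euclidean_space"
  assumes "open U" "cball 0 r \<subseteq> U" "Ck (Suc n) U F" and zero: "\<And>z. norm z = r \<Longrightarrow> F z = 0"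
  shows "(pdx F has_integral 0) (cball 0 r)" "(pdy F has_integral 0) (cball 0 r)"
proof -
  have d: "(F has_derivative frechet_derivative F (at z)) (at z)" if "norm z \<le> r" for z
    using Ck_Suc_has_derivative[OF assms(1,3), of z] that assms(2) by auto
  have "compact (pdx F ` cball 0 r)" "compact (pdy F ` cball 0 r)"
    using Ck_Suc_continuous_pd[OF assms(1,3)] assms(2)
    by (auto intro!: compact_continuous_image intro: continuous_on_subset)
  then obtain B C where BC: "\<And>z. norm z \<le> r \<Longrightarrow> norm (pdx F z) \<le> B" "\<And>z. norm z \<le> r \<Longrightarrow> norm (pdy F z) \<le> C"
    by (force simp: bounded_iff dest!: compact_imp_bounded)
  have K: "norm (frechet_derivative F (at z) v) \<le> (B + C) * norm v" if "norm z \<le> r" for z v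
  proof -
    have "norm (frechet_derivative F (at z) v) \<le> \<bar>Re v\<bar> * norm (pdx F z) + \<bar>Im v\<bar> * norm (pdy F z)"
      unfolding frechet_derivative_complex[OF d[OF that], of v] pdx_def pdy_def
      by (rule order_trans[OF norm_triangle_ineq]) simp
    also have "\<dots> \<le> norm v * B + norm v * C"
      by (intro add_mono mult_mono BC that abs_Re_le_cmod abs_Im_le_cmod) auto
    finally show ?thesis by (simp add: algebra_simps)
  qed
  show "(pdx F has_integral 0) (cball 0 r)" "(pdy F has_integral 0) (cball 0 r)"
    unfolding pdx_def[abs_def] pdy_def[abs_def]
    by (rule has_integral_directional_derivative_cball[of r F, OF d K zero]; assumption)+
qed

text \<open>The combinations \<open>(pdx F - \<i> * pdy F) / 2\<close> and
  \<open>(pdx F + \<i> * pdy F) / 2\<close> of two zero integrals. The other derivative is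
  existentially quantified, so a potential has to be differentiated explicitly in one variable
  only.\<close>

lemma has_integral_wirt_cball:
  assumes "open U" "cball 0 r \<subseteq> U" "Ck (Suc n) U F" "\<And>z. norm z = r \<Longrightarrow> F z = 0"
  shows "(\<And>z. norm z \<le> r \<Longrightarrow> \<exists>q. has_wirt F (p z) q z) \<Longrightarrow> (p has_integral 0) (cball 0 r)"
    and "(\<And>z. norm z \<le> r \<Longrightarrow> \<exists>p. has_wirt F p (q z) z) \<Longrightarrow> (q has_integral 0) (cball 0 r)"
proof -
  note I = has_integral_pd_cball[OF assms]
  have J: "((\<lambda>z. \<i> * pdy F z) has_integral 0) (cball 0 r)"
    using has_integral_mult_right[OF I(2), of \<i>] by simp
  have p: "((\<lambda>z. (pdx F z - \<i> * pdy F z) / 2) has_integral 0) (cball 0 r)"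
    using has_integral_divide[OF has_integral_diff[OF I(1) J], of 2] by simp
  have q: "((\<lambda>z. (pdx F z + \<i> * pdy F z) / 2) has_integral 0) (cball 0 r)"
    using has_integral_divide[OF has_integral_add[OF I(1) J], of 2] by simp
  show "(p has_integral 0) (cball 0 r)" if *: "\<And>z. norm z \<le> r \<Longrightarrow> \<exists>q. has_wirt F (p z) q z"
  proof (rule has_integral_eq[OF _ p])
    fix z :: complex assume "z \<in> cball 0 r"
    then obtain q where "has_wirt F (p z) q z" using *[of z] by auto
    from has_wirt_frechet[OF this]
    show "(pdx F z - \<i> * pdy F z) / 2 = p z"
      by (simp add: pdx_def pdy_def algebra_simps)
  qed
  show "(q has_integral 0) (cball 0 r)" if *: "\<And>z. norm z \<le> r \<Longrightarrow> \<exists>p. has_wirt F p (q z) z"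
  proof (rule has_integral_eq[OF _ q])
    fix z :: complex assume "z \<in> cball 0 r"
    then obtain p where "has_wirt F p (q z) z" using *[of z] by auto
    from has_wirt_frechet[OF this]
    show "(pdx F z + \<i> * pdy F z) / 2 = q z"
      by (simp add: pdx_def pdy_def algebra_simps)
  qed
qed

section \<open>The test function of the Gauss map and its index form\<close>

text \<open>\<open>c\<close> and \<open>d\<close> are the successive quotients of the Taylor
  expansion of \<open>g\<close> at 0. \<open>c\<close> divides the zero out of
  \<open>g - a0\<close>; \<open>d\<close> is what later allows division of
  \<open>\<Theta> - am\<close> by \<open>z\<close>.\<close>

locale gauss_map =
  fixes g c d :: "complex \<Rightarrow> complex" and a0 am \<epsilon> :: complex and m :: nat and r R :: real
  assumes r: "0 < r" "r < R" and m: "m > 0"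
    and hol: "g holomorphic_on ball 0 R" "c holomorphic_on ball 0 R" "d holomorphic_on ball 0 R"
    and g_eq: "norm z < R \<Longrightarrow> g z = a0 + z ^ m * c z"
    and c_eq: "norm z < R \<Longrightarrow> c z = am + z * d z"
    and eps: "norm \<epsilon> = 1" "\<epsilon> * am = of_real (norm am)"
begin

abbreviation "g' \<equiv> deriv g"
abbreviation "c' \<equiv> deriv c"

definition w where "w z = 1 + g z * cnj (g z)"
definition D where "D z = 1 + a0 * cnj (g z)"
text \<open>The Jacobi field with its zero \<open>z ^ m\<close> divided out; smooth across 0, with
  value \<open>am\<close> there.\<close>

definition \<Theta> where "\<Theta> z = c z * D z / w z"
definition S where "S z = c z * cnj (c z) / w z"
definition \<rho> where "\<rho> z = of_real (r ^ (2 * m)) - z ^ m * cnj z ^ m"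
definition v :: "complex \<Rightarrow> complex" where "v z = z ^ (m - 1)"
definition K :: complex where "K = 1 + a0 * cnj a0"

lemma w_of_real: "w z = of_real (1 + (norm (g z))\<^sup>2)"
  by (simp add: w_def complex_norm_square[symmetric])

lemma w_nz [simp]: "w z \<noteq> 0"
proof -
  have "1 + (norm (g z))\<^sup>2 > 0" by (simp add: add_pos_nonneg)
  then show ?thesis unfolding w_of_real of_real_eq_0_iff by linarith
qed

lemma cnj_w [simp]: "cnj (w z) = w z"
  by (simp add: w_def mult.commute)

lemma zm: "z ^ m = z * v z"
  using m unfolding v_def by (metis power_minus_mult mult.commute)

context
  fixes z :: complex assumes z: "norm z < R"
begin

lemma wirt_g: "has_wirt g (g' z) 0 z" and wirt_c: "has_wirt c (c' z) 0 z"
  and wirt_d: "has_wirt d (deriv d z) 0 z"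
  using z hol by (auto intro!: has_wirt_field holomorphic_derivI[where S = "ball 0 R"])

lemma wirt_zm: "has_wirt (\<lambda>z. z ^ m) (of_nat m * v z) 0 z"
  by (rule has_wirt_eqI[OF has_wirt_power[OF has_wirt_ident]]) (auto simp: v_def)

lemma wirt_czm: "has_wirt (\<lambda>z. cnj z ^ m) 0 (of_nat m * cnj (v z)) z"
  by (rule has_wirt_eqI[OF has_wirt_power[OF has_wirt_cnj[OF has_wirt_ident]]]) (auto simp: v_def)

lemma g'_eq: "g' z = of_nat m * v z * c z + z ^ m * c' z"
proof -
  have "((\<lambda>z. a0 + z ^ m * c z) has_field_derivative (of_nat m * v z * c z + z ^ m * c' z)) (at z)"
    using z hol unfolding v_def
    by (auto intro!: derivative_eq_intros holomorphic_derivI[where S = "ball 0 R"])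
  then have "(g has_field_derivative (of_nat m * v z * c z + z ^ m * c' z)) (at z)"
    by (rule has_field_derivative_transform_within_open[of _ _ _ "ball 0 R"]) (use z g_eq in auto)
  then show ?thesis by (rule DERIV_imp_deriv)
qed

lemma wirt_w: "has_wirt w (g' z * cnj (g z)) (g z * cnj (g' z)) z"
  unfolding w_def[abs_def]
  by (rule has_wirt_eqI, (rule wirt wirt_g)+) auto

lemma wirt_D: "has_wirt D 0 (a0 * cnj (g' z)) z"
  unfolding D_def[abs_def]
  by (rule has_wirt_eqI, (rule wirt wirt_g)+) auto

lemma wirt_rho: "has_wirt \<rho> (- (of_nat m * v z * cnj z ^ m)) (- (of_nat m * z ^ m * cnj (v z))) z"
  unfolding \<rho>_def[abs_def]
  by (rule has_wirt_eqI, (rule has_wirt_diff has_wirt_mult has_wirt_const wirt_zm wirt_czm)+) auto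

text \<open>The derivative in \<open>cnj z\<close> collapses because
  \<open>a0 * w - g * D = a0 - g = - z ^ m * c\<close>; the factor \<open>z ^ m\<close> gained here
  is essential for \<open>X3\<close>.\<close>

lemma wirt_Theta: "has_wirt \<Theta> (c' z * D z / w z - c z * D z * g' z * cnj (g z) / (w z)\<^sup>2)
    (- ((c z)\<^sup>2 * z ^ m * cnj (g' z) / (w z)\<^sup>2)) z"
  unfolding \<Theta>_def[abs_def]
  apply (rule has_wirt_eqI, (rule wirt_c wirt_w wirt_D has_wirt_divide has_wirt_mult w_nz)+)
   apply (simp add: field_simps power2_eq_square)
  apply (simp add: field_simps power2_eq_square D_def w_def g_eq[OF z])
  done

end

text \<open>The suffixes \<open>p\<close> and \<open>q\<close> mark derivatives with respect to \<open>z\<close> and \<open>cnj z\<close>. \<open>L\<close> is the Jacobi operator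
  applied to \<open>\<Psi>\<close> and \<open>H\<close> the mixed second derivative of \<open>\<Psi>\<close>; here \<open>J\<close> and \<open>\<sigma> = |z|^(2m) S\<close> satisfy
  \<open>|J|^2 = \<sigma> (K - \<sigma>)\<close>.\<close>

definition rm :: complex where "rm = of_real (r ^ (2 * m))"
abbreviation M :: complex where "M \<equiv> of_nat m"
definition Sq where "Sq z = (c z * cnj (c' z) * w z - c z * cnj (c z) * g z * cnj (g' z)) / (w z)\<^sup>2"
text \<open>The derivative of \<open>cnj z ^ m * S z\<close> in \<open>cnj z\<close>; unlike that of
  \<open>S\<close> alone it factors.\<close>

definition T where "T z = c z * cnj (g' z) * cnj (D z) / (w z)\<^sup>2"
definition \<Theta>p where "\<Theta>p z = c' z * D z / w z - c z * D z * g' z * cnj (g z) / (w z)\<^sup>2"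
definition \<Theta>q where "\<Theta>q z = - ((c z)\<^sup>2 * z ^ m * cnj (g' z) / (w z)\<^sup>2)"
definition J where "J z = z ^ m * \<Theta> z"
definition Jp where "Jp z = g' z * (D z)\<^sup>2 / (w z)\<^sup>2"
definition \<sigma> where "\<sigma> z = z ^ m * cnj z ^ m * S z"

text \<open>Four potentials for integration by parts, zero on the circle because of the factor
  \<open>\<rho>\<close>. \<open>X1\<close> and \<open>X2\<close> serve the two terms of
  \<open>- cnj \<Psi> * L\<close>, \<open>X3\<close> and \<open>X4\<close> those of
  \<open>- \<Psi> * L\<close>; \<open>X1\<close> and \<open>X3\<close> are differentiated in
  \<open>cnj z\<close>, the other two in \<open>z\<close>.\<close>

definition X1 where "X1 z = - (1/2) * M * rm * (\<rho> z * (v z * cnj z ^ m * (S z)\<^sup>2))"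
definition X2 where "X2 z = 1/2 * M * (\<rho> z * cnj (v z) * (z ^ m * S z) * (2 * K - \<sigma> z))"
definition X3 where "X3 z = 1/2 * \<epsilon>\<^sup>2 * M * rm *
  (\<rho> z * (d z - (c z)\<^sup>2 * cnj (g z) * v z / w z) * (\<Theta> z + am))"
definition X4 where "X4 z = 1/2 * \<epsilon>\<^sup>2 * M * (\<rho> z * cnj (v z) * \<Theta> z * J z)"
definition \<Psi> where "\<Psi> z = \<epsilon> * (\<rho> z * \<Theta> z)"
definition \<Psi>p where "\<Psi>p z = \<epsilon> * (- (M * v z * cnj z ^ m) * \<Theta> z + \<rho> z * \<Theta>p z)"
definition \<Psi>q where "\<Psi>q z = - \<epsilon> * (M * cnj (v z) * J z + \<rho> z * ((c z)\<^sup>2 * z ^ m * cnj (g' z) / (w z)\<^sup>2))"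
definition L where "L z = \<epsilon> * M * (rm * v z * (c z)\<^sup>2 * cnj (g' z) - cnj (v z) * g' z * (D z)\<^sup>2) / (w z)\<^sup>2"
definition H where "H z = L z - 2 * g' z * cnj (g' z) * \<Psi> z / (w z)\<^sup>2"
definition \<phi> where "\<phi> z = (\<Psi> z + cnj (\<Psi> z)) / 2"
definition P where "P z = (\<Psi>p z + cnj (\<Psi>q z)) / 2"

lemma rho_eq: "\<rho> z = rm - z ^ m * cnj z ^ m"
  by (simp add: \<rho>_def rm_def)

lemma cnj_S [simp]: "cnj (S z) = S z"
  by (simp add: S_def mult.commute)

context
  fixes z :: complex assumes z: "norm z < R"
begin

lemmas wz = wirt_g[OF z] wirt_c[OF z] wirt_d[OF z] wirt_w[OF z] wirt_D[OF z] wirt_zm[OF z] wirt_czm[OF z]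
  wirt_rho[OF z]

lemma wirt_v: "has_wirt v (of_nat (m - 1) * z ^ (m - 2)) 0 z"
  unfolding v_def[abs_def]
  by (rule has_wirt_eqI, (rule wirt)+) (auto simp: numeral_2_eq_2)

lemma wirt_cg': "has_wirt (\<lambda>z. cnj (g' z)) 0 (cnj (deriv g' z)) z"
  and wirt_g': "has_wirt g' (deriv g' z) 0 z"
  and wirt_c': "has_wirt c' (deriv c' z) 0 z"
proof -
  show *: "has_wirt g' (deriv g' z) 0 z" "has_wirt c' (deriv c' z) 0 z"
    using z hol by (auto intro!: has_wirt_field holomorphic_derivI[where S = "ball 0 R"] holomorphic_deriv)
  show "has_wirt (\<lambda>z. cnj (g' z)) 0 (cnj (deriv g' z)) z"
    by (rule has_wirt_eqI[OF has_wirt_cnj[OF *(1)]]) auto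
qed

lemma wirt_Theta': "has_wirt \<Theta> (\<Theta>p z) (\<Theta>q z) z"
  unfolding \<Theta>p_def \<Theta>q_def by (rule wirt_Theta[OF z])

lemma wirt_S: "has_wirt S (cnj (Sq z)) (Sq z) z"
  unfolding S_def[abs_def]
  by (rule has_wirt_eqI, (rule has_wirt_divide has_wirt_mult has_wirt_cnj wz w_nz)+)
     (auto simp: Sq_def algebra_simps)

lemma cnj_g'_eq: "cnj (g' z) = M * cnj (v z) * cnj (c z) + cnj z ^ m * cnj (c' z)"
  by (simp add: g'_eq[OF z])

text \<open>The product rule for \<open>cnj z ^ m * S z\<close>, solved for the derivative of
  \<open>S\<close>. Once \<open>g\<close> and \<open>g'\<close> are written through \<open>c\<close>
  it is a polynomial identity, hence the detour over free variables for
  \<open>algebra\<close>.\<close>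

lemma czm_Sq: "cnj z ^ m * Sq z = T z - M * cnj (v z) * S z"
proof -
  have *: "u * (c * c1 * w - c * cb * g * gp) = c * gp * Db - mv * c * cb * w"
    if "gp = mv * cb + u * c1" "gb = ab + u * cb" "w = 1 + g * gb" "Db = 1 + ab * g"
    for u gp mv cb c1 gb ab w g Db c :: complex
    using that by algebra
  have "cnj z ^ m * (c z * cnj (c' z) * w z - c z * cnj (c z) * g z * cnj (g' z))
     = c z * cnj (g' z) * cnj (D z) - (M * cnj (v z)) * c z * cnj (c z) * w z"
    by (rule *[where gb = "cnj (g z)" and ab = "cnj a0"])
       (simp_all add: cnj_g'_eq w_def D_def g_eq[OF z])
  then show ?thesis
    by (simp add: Sq_def T_def S_def field_simps power2_eq_square)
qed

lemma zm_cSq: "z ^ m * cnj (Sq z) = cnj (T z) - M * v z * S z"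
  using arg_cong[OF czm_Sq, of cnj] by simp

lemma zm_Thetap: "z ^ m * \<Theta>p z = Jp z - M * v z * \<Theta> z"
proof -
  have *: "u * (c1 * D * w - c * D * gp * gb) = gp * D\<^sup>2 - mv * c * D * w"
    if "gp = mv * c + u * c1" "g = a + u * c" "w = 1 + g * gb" "D = 1 + a * gb"
    for u gp mv c1 gb a w g D c :: complex
    using that by algebra
  have "z ^ m * (c' z * D z * w z - c z * D z * g' z * cnj (g z))
     = g' z * (D z)\<^sup>2 - (M * v z) * c z * D z * w z"
    by (rule *[where a = a0 and g = "g z"])
       (simp_all add: g'_eq[OF z] w_def D_def g_eq[OF z])
  then show ?thesis
    by (simp add: Jp_def \<Theta>p_def \<Theta>_def field_simps power2_eq_square)
qed

lemma wirt_zmS: "has_wirt (\<lambda>z. z ^ m * S z) (cnj (T z)) (z ^ m * Sq z) z"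
  by (rule has_wirt_eqI, (rule has_wirt_mult wz wirt_S)+) (auto simp: zm_cSq)

lemma wirt_J: "has_wirt J (Jp z) (z ^ m * \<Theta>q z) z"
  unfolding J_def[abs_def]
  by (rule has_wirt_eqI, (rule has_wirt_mult wz wirt_Theta')+) (auto simp: zm_Thetap)

text \<open>The term in which \<open>\<rho>\<close> is differentiated merges with the others through
  \<open>\<rho> + z ^ m * cnj z ^ m = rm\<close>, so that beside the wanted term only a multiple of
  \<open>|v|^2 S^2\<close> remains.\<close>

lemma wirt_X1: "\<exists>p. has_wirt X1 p
    (1/2 * M\<^sup>2 * rm\<^sup>2 * v z * cnj (v z) * (S z)\<^sup>2 - M * rm * \<rho> z * v z * S z * T z) z"
proof -
  have *: "- (1/2) * M * rm * (- (M * zm * vb) * (v * u * S\<^sup>2) + \<rho> * (v * (M * vb) * S\<^sup>2 + v * u * (2 * S * Sq)))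
      = 1/2 * M\<^sup>2 * rm\<^sup>2 * v * vb * S\<^sup>2 - M * rm * \<rho> * v * S * T"
    if "u * Sq = T - M * vb * S" "\<rho> = rm - zm * u" for M rm zm vb v u S \<rho> Sq T :: complex
    using that by algebra
  show ?thesis
    unfolding X1_def[abs_def]
    apply (rule exI, rule has_wirt_eqI, (rule wz wirt_S wirt_v has_wirt_mult has_wirt_const has_wirt_power)+)
     apply (rule refl)
    apply (subst *[OF czm_Sq rho_eq, symmetric])
    apply (simp add: algebra_simps)
    done
qed

text \<open>Off the origin \<open>z ^ m * S * (2 * K - \<sigma>)\<close> equals
  \<open>(K^2 - (K - \<sigma>)^2) / cnj z ^ m\<close>. The constant \<open>K^2\<close> removes the
  pole and is the source of \<open>K^2\<close> in the final comparison.\<close>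

lemma wirt_X2: "\<exists>q. has_wirt X2
    (M * cnj (v z) * \<rho> z * cnj (T z) * (K - \<sigma> z) + 1/2 * M\<^sup>2 * v z * cnj (v z) * ((K - \<sigma> z)\<^sup>2 - K\<^sup>2)) q z"
proof -
  have \<sigma>: "\<sigma> = (\<lambda>z. z ^ m * S z * cnj z ^ m)"
    by (auto simp: \<sigma>_def)
  have wc: "has_wirt (\<lambda>z. cnj (v z)) 0 (cnj (of_nat (m - 1) * z ^ (m - 2))) z"
    using has_wirt_cnj[OF wirt_v] by simp
  show ?thesis
    unfolding X2_def[abs_def] \<sigma>
    apply (rule exI, rule has_wirt_eqI, (rule wirt_zmS wc wz has_wirt_const has_wirt_diff has_wirt_mult)+)
     apply (simp add: algebra_simps power2_eq_square)
    apply (rule refl)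
    done
qed

lemma wirt_X4: "\<exists>q. has_wirt X4
    (\<epsilon>\<^sup>2 * M * \<rho> z * cnj (v z) * \<Theta> z * Jp z - 1/2 * \<epsilon>\<^sup>2 * M\<^sup>2 * rm * v z * cnj (v z) * (\<Theta> z)\<^sup>2) q z"
proof -
  have *: "1/2 * e\<^sup>2 * M * vb * (- (M * v * u) * \<Theta> * J + \<rho> * (\<Theta>p * J + \<Theta> * Jp))
     = e\<^sup>2 * M * \<rho> * vb * \<Theta> * Jp - 1/2 * e\<^sup>2 * M\<^sup>2 * rm * v * vb * \<Theta>\<^sup>2"
    if "zm * \<Theta>p = Jp - M * v * \<Theta>" "J = zm * \<Theta>" "\<rho> = rm - zm * u" for e M vb v u \<Theta> J \<rho> Jp rm zm \<Theta>p :: complex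
    using that by algebra
  have wc: "has_wirt (\<lambda>z. cnj (v z)) 0 (cnj (of_nat (m - 1) * z ^ (m - 2))) z"
    using has_wirt_cnj[OF wirt_v] by simp
  show ?thesis
    unfolding X4_def[abs_def]
    apply (rule exI, rule has_wirt_eqI, (rule wc wz wirt_Theta' wirt_J has_wirt_const has_wirt_mult)+)
     apply (subst *[OF zm_Thetap J_def rho_eq, symmetric])
     apply (simp add: algebra_simps)
    apply (rule refl)
    done
qed

text \<open>The obvious potential contains \<open>\<rho> \<Theta>^2 / z\<close> and has a pole.
  Since \<open>\<Theta>\<close> is \<open>am\<close> at 0, replacing \<open>\<Theta>^2\<close> by
  \<open>\<Theta>^2 - am^2\<close> cures it, \<open>T3\<close> being the smooth quotient
  \<open>(\<Theta> - am) / z\<close>. The correction brings in \<open>am^2\<close>, and with it the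
  decisive term \<open>|a_m|^2 r^(2m)\<close>.\<close>

lemma wirt_X3: "\<exists>p. has_wirt X3 p
    (- (1/2) * \<epsilon>\<^sup>2 * M\<^sup>2 * rm * v z * cnj (v z) * ((\<Theta> z)\<^sup>2 - am\<^sup>2)
      - \<epsilon>\<^sup>2 * M * rm * \<rho> z * \<Theta> z * ((c z)\<^sup>2 * v z * cnj (g' z) / (w z)\<^sup>2)) z"
proof -
  define T3 where "T3 z = d z - (c z)\<^sup>2 * cnj (g z) * v z / w z" for z
  define Q where "Q = - ((c z)\<^sup>2 * v z * cnj (g' z) / (w z)\<^sup>2)"
  have wT: "\<exists>p. has_wirt T3 p Q z"
    unfolding T3_def[abs_def] Q_def
    apply (rule exI, rule has_wirt_eqI,
       (rule wz wirt_v w_nz has_wirt_const has_wirt_diff has_wirt_divide has_wirt_power has_wirt_cnj has_wirt_mult)+)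
     apply (rule refl)
    apply (simp add: field_simps power2_eq_square w_def)
    done
  then obtain p3 where wT: "has_wirt T3 p3 Q z" by blast
  have zT: "z * T3 z = \<Theta> z - am"
  proof -
    have "z * T3 z * w z = (c z - am) * w z - (c z)\<^sup>2 * cnj (g z) * z ^ m"
      using c_eq[OF z] by (simp add: T3_def field_simps zm)
    also have "\<dots> = c z * D z - am * w z"
      by (simp add: w_def D_def g_eq[OF z] algebra_simps power2_eq_square)
    finally show ?thesis by (simp add: \<Theta>_def field_simps)
  qed
  have Tq: "\<Theta>q z = z * Q"
    by (simp add: \<Theta>q_def Q_def zm)
  have *: "1/2 * e\<^sup>2 * M * rm * (- (M * zm * vb) * T * (\<Theta> + am) + \<rho> * (Q * (\<Theta> + am) + T * \<Theta>q))
     = - (1/2) * e\<^sup>2 * M\<^sup>2 * rm * v * vb * (\<Theta>\<^sup>2 - am\<^sup>2) + e\<^sup>2 * M * rm * \<rho> * \<Theta> * Q"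
    if "z * T = \<Theta> - am" "\<Theta>q = z * Q" "zm = z * v"
    for e M rm zm vb T \<Theta> am \<rho> Q \<Theta>q v z :: complex
    using that by algebra
  have "\<exists>p. has_wirt (\<lambda>z. 1/2 * \<epsilon>\<^sup>2 * M * rm * (\<rho> z * T3 z * (\<Theta> z + am))) p
    (- (1/2) * \<epsilon>\<^sup>2 * M\<^sup>2 * rm * v z * cnj (v z) * ((\<Theta> z)\<^sup>2 - am\<^sup>2) + \<epsilon>\<^sup>2 * M * rm * \<rho> z * \<Theta> z * Q) z"
    apply (rule exI, rule has_wirt_eqI, (rule wz wirt_Theta' wT has_wirt_const has_wirt_add has_wirt_mult)+)
     apply (rule refl)
    apply (subst *[OF zT Tq zm, symmetric])
    apply (simp add: algebra_simps)
    done
  then show ?thesis by (simp add: T3_def Q_def X3_def[abs_def])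
qed

lemma wirt_Psi: "has_wirt \<Psi> (\<Psi>p z) (\<Psi>q z) z"
  unfolding \<Psi>_def[abs_def]
  apply (rule has_wirt_eqI, (rule has_wirt_const wz has_wirt_mult wirt_Theta')+)
  apply (simp_all add: \<Psi>p_def \<Psi>q_def \<Theta>q_def J_def algebra_simps)
  done

end

context
  fixes z :: complex assumes z: "norm z < R"
begin

lemmas ww = wz[OF z] wirt_Theta'[OF z] wirt_v[OF z] wirt_cg'[OF z] wirt_g'[OF z] wirt_c'[OF z]

text \<open>Off the origin \<open>\<Psi> = \<epsilon> Q J\<close> with \<open>Q\<close> harmonic and
  \<open>J\<close> a Jacobi field, so only the cross terms \<open>Q_z J_zbar + Q_zbar J_z\<close>
  survive in \<open>L\<close>. The identity is checked in the form without poles, hence at 0 as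
  well.\<close>

lemma wirt_Psi_q: "\<exists>q. has_wirt \<Psi>q (H z) q z"
proof -
  have wc: "has_wirt (\<lambda>z. cnj (v z)) 0 (cnj (of_nat (m - 1) * z ^ (m - 2))) z"
    using has_wirt_cnj[OF wirt_v[OF z]] by simp
  have *: "- e * (M * vb * Jp + (- (M * v * u) * (c\<^sup>2 * zm * gpb * i\<^sup>2)
        + \<rho> * ((2 * c * c1 * zm + c\<^sup>2 * (M * v)) * gpb * i\<^sup>2 - 2 * c\<^sup>2 * zm * gpb * gp * gb * i ^ 3)))
     = e * M * (rm * v * c\<^sup>2 * gpb - vb * gp * D\<^sup>2) * i\<^sup>2 - 2 * gp * gpb * (e * (\<rho> * (c * D * i))) * i\<^sup>2"
    if "Jp = gp * D\<^sup>2 * i\<^sup>2" "gp = M * v * c + zm * c1" "\<rho> = rm - zm * u"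
      "D = w - c * zm * gb" "w * i = 1"
    for e M vb Jp v u c zm gpb i \<rho> c1 gp gb rm D w :: complex
  proof -
    have D: "D * i = 1 - c * zm * gb * i" using that(4,5) by algebra
    have "- (M * v * u) * (c\<^sup>2 * zm * gpb * i\<^sup>2)
        + \<rho> * ((2 * c * c1 * zm + c\<^sup>2 * (M * v)) * gpb * i\<^sup>2 - 2 * c\<^sup>2 * zm * gpb * gp * gb * i ^ 3)
      = - (M * rm * v * c\<^sup>2 * gpb * i\<^sup>2) + 2 * gp * gpb * \<rho> * c * (D * i) * i\<^sup>2"
      unfolding D that(2,3) by (simp add: algebra_simps power2_eq_square power3_eq_cube)
    then show ?thesis using that(1) by algebra
  qed
  have Dw: "D z = w z - c z * z ^ m * cnj (g z)"
    by (simp add: D_def w_def g_eq[OF z] algebra_simps)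
  have J: "Jp z = g' z * (D z)\<^sup>2 * (inverse (w z))\<^sup>2"
    by (simp add: Jp_def field_simps)
  have w2: "(w z)\<^sup>2 \<noteq> 0" by simp
  show ?thesis
    unfolding \<Psi>q_def[abs_def]
    apply (rule exI, rule has_wirt_eqI, (rule wc ww wirt_J[OF z] w_nz w2 has_wirt_const has_wirt_add has_wirt_mult has_wirt_divide has_wirt_power)+)
     apply (rule trans[OF _ trans[OF *[OF J g'_eq[OF z] rho_eq Dw, of \<epsilon> "cnj (v z)" "cnj (g' z)"]]])
       apply (simp add: field_simps power2_eq_square power3_eq_cube)
      apply simp
     apply (simp add: H_def L_def \<Psi>_def \<Theta>_def field_simps power2_eq_square)
    apply (rule refl)
    done
qed

lemma wirt_Thetap: "\<exists>p. has_wirt \<Theta>p p (- (cnj (g' z) * (2 * g' z * \<Theta> z - M * v z * (c z)\<^sup>2) / (w z)\<^sup>2)) z"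
proof -
  have *: "c1 * (a * gpb * w - D * (g * gpb)) * w\<^sup>2 - c * gp * ((a * gpb * gb + D * gpb) * w - 2 * D * gb * g * gpb) * w
      = - (gpb * (2 * gp * (c * D) - M * v * c\<^sup>2 * w)) * w"
    if "gp = M * v * c + zm * c1" "w = 1 + g * gb" "D = 1 + a * gb" "g = a + zm * c"
    for gp M v c D gpb c1 zm w a g gb :: complex
    using that by algebra
  have e: "c' z * (a0 * cnj (g' z) * w z - D z * (g z * cnj (g' z))) * (w z)\<^sup>2
      - c z * g' z * ((a0 * cnj (g' z) * cnj (g z) + D z * cnj (g' z)) * w z - 2 * D z * cnj (g z) * g z * cnj (g' z)) * w z
      = - (cnj (g' z) * (2 * g' z * (c z * D z) - M * v z * (c z)\<^sup>2 * w z)) * w z"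
    by (rule *[OF g'_eq[OF z] w_def D_def g_eq[OF z]])
  have w2: "(w z)\<^sup>2 \<noteq> 0" by simp
  show ?thesis
    unfolding \<Theta>p_def[abs_def]
    apply (rule exI, rule has_wirt_eqI, (rule ww w_nz w2 has_wirt_const has_wirt_diff has_wirt_cnj has_wirt_mult has_wirt_divide has_wirt_power)+)
     apply (rule refl)
    using e apply (simp add: \<Theta>_def divide_simps)
    apply algebra
    done
qed

text \<open>The same mixed derivative in the other order: \<open>P\<close> contains both
  \<open>\<Psi>p\<close> and \<open>cnj \<Psi>q\<close>, and its derivative in \<open>cnj z\<close>
  calls for the two orders at once.\<close>

lemma wirt_Psi_p: "\<exists>p. has_wirt \<Psi>p p (H z) z"
proof -
  obtain p where p: "has_wirt \<Theta>p p (- (cnj (g' z) * (2 * g' z * \<Theta> z - M * v z * (c z)\<^sup>2) / (w z)\<^sup>2)) z"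
    using wirt_Thetap by blast
  have *: "e * (- (M * v * (M * vb)) * \<Theta> + - (M * v * u) * \<Theta>q + (- (M * zm * vb) * \<Theta>p + \<rho> * (- (Y * (2 * gp * \<Theta> - M * v * c\<^sup>2)))))
     = e * (M * (rm * v * c\<^sup>2 * Y - vb * Jp) - 2 * gp * Y * (\<rho> * \<Theta>))"
    if "zm * \<Theta>p = Jp - M * v * \<Theta>" "\<Theta>q = - (c\<^sup>2 * zm * Y)" "\<rho> = rm - zm * u"
    for e M v vb \<Theta> u \<Theta>q zm \<Theta>p \<rho> Y gp c rm Jp :: complex
    using that by algebra
  have q: "\<Theta>q z = - ((c z)\<^sup>2 * z ^ m * (cnj (g' z) / (w z)\<^sup>2))"
    by (simp add: \<Theta>q_def)
  show ?thesis
    unfolding \<Psi>p_def[abs_def]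
    apply (rule exI, rule has_wirt_eqI, (rule p ww has_wirt_const has_wirt_add has_wirt_uminus has_wirt_mult)+)
     apply (rule refl)
    apply (rule trans[OF _ trans[OF *[OF zm_Thetap[OF z] q rho_eq, of \<epsilon> "cnj (v z)" "g' z"]]])
     apply (simp add: algebra_simps)
    apply (simp add: H_def L_def Jp_def \<Psi>_def field_simps)
    apply (simp add: H_def L_def Jp_def \<Psi>_def field_simps)
    done
qed

lemma wirt_phi: "has_wirt \<phi> (P z) (cnj (P z)) z"
  unfolding \<phi>_def[abs_def]
  by (rule has_wirt_eqI, (rule wirt_Psi[OF z] has_wirt_divide has_wirt_add has_wirt_cnj has_wirt_const)+)
     (auto simp: P_def field_simps)

text \<open>Green's identity in complex form: \<open>cnj P\<close> is the derivative of
  \<open>\<phi>\<close> in \<open>cnj z\<close>.\<close>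

lemma wirt_phiP: "\<exists>q. has_wirt (\<lambda>z. \<phi> z * cnj (P z)) (P z * cnj (P z) + \<phi> z * ((H z + cnj (H z)) / 2)) q z"
proof -
  obtain p q where "has_wirt \<Psi>p p (H z) z" "has_wirt \<Psi>q (H z) q z"
    using wirt_Psi_p wirt_Psi_q by blast
  then have "\<exists>p. has_wirt P p ((H z + cnj (H z)) / 2) z"
    unfolding P_def[abs_def]
    apply (intro exI)
    apply (rule has_wirt_eqI, (assumption | rule has_wirt_divide has_wirt_add has_wirt_cnj has_wirt_const)+)
      apply simp
     apply (rule refl)
    apply (simp add: field_simps)
    done
  then obtain p' where p': "has_wirt P p' ((H z + cnj (H z)) / 2) z" by blast
  show ?thesis
    by (rule exI, rule has_wirt_eqI[OF has_wirt_mult[OF wirt_phi has_wirt_cnj[OF p']]])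
       (auto simp: field_simps)
qed

text \<open>The divergence terms below come from writing \<open>\<Psi> = \<epsilon> (r^(2m) / z^m - cnj z ^ m) J\<close> with \<open>J\<close> a
  Jacobi field, and integrating by parts once more in \<open>\<Psi> L\<close> and \<open>cnj \<Psi> L\<close>, using
  \<open>cnj J J_z = \<sigma>_z (K - \<sigma>)\<close> and \<open>cnj J J_zbar = - \<sigma> \<sigma>_zbar\<close>.\<close>

definition E where "E = 2 * (P z * cnj (P z) + \<phi> z * ((H z + cnj (H z)) / 2))
  + (1/2 * M\<^sup>2 * rm\<^sup>2 * v z * cnj (v z) * (S z)\<^sup>2 - M * rm * \<rho> z * v z * S z * T z)
  + (M * cnj (v z) * \<rho> z * cnj (T z) * (K - \<sigma> z) + 1/2 * M\<^sup>2 * v z * cnj (v z) * ((K - \<sigma> z)\<^sup>2 - K\<^sup>2))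
  + (- (1/2) * \<epsilon>\<^sup>2 * M\<^sup>2 * rm * v z * cnj (v z) * ((\<Theta> z)\<^sup>2 - am\<^sup>2)
      - \<epsilon>\<^sup>2 * M * rm * \<rho> z * \<Theta> z * ((c z)\<^sup>2 * v z * cnj (g' z) / (w z)\<^sup>2))
  + (\<epsilon>\<^sup>2 * M * \<rho> z * cnj (v z) * \<Theta> z * Jp z - 1/2 * \<epsilon>\<^sup>2 * M\<^sup>2 * rm * v z * cnj (v z) * (\<Theta> z)\<^sup>2)"

definition N where "N = M\<^sup>2 * (v z * cnj (v z)) * (rm\<^sup>2 * (S z)\<^sup>2 + (K - \<sigma> z)\<^sup>2
  - rm * (\<epsilon>\<^sup>2 * (\<Theta> z)\<^sup>2 + cnj (\<epsilon>\<^sup>2 * (\<Theta> z)\<^sup>2)))"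

text \<open>Lagrange's identity \<open>|D|^2 + |g - a0|^2 = K w\<close>, divided by
  \<open>w\<close>.\<close>

lemma D_cnj_D: "D z * cnj (D z) / w z = K - \<sigma> z"
proof -
  have "D z * cnj (D z) = K * w z - z ^ m * c z * cnj (z ^ m * c z)"
    using g_eq[OF z] by (simp add: D_def K_def w_def algebra_simps)
  then show ?thesis by (simp add: \<sigma>_def S_def field_simps)
qed

lemma eps_sq: "\<epsilon> * cnj \<epsilon> = 1"
  using eps(1) by (simp add: complex_norm_square[symmetric])

lemma eps_am: "\<epsilon>\<^sup>2 * am\<^sup>2 = am * cnj am"
  using eps(2) by (metis complex_norm_square of_real_power power_mult_distrib)

lemma cnj_rho [simp]: "cnj (\<rho> z) = \<rho> z" by (simp add: \<rho>_def mult.commute)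
lemma cnj_K [simp]: "cnj K = K" by (simp add: K_def mult.commute)
lemma cnj_rm [simp]: "cnj rm = rm" by (simp add: rm_def)
lemma cnj_sigma [simp]: "cnj (\<sigma> z) = \<sigma> z" by (simp add: \<sigma>_def mult.commute)

lemma PsiL: "- (\<Psi> z * L z) = - (\<epsilon>\<^sup>2 * M * rm * \<rho> z * \<Theta> z * ((c z)\<^sup>2 * v z * cnj (g' z) / (w z)\<^sup>2))
   + \<epsilon>\<^sup>2 * M * \<rho> z * cnj (v z) * \<Theta> z * Jp z"
  by (simp add: \<Psi>_def L_def Jp_def field_simps power2_eq_square)

lemma cnjPsiL: "- (cnj (\<Psi> z) * L z) = - (M * rm * \<rho> z * v z * S z * T z)
   + M * cnj (v z) * \<rho> z * cnj (T z) * (K - \<sigma> z)"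
proof -
  have "- (cnj (\<Psi> z) * L z) = - ((\<epsilon> * cnj \<epsilon>) * M * \<rho> z * (c z * cnj (c z) / w z)
     * (rm * v z * (c z * cnj (g' z) * cnj (D z) / (w z)\<^sup>2)) )
     + (\<epsilon> * cnj \<epsilon>) * M * \<rho> z * cnj (v z) * (cnj (c z) * g' z * D z / (w z)\<^sup>2) * (D z * cnj (D z) / w z)"
    by (simp add: \<Psi>_def L_def \<Theta>_def field_simps power2_eq_square)
  then show ?thesis
    unfolding eps_sq D_cnj_D by (simp add: S_def T_def mult_ac)
qed

text \<open>Modulo divergences \<open>4 |P|^2\<close> is \<open>- 4 \<phi> Re H\<close>. The
  zero-order part of \<open>H\<close> cancels the curvature term, leaving
  \<open>- 4 \<phi> Re L = - 2 Re (\<Psi> L + cnj \<Psi> L)\<close>; the four potentials turn this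
  into multiples of \<open>|v|^2\<close>, collected in \<open>Z\<close>.\<close>

lemma E_eq: "4 * (P z * cnj (P z)) - 8 * (g' z * cnj (g' z) / (w z)\<^sup>2) * (\<phi> z)\<^sup>2
   = E + cnj E - N + M\<^sup>2 * (v z * cnj (v z)) * (K\<^sup>2 - rm * (am * cnj am))"
proof -
  define Z where "Z = 1/2 * M\<^sup>2 * v z * cnj (v z) * (rm\<^sup>2 * (S z)\<^sup>2 + (K - \<sigma> z)\<^sup>2 - 2 * rm * (\<epsilon>\<^sup>2 * (\<Theta> z)\<^sup>2)
     - K\<^sup>2 + rm * (\<epsilon>\<^sup>2 * am\<^sup>2))"
  have E: "E = 2 * (P z * cnj (P z)) + \<phi> z * (H z + cnj (H z)) - \<Psi> z * L z - cnj (\<Psi> z) * L z + Z"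
  proof -
    have *: "- (\<Psi> z * L z) + - (cnj (\<Psi> z) * L z) = - (\<epsilon>\<^sup>2 * M * rm * \<rho> z * \<Theta> z * ((c z)\<^sup>2 * v z * cnj (g' z) / (w z)\<^sup>2))
       + \<epsilon>\<^sup>2 * M * \<rho> z * cnj (v z) * \<Theta> z * Jp z + (- (M * rm * \<rho> z * v z * S z * T z)
       + M * cnj (v z) * \<rho> z * cnj (T z) * (K - \<sigma> z))"
      unfolding PsiL cnjPsiL ..
    define Y where "Y = (c z)\<^sup>2 * v z * cnj (g' z) / (w z)\<^sup>2"
    show ?thesis
      using * unfolding E_def Z_def Y_def[symmetric] by algebra
  qed
  have cZ: "Z + cnj Z = N - M\<^sup>2 * (v z * cnj (v z)) * (K\<^sup>2 - rm * (am * cnj am))"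
    unfolding Z_def N_def eps_am by (simp add: algebra_simps)
  have cp: "cnj (\<phi> z) = \<phi> z" by (simp add: \<phi>_def add.commute)
  have H: "H z = L z - 2 * (g' z * cnj (g' z) / (w z)\<^sup>2) * \<Psi> z"
    by (simp add: H_def)
  have f1: "E + cnj E = 4 * (P z * cnj (P z)) + 2 * \<phi> z * (H z + cnj (H z))
      - (\<Psi> z + cnj (\<Psi> z)) * (L z + cnj (L z)) + (Z + cnj Z)"
    unfolding E by (simp add: cp algebra_simps)
  have f2: "2 * \<phi> z * (H z + cnj (H z)) = (\<Psi> z + cnj (\<Psi> z)) * (L z + cnj (L z))
      - 8 * (g' z * cnj (g' z) / (w z)\<^sup>2) * (\<phi> z)\<^sup>2"
    unfolding \<phi>_def H by (simp add: field_simps power2_eq_square)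
  define Y where "Y = g' z * cnj (g' z) / (w z)\<^sup>2"
  show ?thesis
    using f1[unfolded cZ] f2 unfolding Y_def[symmetric] by algebra
qed

end

section \<open>Sign of the index form\<close>

text \<open>Because \<open>\<Theta> = c D / w\<close>, the modulus of
  \<open>\<epsilon>^2 \<Theta>^2\<close> is exactly \<open>s * k\<close>; the bracket is therefore
  at least the square of \<open>r^(2m) s - k\<close>.\<close>

lemma N_nonneg: assumes z: "norm z < R" shows "Re (N z) \<ge> 0"
proof -
  define s where "s = (norm (c z))\<^sup>2 / (1 + (norm (g z))\<^sup>2)"
  define k where "k = (norm (D z))\<^sup>2 / (1 + (norm (g z))\<^sup>2)"
  define x where "x = Re (\<epsilon>\<^sup>2 * (\<Theta> z)\<^sup>2)"
  have S: "S z = of_real s"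
    by (simp only: S_def s_def w_of_real of_real_divide complex_norm_square[symmetric])
  have k: "K - \<sigma> z = of_real k"
    by (simp only: D_cnj_D[OF z, symmetric] k_def w_of_real of_real_divide complex_norm_square[symmetric])
  have "norm (\<epsilon>\<^sup>2 * (\<Theta> z)\<^sup>2) = s * k"
    using eps(1) by (simp add: \<Theta>_def w_of_real norm_mult norm_power norm_divide s_def k_def power_divide
        power_mult_distrib power2_eq_square del: of_real_add of_real_power)
  then have "x \<le> s * k" unfolding x_def by (metis complex_Re_le_cmod)
  then have "2 * r ^ (2 * m) * x \<le> 2 * r ^ (2 * m) * (s * k)"
    using r by (intro mult_left_mono) auto
  moreover have "0 \<le> (r ^ (2 * m) * s - k)\<^sup>2" by simp
  ultimately have pos: "0 \<le> (r ^ (2 * m))\<^sup>2 * s\<^sup>2 + k\<^sup>2 - r ^ (2 * m) * (2 * x)"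
    by (simp add: power2_eq_square algebra_simps)
  have "\<epsilon>\<^sup>2 * (\<Theta> z)\<^sup>2 + cnj (\<epsilon>\<^sup>2 * (\<Theta> z)\<^sup>2) = of_real (2 * x)"
    by (simp only: complex_add_cnj x_def)
  then have "N z = of_real (real m ^ 2 * (norm (v z))\<^sup>2 * ((r ^ (2 * m))\<^sup>2 * s\<^sup>2 + k\<^sup>2 - r ^ (2 * m) * (2 * x)))"
    unfolding N_def[OF z] S k rm_def complex_norm_square[symmetric]
    by (simp only: of_real_mult of_real_add of_real_diff of_real_power of_real_of_nat_eq)
  then have "Re (N z) = real m ^ 2 * (norm (v z))\<^sup>2 * ((r ^ (2 * m))\<^sup>2 * s\<^sup>2 + k\<^sup>2 - r ^ (2 * m) * (2 * x))"
    by (simp only: Re_complex_of_real)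
  then show ?thesis using pos by simp
qed

abbreviation U where "U \<equiv> ball (0::complex) R"

lemma Ck_basic:
  "Ck n U g" "Ck n U c" "Ck n U d" "Ck n U g'" "Ck n U c'" "Ck n U (\<lambda>z. z)"
  using hol by (auto intro!: Ck_holomorphic holomorphic_deriv holomorphic_intros)

lemmas Ck_intros = Ck_add Ck_diff Ck_mult Ck_divide Ck_power Ck_const Ck_cnj Ck_uminus open_ball

lemma Ck_w: "Ck n U w" unfolding w_def[abs_def] by (intro Ck_intros Ck_basic)
lemma Ck_D: "Ck n U D" unfolding D_def[abs_def] by (intro Ck_intros Ck_basic)
lemma Ck_v: "Ck n U v" unfolding v_def[abs_def] by (intro Ck_intros Ck_basic)
lemma Ck_rho: "Ck n U \<rho>" unfolding \<rho>_def[abs_def] by (intro Ck_intros Ck_basic)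
lemma Ck_S: "Ck n U S" unfolding S_def[abs_def] by (intro Ck_intros Ck_basic Ck_w w_nz)
lemma Ck_Theta: "Ck n U \<Theta>" unfolding \<Theta>_def[abs_def] by (intro Ck_intros Ck_basic Ck_w Ck_D w_nz)
lemma Ck_J: "Ck n U J" unfolding J_def[abs_def] by (intro Ck_intros Ck_basic Ck_Theta)
lemma Ck_sigma: "Ck n U \<sigma>" unfolding \<sigma>_def[abs_def] by (intro Ck_intros Ck_basic Ck_S)
lemma Ck_Psi: "Ck n U \<Psi>" unfolding \<Psi>_def[abs_def] by (intro Ck_intros Ck_rho Ck_Theta)
lemma Ck_phi: "Ck n U \<phi>" unfolding \<phi>_def[abs_def] by (intro Ck_intros Ck_Psi) auto

lemma w2_nz: "(w z)\<^sup>2 \<noteq> 0" by simp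

lemma Ck_P: "Ck n U P"
  unfolding P_def[abs_def] \<Psi>p_def \<Psi>q_def \<Theta>p_def
  by (intro Ck_intros Ck_basic Ck_v Ck_rho Ck_Theta Ck_J Ck_w Ck_D w_nz w2_nz) auto

lemma Ck_X: "Ck n U X1" "Ck n U X2" "Ck n U X3" "Ck n U X4"
  unfolding X1_def[abs_def] X2_def[abs_def] X3_def[abs_def] X4_def[abs_def]
  by (intro Ck_intros Ck_basic Ck_v Ck_rho Ck_Theta Ck_J Ck_w Ck_S Ck_sigma w_nz)+

lemma rho_0: assumes "norm z = r" shows "\<rho> z = 0"
proof -
  have "z ^ m * cnj z ^ m = of_real ((norm z)\<^sup>2) ^ m"
    by (simp only: complex_norm_square power_mult_distrib)
  then show ?thesis using assms by (simp add: \<rho>_def power_mult)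
qed

lemma E_integral: "(E has_integral 0) (cball 0 r)"
proof -
  have sub: "cball 0 r \<subseteq> U" using r by auto
  have lt: "norm z < R" if "norm z \<le> r" for z :: complex using that r by linarith
  note p = has_integral_wirt_cball(1)[OF open_ball sub] and q = has_integral_wirt_cball(2)[OF open_ball sub]
  have 0: "((\<lambda>z. P z * cnj (P z) + \<phi> z * ((H z + cnj (H z)) / 2)) has_integral 0) (cball 0 r)"
  proof (rule p[where F = "\<lambda>z. \<phi> z * cnj (P z)" and n = 0, OF _ _ wirt_phiP[OF lt]])
    show "Ck (Suc 0) U (\<lambda>z. \<phi> z * cnj (P z))"
      by (intro Ck_intros Ck_phi Ck_P)
  qed (simp_all add: \<phi>_def \<Psi>_def rho_0)
  have X0: "X1 z = 0" "X2 z = 0" "X3 z = 0" "X4 z = 0" if "norm z = r" for z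
    using rho_0[OF that] by (auto simp: X1_def X2_def X3_def X4_def)
  have 1: "((\<lambda>z. 1/2 * M\<^sup>2 * rm\<^sup>2 * v z * cnj (v z) * (S z)\<^sup>2 - M * rm * \<rho> z * v z * S z * T z) has_integral 0) (cball 0 r)"
    using lt by (intro q[OF Ck_X(1)[of "Suc 0"]] X0 wirt_X1) auto
  have 2: "((\<lambda>z. M * cnj (v z) * \<rho> z * cnj (T z) * (K - \<sigma> z) + 1/2 * M\<^sup>2 * v z * cnj (v z) * ((K - \<sigma> z)\<^sup>2 - K\<^sup>2)) has_integral 0) (cball 0 r)"
    using lt by (intro p[OF Ck_X(2)[of "Suc 0"]] X0 wirt_X2) auto
  have 3: "((\<lambda>z. - (1/2) * \<epsilon>\<^sup>2 * M\<^sup>2 * rm * v z * cnj (v z) * ((\<Theta> z)\<^sup>2 - am\<^sup>2)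
      - \<epsilon>\<^sup>2 * M * rm * \<rho> z * \<Theta> z * ((c z)\<^sup>2 * v z * cnj (g' z) / (w z)\<^sup>2)) has_integral 0) (cball 0 r)"
    using lt by (intro q[OF Ck_X(3)[of "Suc 0"]] X0 wirt_X3) auto
  have 4: "((\<lambda>z. \<epsilon>\<^sup>2 * M * \<rho> z * cnj (v z) * \<Theta> z * Jp z - 1/2 * \<epsilon>\<^sup>2 * M\<^sup>2 * rm * v z * cnj (v z) * (\<Theta> z)\<^sup>2) has_integral 0) (cball 0 r)"
    using lt by (intro p[OF Ck_X(4)[of "Suc 0"]] X0 wirt_X4) auto
  have "((\<lambda>z. E z) has_integral (2 * 0 + 0 + 0 + 0 + 0)) (cball 0 r)"
  proof (rule has_integral_eq)
    show "((\<lambda>z. 2 * (P z * cnj (P z) + \<phi> z * ((H z + cnj (H z)) / 2)) + (1/2 * M\<^sup>2 * rm\<^sup>2 * v z * cnj (v z) * (S z)\<^sup>2 - M * rm * \<rho> z * v z * S z * T z)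
       + (M * cnj (v z) * \<rho> z * cnj (T z) * (K - \<sigma> z) + 1/2 * M\<^sup>2 * v z * cnj (v z) * ((K - \<sigma> z)\<^sup>2 - K\<^sup>2))
       + (- (1/2) * \<epsilon>\<^sup>2 * M\<^sup>2 * rm * v z * cnj (v z) * ((\<Theta> z)\<^sup>2 - am\<^sup>2)
      - \<epsilon>\<^sup>2 * M * rm * \<rho> z * \<Theta> z * ((c z)\<^sup>2 * v z * cnj (g' z) / (w z)\<^sup>2))
       + (\<epsilon>\<^sup>2 * M * \<rho> z * cnj (v z) * \<Theta> z * Jp z - 1/2 * \<epsilon>\<^sup>2 * M\<^sup>2 * rm * v z * cnj (v z) * (\<Theta> z)\<^sup>2)) has_integral (2 * 0 + 0 + 0 + 0 + 0)) (cball 0 r)"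
      by (rule has_integral_add has_integral_mult_right 0 1 2 3 4)+
  qed (simp add: E_def lt)
  then show ?thesis by simp
qed


definition index_integrand where
  "index_integrand z = 4 * (norm (P z))\<^sup>2 - 8 * (norm (g' z))\<^sup>2 / (1 + (norm (g z))\<^sup>2)\<^sup>2 * (Re (\<phi> z))\<^sup>2"

lemma phi_real: "\<phi> z = of_real (Re (\<phi> z))"
  by (simp add: \<phi>_def complex_eq_iff)

lemma index_le:
  assumes z: "norm z < R"
  shows "index_integrand z \<le> 2 * Re (E z)
     + (real m)\<^sup>2 * (norm (v z))\<^sup>2 * ((1 + (norm a0)\<^sup>2)\<^sup>2 - r ^ (2 * m) * (norm am)\<^sup>2)"
proof -
  obtain q where q: "\<phi> z = of_real q" using phi_real by blast
  have "of_real (index_integrand z) = E z + cnj (E z) - N z +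
     of_real ((real m)\<^sup>2 * (norm (v z))\<^sup>2 * ((1 + (norm a0)\<^sup>2)\<^sup>2 - r ^ (2 * m) * (norm am)\<^sup>2))"
  proof -
    have "of_real (index_integrand z) = 4 * (P z * cnj (P z)) - 8 * (g' z * cnj (g' z) / (w z)\<^sup>2) * (\<phi> z)\<^sup>2"
      unfolding index_integrand_def q w_of_real
      by (simp only: complex_norm_square[symmetric]) (simp add: power2_eq_square)
    also note E_eq[OF z]
    also have "M\<^sup>2 * (v z * cnj (v z)) * (K\<^sup>2 - rm * (am * cnj am)) =
       of_real ((real m)\<^sup>2 * (norm (v z))\<^sup>2 * ((1 + (norm a0)\<^sup>2)\<^sup>2 - r ^ (2 * m) * (norm am)\<^sup>2))"
      unfolding K_def rm_def by (simp only: complex_norm_square[symmetric]) simp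
    finally show ?thesis .
  qed
  from arg_cong[OF this, of Re] show ?thesis
    using N_nonneg[OF z] by (simp only: plus_complex.sel minus_complex.sel complex_cnj Re_complex_of_real cnj.sel)
qed

lemma index_continuous: "continuous_on (cball 0 r) index_integrand"
proof -
  have "continuous_on U F" if "Ck 0 U F" for F :: "complex \<Rightarrow> complex"
    using that by simp
  then have "continuous_on U P" "continuous_on U g'" "continuous_on U g" "continuous_on U \<phi>"
    using Ck_P[of 0] Ck_basic[of 0] Ck_phi[of 0] by auto
  moreover have "1 + (norm (g z))\<^sup>2 \<noteq> 0" for z
    by (smt (verit) zero_le_power2)
  ultimately have "continuous_on U index_integrand"
    unfolding index_integrand_def[abs_def] by (intro continuous_intros) auto
  then show ?thesis by (rule continuous_on_subset) (use r in auto)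
qed

lemma integral_v_pos: "integral (cball 0 r) (\<lambda>z. (norm (v z))\<^sup>2) > 0"
proof -
  \<comment> \<open>Centre \<open>3 r / 4\<close> and radius \<open>r / 4\<close> keep the ball
    inside the disc and at distance at least \<open>r / 2\<close> from 0, the only possible zero of
    \<open>v\<close>.\<close>
  define B where "B = cball (of_real (3 * r / 4) :: complex) (r / 4)"
  have B: "r / 2 \<le> norm z" "norm z \<le> r" if "z \<in> B" for z
    using that norm_triangle_ineq2[of "of_real (3 * r / 4)" z] norm_triangle_ineq2[of z "of_real (3 * r / 4)"] r
    by (auto simp: B_def dist_norm norm_minus_commute)
  have cont: "continuous_on A (\<lambda>z. (norm (v z))\<^sup>2)" for A
    unfolding v_def by (intro continuous_intros)
  have "0 < measure lebesgue B * ((r / 2) ^ (m - 1))\<^sup>2"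
    unfolding B_def using r by (auto intro!: mult_pos_pos content_cball_pos)
  also have "\<dots> = integral B (\<lambda>z. ((r / 2) ^ (m - 1))\<^sup>2)"
    using integral_mult_right[of B "((r / 2) ^ (m - 1))\<^sup>2" "\<lambda>z. 1"] lmeasure_integral[of B]
    by (simp add: B_def)
  also have "\<dots> \<le> integral B (\<lambda>z. (norm (v z))\<^sup>2)"
  proof (rule integral_le)
    show "((r / 2) ^ (m - 1))\<^sup>2 \<le> (norm (v z))\<^sup>2" if "z \<in> B" for z
      unfolding v_def norm_power using B[OF that] r by (intro power_mono) auto
  qed (auto intro!: integrable_on_compact_continuous cont simp: B_def)
  also have "\<dots> \<le> integral (cball 0 r) (\<lambda>z. (norm (v z))\<^sup>2)"
    by (rule integral_subset_le) (use B in \<open>auto intro!: integrable_on_compact_continuous cont simp: B_def\<close>)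
  finally show ?thesis .
qed

lemma index_negative:
  assumes "1 + (norm a0)\<^sup>2 < norm am * r ^ m"
  shows "integral (cball 0 r) index_integrand < 0"
proof -
  define C where "C = (1 + (norm a0)\<^sup>2)\<^sup>2 - r ^ (2 * m) * (norm am)\<^sup>2"
  have "(1 + (norm a0)\<^sup>2)\<^sup>2 < (norm am * r ^ m)\<^sup>2"
    using assms by (intro power_strict_mono) auto
  also have "\<dots> = r ^ (2 * m) * (norm am)\<^sup>2"
    by (simp add: power_mult_distrib power_mult[symmetric] mult_ac)
  finally have C: "C < 0" by (simp add: C_def)
  have vi: "(\<lambda>z. (norm (v z))\<^sup>2) integrable_on cball 0 r"
    unfolding v_def by (intro integrable_on_compact_continuous continuous_intros) auto
  have E: "((\<lambda>z. Re (E z)) has_integral 0) (cball 0 r)"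
    using has_integral_linear[OF E_integral bounded_linear_Re] by (simp add: o_def)
  have i1: "((\<lambda>z. 2 * Re (E z) + (real m)\<^sup>2 * C * (norm (v z))\<^sup>2) has_integral
      (2 * 0 + (real m)\<^sup>2 * C * integral (cball 0 r) (\<lambda>z. (norm (v z))\<^sup>2))) (cball 0 r)"
    by (intro has_integral_add has_integral_mult_right E integrable_integral vi)
  have i2: "(index_integrand has_integral integral (cball 0 r) index_integrand) (cball 0 r)"
    by (intro integrable_integral integrable_on_compact_continuous index_continuous) auto
  have "integral (cball 0 r) index_integrand \<le>
      2 * 0 + (real m)\<^sup>2 * C * integral (cball 0 r) (\<lambda>z. (norm (v z))\<^sup>2)"
  proof (rule has_integral_le[OF i2 i1])
    show "index_integrand z \<le> 2 * Re (E z) + (real m)\<^sup>2 * C * (norm (v z))\<^sup>2" if "z \<in> cball 0 r" for z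
      using index_le[of z] that r by (simp add: C_def mult_ac)
  qed
  also have "\<dots> < 0"
    using C m integral_v_pos by (simp add: mult_pos_neg mult_neg_pos)
  finally show ?thesis .
qed

end

section \<open>Logarithmic cutoffs\<close>

text \<open>Near a zero \<open>z0\<close> of order \<open>n\<close> the logarithmic derivative is \<open>n / (z - z0)\<close> up to a bounded term.\<close>

lemma log_deriv_bound_near:
  assumes "open S" "connected S" "f holomorphic_on S" "\<exists>w\<in>S. f w \<noteq> 0" "z0 \<in> S"
  shows "\<exists>e>0. \<exists>n::nat. \<forall>z\<in>ball z0 e. norm (deriv f z) * norm (z - z0) \<le> (real n + 1) * norm (f z)"
proof -
  have "\<exists>g e n. e > 0 \<and> ball z0 e \<subseteq> S \<and> g holomorphic_on ball z0 e \<and>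
      (\<forall>w\<in>ball z0 e. f w = (w - z0) ^ n * g w \<and> g w \<noteq> 0)"
  proof (cases "f z0 = 0")
    case True
    have "\<not> f constant_on S"
      using True assms(4,5) unfolding constant_on_def by metis
    then obtain g e n where "0 < (n::nat)" "0 < e" "ball z0 e \<subseteq> S" "g holomorphic_on ball z0 e"
      "\<And>w. w \<in> ball z0 e \<Longrightarrow> f w = (w - z0) ^ n * g w" "\<And>w. w \<in> ball z0 e \<Longrightarrow> g w \<noteq> 0"
      using holomorphic_factor_zero_nonconstant[OF assms(3,1,2,5) True] by metis
    then show ?thesis by blast
  next
    case False
    have "continuous (at z0) f"
      using assms by (meson holomorphic_on_imp_continuous_on continuous_on_eq_continuous_at)
    then obtain d where d: "d > 0" "\<And>w. dist z0 w < d \<Longrightarrow> f w \<noteq> 0"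
      using continuous_at_avoid[of z0 f 0] False by auto
    obtain e where e: "e > 0" "ball z0 e \<subseteq> S"
      using assms(1,5) open_contains_ball by blast
    have "f holomorphic_on ball z0 (min d e)"
      by (rule holomorphic_on_subset[OF assms(3)]) (use e in auto)
    then show ?thesis
      using d e by (intro exI[of _ f] exI[of _ "min d e"] exI[of _ 0]) (auto simp: dist_commute)
  qed
  then obtain g e n where e: "e > 0" "ball z0 e \<subseteq> S" and g: "g holomorphic_on ball z0 e"
    and fg: "\<And>w. w \<in> ball z0 e \<Longrightarrow> f w = (w - z0) ^ n * g w" "\<And>w. w \<in> ball z0 e \<Longrightarrow> g w \<noteq> 0"
    by blast
  \<comment> \<open>\<open>(z - z0) f' / f = n + q\<close>, and \<open>q\<close> vanishes at
    \<open>z0\<close>, so it is below 1 in modulus nearby.\<close>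
  define q where "q w = (w - z0) * (deriv g w / g w)" for w
  have "continuous_on (ball z0 e) q"
    unfolding q_def using fg(2) g
    by (intro continuous_intros holomorphic_on_imp_continuous_on holomorphic_deriv) auto
  then have "isCont q z0"
    using e(1) by (simp add: continuous_on_eq_continuous_at)
  then obtain d where d: "d > 0" "\<And>w. dist w z0 < d \<Longrightarrow> norm (q w) < 1"
    using continuous_within_eps_delta[of z0 UNIV q, THEN iffD1, rule_format, of 1] by (auto simp: q_def)
  have "norm (deriv f z) * norm (z - z0) \<le> (real n + 1) * norm (f z)" if "z \<in> ball z0 (min d e)" for z
  proof -
    have z: "z \<in> ball z0 e" "norm (q z) < 1" using that d(2)[of z] by (auto simp: dist_commute)
    have "(f has_field_derivative (of_nat n * (z - z0) ^ (n - 1) * g z + (z - z0) ^ n * deriv g z)) (at z)"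
    proof (rule has_field_derivative_transform_within_open[of _ _ _ "ball z0 e"])
      show "((\<lambda>w. (w - z0) ^ n * g w) has_field_derivative
          (of_nat n * (z - z0) ^ (n - 1) * g z + (z - z0) ^ n * deriv g z)) (at z)"
        by (auto intro!: derivative_eq_intros holomorphic_derivI[OF g open_ball z(1)])
    qed (use z fg in auto)
    then have "deriv f z * (z - z0) = of_nat n * ((z - z0) ^ (n - 1) * (z - z0)) * g z + (z - z0) ^ n * deriv g z * (z - z0)"
      by (simp add: DERIV_imp_deriv algebra_simps)
    also have "of_nat n * ((z - z0) ^ (n - 1) * (z - z0)) = of_nat n * (z - z0) ^ n"
      by (cases n) auto
    also have "of_nat n * (z - z0) ^ n * g z + (z - z0) ^ n * deriv g z * (z - z0) = (of_nat n + q z) * f z"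
      using fg[OF z(1)] by (simp add: q_def field_simps)
    finally have "norm (deriv f z) * norm (z - z0) = norm (of_nat n + q z) * norm (f z)"
      by (metis norm_mult)
    also have "\<dots> \<le> (real n + 1) * norm (f z)"
      using z(2) norm_triangle_ineq[of "of_nat n" "q z"] by (intro mult_right_mono) auto
    finally show ?thesis .
  qed
  then show ?thesis using d e by (intro exI[of _ "min d e"] conjI exI[of _ n]) auto
qed

text \<open>A finite subcover of the local estimates: \<open>Z\<close> consists of its centres,
  which need not be zeros of \<open>f\<close>. A common constant is taken because the two bounds are
  squared and added later.\<close>

lemma log_deriv_bound:
  assumes "open S" "connected S" "f holomorphic_on S" "\<exists>w\<in>S. f w \<noteq> 0" "compact A" "A \<subseteq> S"
  obtains Z C where "finite Z" "C \<ge> 0"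
    "\<And>z. z \<in> A \<Longrightarrow> norm (deriv f z) \<le> C"
    "\<And>z. z \<in> A \<Longrightarrow> \<exists>\<zeta>\<in>Z. norm (deriv f z) * norm (z - \<zeta>) \<le> C * norm (f z)"
proof -
  obtain e n where en: "\<And>z0. z0 \<in> A \<Longrightarrow> e z0 > 0 \<and>
     (\<forall>z\<in>ball z0 (e z0). norm (deriv f z) * norm (z - z0) \<le> (real (n z0) + 1) * norm (f z))"
    using log_deriv_bound_near[OF assms(1-4)] assms(6) by (metis subsetD)
  have "A \<subseteq> (\<Union>z0\<in>A. ball z0 (e z0))" using en by force
  then obtain Z where Z: "Z \<subseteq> A" "finite Z" "A \<subseteq> (\<Union>z0\<in>Z. ball z0 (e z0))"
    using compactE_image[OF assms(5), of A "\<lambda>z0. ball z0 (e z0)"] by auto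
  have "continuous_on A (deriv f)"
    using assms by (meson continuous_on_subset holomorphic_deriv holomorphic_on_imp_continuous_on)
  then have "bounded (deriv f ` A)"
    using assms(5) compact_continuous_image compact_imp_bounded by blast
  then obtain B where B: "\<And>z. z \<in> A \<Longrightarrow> norm (deriv f z) \<le> B" by (auto simp: bounded_iff)
  define C where "C = \<bar>B\<bar> + (\<Sum>\<zeta>\<in>Z. real (n \<zeta>) + 1)"
  show ?thesis
  proof (rule that[OF Z(2)])
    have s: "(\<Sum>\<zeta>\<in>Z. real (n \<zeta>) + 1) \<ge> 0" by (intro sum_nonneg) auto
    then show "C \<ge> 0" by (simp add: C_def)
    show "norm (deriv f z) \<le> C" if "z \<in> A" for z using B[OF that] s by (simp add: C_def)
    show "\<exists>\<zeta>\<in>Z. norm (deriv f z) * norm (z - \<zeta>) \<le> C * norm (f z)" if zA: "z \<in> A" for z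
    proof -
      obtain \<zeta> where \<zeta>: "\<zeta> \<in> Z" "z \<in> ball \<zeta> (e \<zeta>)" using Z(3) zA by blast
      have "norm (deriv f z) * norm (z - \<zeta>) \<le> (real (n \<zeta>) + 1) * norm (f z)"
        using en[of \<zeta>] \<zeta> Z(1) by auto
      also have "\<dots> \<le> C * norm (f z)"
      proof (rule mult_right_mono)
        have "real (n \<zeta>) + 1 \<le> (\<Sum>\<zeta>\<in>Z. real (n \<zeta>) + 1)"
          by (rule member_le_sum[OF \<zeta>(1)]) (use Z in auto)
        then show "real (n \<zeta>) + 1 \<le> C" by (simp add: C_def)
      qed simp
      finally show ?thesis using \<zeta>(1) by blast
    qed
  qed
qed

text \<open>If \<open>(1/2)^(k+1) < x \<le> (1/2)^k\<close>, the summand of index \<open>k\<close>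
  alone dominates \<open>1 / x^2\<close>. The summand 1 covers \<open>x > 1\<close>, and the last
  index covers \<open>x \<le> (1/2)^n\<close>. Step functions on discs make the integral elementary,
  without polar coordinates.\<close>

lemma inverse_square_dyadic:
  fixes x :: real
  assumes "x \<ge> 0"
  shows "1 / (x\<^sup>2 + (1/4) ^ n) \<le> 1 + (\<Sum>k\<le>n. 4 ^ Suc k * (if x \<le> (1/2) ^ k then 1 else 0))"
proof -
  have q: "((1/2) ^ k)\<^sup>2 = (1/4 :: real) ^ k" for k
    by (simp add: power_mult_distrib[symmetric] power_commutes power2_eq_square flip: power_mult_distrib)
  have far: "1 / x\<^sup>2 \<le> 1 + (\<Sum>k<n. 4 ^ Suc k * (if x \<le> (1/2) ^ k then 1 else 0))" if "x > (1/2) ^ n" for n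
    using that
  proof (induction n)
    case 0
    then have "1 \<le> x\<^sup>2" by (simp add: one_le_power)
    then show ?case by (simp add: divide_le_eq)
  next
    case (Suc n)
    have *: "0 \<le> (\<Sum>k<n. 4 ^ Suc k * (if x \<le> (1/2) ^ k then 1 else 0 :: real))"
      by (intro sum_nonneg) auto
    show ?case
    proof (cases "x > (1/2) ^ n")
      case True
      then show ?thesis using Suc.IH by simp
    next
      case False
      have "((1/2) ^ Suc n)\<^sup>2 < x\<^sup>2" using Suc.prems by (intro power_strict_mono) auto
      then have "(1/4) ^ Suc n < x\<^sup>2" by (simp only: q)
      moreover have "x > 0" using Suc.prems by (rule le_less_trans[rotated]) simp
      ultimately have "1 / x\<^sup>2 \<le> 1 / (1/4) ^ Suc n" by (intro divide_left_mono mult_pos_pos) auto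
      also have "\<dots> = 4 ^ Suc n" by (simp add: power_one_over)
      finally show ?thesis using False * by simp
    qed
  qed
  show ?thesis
  proof (cases "x > (1/2) ^ n")
    case True
    then have "x > 0" by (smt (verit) zero_less_power half_gt_zero_iff)
    then have "1 / (x\<^sup>2 + (1/4) ^ n) \<le> 1 / x\<^sup>2"
      by (intro divide_left_mono) (auto intro!: mult_pos_pos add_pos_pos)
    then show ?thesis using far[OF True] True by (simp add: lessThan_Suc_atMost[symmetric] not_le)
  next
    case False
    have *: "0 \<le> (\<Sum>k<n. 4 ^ Suc k * (if x \<le> (1/2) ^ k then 1 else 0 :: real))"
      by (intro sum_nonneg) auto
    have "1 / (x\<^sup>2 + (1/4) ^ n) \<le> 1 / (1/4) ^ n"
      by (intro divide_left_mono) (auto intro!: mult_pos_pos add_nonneg_pos)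
    also have "\<dots> = 4 ^ n" by (simp add: power_one_over)
    also have "\<dots> \<le> 4 ^ Suc n" by simp
    finally show ?thesis using False * by (simp add: lessThan_Suc_atMost[symmetric])
  qed
qed

text \<open>A disc of radius \<open>(1/2)^k\<close> has area proportional to \<open>(1/4)^k\<close>,
  so each dyadic scale contributes the same amount. The growth linear in \<open>n\<close> is what
  the factor \<open>1 / n^2\<close> in the squared gradient of the cutoff will beat.\<close>

lemma integral_inverse_square_le:
  obtains V where "\<And>\<zeta> n. integral (cball 0 r) (\<lambda>z::complex. 1 / ((norm (z - \<zeta>))\<^sup>2 + (1/4) ^ n)) \<le> V * (real n + 1)"
proof -
  define v where "v = unit_ball_vol (real DIM(complex))"
  have v: "measure lebesgue (cball \<zeta> s) = v * s\<^sup>2" if "s \<ge> 0" for \<zeta> :: complex and s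
    using content_cball[OF that, of \<zeta>] by (simp add: v_def)
  have v0: "v \<ge> 0" by (simp add: v_def)
  define V where "V = v * r\<^sup>2 + 4 * v"
  have "integral (cball 0 r) (\<lambda>z::complex. 1 / ((norm (z - \<zeta>))\<^sup>2 + (1/4) ^ n)) \<le> V * (real n + 1)" for \<zeta> n
  proof -
    let ?g = "\<lambda>z. 1 + (\<Sum>k\<le>n. 4 ^ Suc k * indicator (cball \<zeta> ((1/2) ^ k)) z :: real)"
    have gi: "((\<lambda>z. indicator (cball \<zeta> s) z :: real) has_integral measure lebesgue (cball \<zeta> s \<inter> cball 0 r)) (cball 0 r)" for s
    proof -
      have "((\<lambda>z. 1 :: real) has_integral measure lebesgue (cball \<zeta> s \<inter> cball 0 r)) (cball \<zeta> s \<inter> cball 0 r)"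
        using lmeasure_integral[of "cball \<zeta> s \<inter> cball 0 r"] integrable_on_const[of "cball \<zeta> s \<inter> cball 0 r"]
        by (simp add: has_integral_iff fmeasurable.Int)
      then show ?thesis
        using has_integral_restrict_Int[of "cball \<zeta> s" "\<lambda>_. 1 :: real"] by (simp add: indicator_def of_bool_def)
    qed
    have "(?g has_integral (measure lebesgue (cball (0::complex) r) * 1 +
        (\<Sum>k\<le>n. 4 ^ Suc k * measure lebesgue (cball \<zeta> ((1/2) ^ k) \<inter> cball 0 r)))) (cball 0 r)"
      by (intro has_integral_add has_integral_sum has_integral_mult_right gi) 
         (use lmeasure_integral[of "cball (0::complex) r"] in \<open>auto simp: has_integral_iff intro!: integrable_on_const\<close>)
    moreover have "(\<lambda>z::complex. 1 / ((norm (z - \<zeta>))\<^sup>2 + (1/4) ^ n)) integrable_on cball 0 r"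
      by (intro integrable_on_compact_continuous continuous_intros)
         (auto simp: add_nonneg_pos intro!: order.strict_implies_not_eq[symmetric] add_nonneg_pos)
    moreover have "1 / ((norm (z - \<zeta>))\<^sup>2 + (1/4) ^ n) \<le> ?g z" for z
    proof -
      have "indicator (cball \<zeta> s) z = (if norm (z - \<zeta>) \<le> s then 1 else 0 :: real)" for s
        by (simp add: indicator_def dist_norm norm_minus_commute)
      then show ?thesis using inverse_square_dyadic[of "norm (z - \<zeta>)" n] by simp
    qed
    ultimately have "integral (cball 0 r) (\<lambda>z. 1 / ((norm (z - \<zeta>))\<^sup>2 + (1/4) ^ n)) \<le>
      measure lebesgue (cball (0::complex) r) * 1 + (\<Sum>k\<le>n. 4 ^ Suc k * measure lebesgue (cball \<zeta> ((1/2) ^ k) \<inter> cball 0 r))"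
      using has_integral_le integrable_integral by blast
    also have "\<dots> \<le> v * r\<^sup>2 + (\<Sum>k\<le>n. 4 * v)"
    proof (intro add_mono sum_mono)
      show "measure lebesgue (cball (0::complex) r) * 1 \<le> v * r\<^sup>2"
        using v[of r 0] v0 by (cases "r \<ge> 0") auto
      show "4 ^ Suc k * measure lebesgue (cball \<zeta> ((1/2) ^ k) \<inter> cball 0 r) \<le> 4 * v" for k
      proof -
        have "measure lebesgue (cball \<zeta> ((1/2) ^ k) \<inter> cball 0 r) \<le> measure lebesgue (cball \<zeta> ((1/2) ^ k))"
          by (intro measure_mono_fmeasurable) auto
        also have "\<dots> = v * (1/4) ^ k"
          by (subst v) (auto simp: power2_eq_square power_mult_distrib[symmetric])
        finally have "4 ^ Suc k * measure lebesgue (cball \<zeta> ((1/2) ^ k) \<inter> cball 0 r) \<le> 4 ^ Suc k * (v * (1/4) ^ k)"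
          by (intro mult_left_mono) auto
        also have "\<dots> = 4 * v" by (simp add: power_one_over)
        finally show ?thesis .
      qed
    qed
    also have "\<dots> \<le> V * (real n + 1)"
      using v0 by (simp add: V_def algebra_simps)
    finally show ?thesis .
  qed
  then show ?thesis using that by blast
qed


text \<open>At a zero of \<open>f\<close> the logarithms differ by exactly \<open>n ln 4\<close>, so
  the value is 0; elsewhere their difference stays bounded as \<open>n\<close> grows, so the value
  tends to 1. The shifts \<open>1\<close> and \<open>(1/4)^n\<close> keep both logarithms
  smooth.\<close>

definition log_cutoff :: "nat \<Rightarrow> (complex \<Rightarrow> complex) \<Rightarrow> complex \<Rightarrow> real" where
  "log_cutoff n f z = 1 - (ln ((norm (f z))\<^sup>2 + 1) - ln ((norm (f z))\<^sup>2 + (1/4) ^ n)) / (real n * ln 4)"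

lemma Ck_norm_square:
  assumes "open U" "Ck k U f"
  shows "Ck k U (\<lambda>z. (norm (f z :: complex))\<^sup>2)"
proof -
  have "(norm (f z))\<^sup>2 = Re (f z * cnj (f z))" for z
    by (simp only: complex_norm_square[symmetric] Re_complex_of_real)
  then show ?thesis
    using Ck_bounded_linear[OF assms(1) bounded_linear_Re Ck_mult[OF assms(1) assms(2) Ck_cnj[OF assms]]]
    by simp
qed

lemma Ck_log_cutoff:
  assumes "open U" "Ck k U f"
  shows "Ck k U (log_cutoff n f)"
proof -
  have [simp]: "0 < (norm (f z))\<^sup>2 + 1" "0 < (norm (f z))\<^sup>2 + (1/4) ^ n" for z
    by (auto intro!: add_nonneg_pos)
  have "Ck k U (\<lambda>z. 1 - (ln ((norm (f z))\<^sup>2 + 1) - ln ((norm (f z))\<^sup>2 + (1/4) ^ n)) * inverse (real n * ln 4))"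
    by (intro Ck_diff Ck_mult Ck_const Ck_ln Ck_add Ck_norm_square assms) auto
  then show ?thesis unfolding log_cutoff_def[abs_def] divide_inverse .
qed

lemma log_cutoff_bounds:
  assumes "n > 0"
  shows "0 \<le> log_cutoff n f z" "log_cutoff n f z \<le> 1"
    "log_cutoff n f z \<le> 4 ^ n * (norm (f z))\<^sup>2"
proof -
  define u where "u = (norm (f z))\<^sup>2"
  define a :: real where "a = (1/4) ^ n"
  define L where "L = real n * ln 4"
  have u: "u \<ge> 0" and a: "0 < a" "a \<le> 1" by (auto simp: u_def a_def power_le_one)
  have "ln 4 \<ge> (1::real)" using exp_le by (subst ln_ge_iff) auto
  then have L1: "L \<ge> 1" using assms unfolding L_def by (metis One_nat_def Suc_leI mult_mono mult_1 of_nat_1 of_nat_mono of_nat_0_le_iff zero_le_one)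
  have La: "L = - ln a" by (simp add: L_def a_def ln_realpow ln_div)
  have chi: "log_cutoff n f z = 1 - (ln (u + 1) - ln (u + a)) / L"
    by (simp add: log_cutoff_def u_def a_def L_def)
  have "ln (u + 1) - ln (u + a) \<ge> 0" using u a by simp
  then show "log_cutoff n f z \<le> 1" unfolding chi using L1 by simp
  \<comment> \<open>As a single logarithm the cutoff is open both to \<open>ln x \<ge> 0\<close> for
    \<open>x \<ge> 1\<close> and to \<open>ln x \<le> x - 1\<close>, which gives the bound linear in
    \<open>|f|^2\<close>.\<close>
  have e: "log_cutoff n f z = ln ((u + a) / (a * (u + 1))) / L"
  proof -
    have "ln ((u + a) / (a * (u + 1))) = ln (u + a) - ln (a * (u + 1))"
      using u a by (simp add: ln_div add_nonneg_pos)
    also have "ln (a * (u + 1)) = ln a + ln (u + 1)"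
      using u a by (simp add: ln_mult add_nonneg_pos)
    finally have "ln ((u + a) / (a * (u + 1))) = L - (ln (u + 1) - ln (u + a))" by (simp add: La)
    then show ?thesis unfolding chi using L1 by (simp add: diff_divide_distrib)
  qed
  have "a * (u + 1) \<le> u + a" using u a by (simp add: algebra_simps mult_left_le_one_le)
  then have "(u + a) / (a * (u + 1)) \<ge> 1" using u a by (simp add: le_divide_eq)
  then show "0 \<le> log_cutoff n f z" unfolding e using L1 by (intro divide_nonneg_nonneg ln_ge_zero) auto
  have "ln ((u + a) / (a * (u + 1))) \<le> (u + a) / (a * (u + 1)) - 1"
    using u a by (intro ln_le_minus_one) auto
  also have "\<dots> \<le> u / a"
  proof -
    have "(u + a) / (a * (u + 1)) \<le> (u + a) / a"
      using u a by (intro divide_left_mono) (auto simp: mult_le_cancel_left1)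
    then show ?thesis using a by (simp add: add_divide_distrib)
  qed
  finally have "ln ((u + a) / (a * (u + 1))) \<le> u / a" .
  then have "log_cutoff n f z \<le> (u / a) / L" unfolding e using L1 by (intro divide_right_mono) auto
  also have "\<dots> \<le> u / a" using u a L1 by (simp add: divide_le_eq mult_le_cancel_left1)
  finally show "log_cutoff n f z \<le> 4 ^ n * (norm (f z))\<^sup>2"
    by (simp add: u_def a_def power_one_over mult.commute)
qed

text \<open>Two bounds for two purposes: the first makes the derivative \<open>O(|f|)\<close> for
  fixed \<open>n\<close>; the second has a constant that decays like \<open>1 / n^2\<close> and
  controls the energy.\<close>

lemma log_cutoff_derivative:
  assumes "(f has_field_derivative f') (at z)" "n > 0"
  obtains D where "(log_cutoff n f has_derivative D) (at z)"
    "\<And>v. \<bar>D v\<bar> \<le> 2 * 4 ^ n * norm (f z) * norm f' * norm v"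
    "\<And>v. (D v)\<^sup>2 \<le> 4 * (norm f')\<^sup>2 * (norm v)\<^sup>2 / (((norm (f z))\<^sup>2 + (1/4) ^ n) * (real n * ln 4)\<^sup>2)"
proof -
  define u where "u = (norm (f z))\<^sup>2"
  define a :: real where "a = (1/4) ^ n"
  define L where "L = real n * ln 4"
  have u: "u \<ge> 0" and a: "0 < a" "a \<le> 1" by (auto simp: u_def a_def power_le_one)
  have "ln 4 \<ge> (1::real)" using exp_le by (subst ln_ge_iff) auto
  then have L1: "L \<ge> 1" using assms(2) unfolding L_def by (metis One_nat_def Suc_leI mult_mono mult_1 of_nat_1 of_nat_mono of_nat_0_le_iff zero_le_one)
  define du where "du v = 2 * Re (cnj (f z) * (f' * v))" for v
  have "((\<lambda>z. (norm (f z))\<^sup>2) has_derivative du) (at z)"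
  proof -
    have "((\<lambda>z. Re (f z * cnj (f z))) has_derivative (\<lambda>v. Re (f z * cnj (f' * v) + f' * v * cnj (f z)))) (at z)"
      by (intro has_derivative_Re has_derivative_mult has_derivative_cnj assms(1)[unfolded has_field_derivative_def])
    moreover have "(\<lambda>v. Re (f z * cnj (f' * v) + f' * v * cnj (f z))) = du"
      by (auto simp: du_def algebra_simps)
    moreover have "(\<lambda>z. Re (f z * cnj (f z))) = (\<lambda>z. (norm (f z))\<^sup>2)"
      by (simp only: complex_norm_square[symmetric] Re_complex_of_real)
    ultimately show ?thesis by simp
  qed
  note du = this
  define D where "D v = du v * (1 / (u + a) - 1 / (u + 1)) / L" for v
  have "(log_cutoff n f has_derivative D) (at z)"
  proof -
    have ln: "((\<lambda>z. ln ((norm (f z))\<^sup>2 + b)) has_derivative (\<lambda>v. du v * inverse (u + b))) (at z)" if "b > 0" for b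
      unfolding u_def using that by (intro has_derivative_ln has_derivative_add_const du add_nonneg_pos) auto
    have "((\<lambda>z. 1 - (ln ((norm (f z))\<^sup>2 + 1) - ln ((norm (f z))\<^sup>2 + a)) / L) has_derivative
        (\<lambda>v. 0 - (du v * inverse (u + 1) - du v * inverse (u + a)) / L)) (at z)"
      using a by (intro has_derivative_diff has_derivative_const ln
          bounded_linear.has_derivative[OF bounded_linear_divide]) auto
    moreover have "(\<lambda>v. 0 - (du v * inverse (u + 1) - du v * inverse (u + a)) / L) = D"
      by (simp add: fun_eq_iff D_def divide_inverse algebra_simps)
    ultimately show ?thesis by (simp add: log_cutoff_def[abs_def] a_def L_def)
  qed
  moreover have abs: "\<bar>D v\<bar> \<le> 2 * norm (f z) * norm f' * norm v / (u + a) / L" for v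
  proof -
    have "\<bar>du v\<bar> \<le> 2 * norm (f z) * norm f' * norm v"
      using abs_Re_le_cmod[of "cnj (f z) * (f' * v)"] by (simp add: du_def norm_mult)
    moreover have "0 \<le> 1 / (u + a) - 1 / (u + 1)" using u a by (simp add: frac_le)
    moreover have "1 / (u + a) - 1 / (u + 1) \<le> 1 / (u + a)" using u a by simp
    ultimately have "\<bar>du v\<bar> * (1 / (u + a) - 1 / (u + 1)) \<le> (2 * norm (f z) * norm f' * norm v) * (1 / (u + a))"
      by (intro mult_mono) auto
    then have "\<bar>du v\<bar> * (1 / (u + a) - 1 / (u + 1)) / L \<le> (2 * norm (f z) * norm f' * norm v) * (1 / (u + a)) / L"
      using L1 by (intro divide_right_mono) auto
    then show ?thesis using \<open>0 \<le> 1 / (u + a) - 1 / (u + 1)\<close> L1 by (simp add: D_def abs_mult)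
  qed
  moreover have "\<bar>D v\<bar> \<le> 2 * 4 ^ n * norm (f z) * norm f' * norm v" for v
  proof -
    have "1 / (u + a) \<le> 1 / a" using u a by (intro divide_left_mono) auto
    then have "2 * norm (f z) * norm f' * norm v * (1 / (u + a)) \<le> 2 * norm (f z) * norm f' * norm v * (1 / a)"
      by (intro mult_left_mono) auto
    then have "2 * norm (f z) * norm f' * norm v / (u + a) \<le> 2 * 4 ^ n * norm (f z) * norm f' * norm v"
      by (simp add: a_def power_one_over mult_ac)
    moreover have "2 * norm (f z) * norm f' * norm v / (u + a) / L \<le> 2 * norm (f z) * norm f' * norm v / (u + a)"
      using divide_left_mono[of 1 L "2 * norm (f z) * norm f' * norm v / (u + a)"] u a L1 by simp
    ultimately show ?thesis using abs[of v] by linarith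
  qed
  moreover have "(D v)\<^sup>2 \<le> 4 * (norm f')\<^sup>2 * (norm v)\<^sup>2 / ((u + a) * L\<^sup>2)" for v
  proof -
    have "(D v)\<^sup>2 \<le> (2 * norm (f z) * norm f' * norm v / (u + a) / L)\<^sup>2"
      using power_mono[OF abs[of v], of 2] by simp
    also have "\<dots> = 4 * (norm f')\<^sup>2 * (norm v)\<^sup>2 / ((u + a) * L\<^sup>2) * (u / (u + a))"
      by (simp add: power_divide power_mult_distrib u_def power2_eq_square mult_ac)
    also have "\<dots> \<le> 4 * (norm f')\<^sup>2 * (norm v)\<^sup>2 / ((u + a) * L\<^sup>2) * 1"
      using u a by (intro mult_left_mono) auto
    finally show ?thesis by simp
  qed
  ultimately show ?thesis using that[of D] unfolding u_def a_def L_def by blast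
qed

lemma log_cutoff_tendsto:
  assumes "f z \<noteq> 0"
  shows "(\<lambda>n. log_cutoff n f z) \<longlonglongrightarrow> 1"
proof -
  define u where "u = (norm (f z))\<^sup>2"
  have u: "u > 0" using assms by (simp add: u_def)
  have p: "(\<lambda>n. (1/4 :: real) ^ n) \<longlonglongrightarrow> 0" by (rule LIMSEQ_power_zero) auto
  have "(\<lambda>n. ln (u + 1) - ln (u + (1/4) ^ n)) \<longlonglongrightarrow> ln (u + 1) - ln (u + 0)"
    using u by (intro tendsto_diff tendsto_const tendsto_ln tendsto_add p) auto
  moreover have "(\<lambda>n. 1 / (real n * ln 4)) \<longlonglongrightarrow> 0"
    using tendsto_mult[OF lim_1_over_n tendsto_const[of "1 / ln 4 :: real"]] by simp
  ultimately have "(\<lambda>n. 1 - (ln (u + 1) - ln (u + (1/4) ^ n)) * (1 / (real n * ln 4))) \<longlonglongrightarrow> 1 - (ln (u + 1) - ln (u + 0)) * 0"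
    by (rule tendsto_diff[OF tendsto_const tendsto_mult])
  then show ?thesis by (simp add: log_cutoff_def u_def)
qed

lemma pd_has_derivative:
  assumes "(u has_derivative D) (at z)"
  shows "pdx u z = D 1" "pdy u z = D \<i>"
  using frechet_derivative_at[OF assms] by (simp_all add: pdx_def pdy_def)

text \<open>The squared gradient carries \<open>1 / n^2\<close> against integrals growing like
  \<open>n\<close>, so the energy is \<open>O(1 / n)\<close>.\<close>

lemma log_cutoff_energy_tendsto_0:
  assumes "open S" "connected S" "f holomorphic_on S" "\<exists>w\<in>S. f w \<noteq> 0" "cball 0 r \<subseteq> S"
  obtains E where "E \<longlonglongrightarrow> (0::real)"
    "\<And>n. n > 0 \<Longrightarrow> integral (cball 0 r) (\<lambda>z. (pdx (log_cutoff n f) z)\<^sup>2 + (pdy (log_cutoff n f) z)\<^sup>2) \<le> E n"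
proof -
  obtain Z C where Z: "finite Z" and C: "C \<ge> 0"
    "\<And>z. z \<in> cball 0 r \<Longrightarrow> norm (deriv f z) \<le> C"
    "\<And>z. z \<in> cball 0 r \<Longrightarrow> \<exists>\<zeta>\<in>Z. norm (deriv f z) * norm (z - \<zeta>) \<le> C * norm (f z)"
    using log_deriv_bound[OF assms(1-4) compact_cball assms(5)] by blast
  obtain V where V: "\<And>\<zeta> n. integral (cball 0 r) (\<lambda>z::complex. 1 / ((norm (z - \<zeta>))\<^sup>2 + (1/4) ^ n)) \<le> V * (real n + 1)"
    using integral_inverse_square_le by blast
  define E where "E n = 8 * C\<^sup>2 * real (card Z) * V * ((1 / real n) * (1 + 1 / real n) / (ln 4)\<^sup>2)" for n
  have "E \<longlonglongrightarrow> 8 * C\<^sup>2 * real (card Z) * V * (0 * (1 + 0) / (ln 4)\<^sup>2)"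
    unfolding E_def by (intro tendsto_mult tendsto_divide tendsto_add tendsto_const lim_1_over_n) auto
  then have "E \<longlonglongrightarrow> 0" by simp
  moreover have "integral (cball 0 r) (\<lambda>z. (pdx (log_cutoff n f) z)\<^sup>2 + (pdy (log_cutoff n f) z)\<^sup>2) \<le> E n" if n: "n > 0" for n
  proof -
    let ?L = "real n * ln 4" and ?a = "(1/4 :: real) ^ n"
    let ?g = "\<lambda>z. 8 * C\<^sup>2 / ?L\<^sup>2 * (\<Sum>\<zeta>\<in>Z. 1 / ((norm (z - \<zeta>))\<^sup>2 + ?a))"
    have L: "?L > 0" using n by simp
    have pos: "(norm x)\<^sup>2 + ?a > 0" for x :: complex by (intro add_nonneg_pos) auto
    have le: "(pdx (log_cutoff n f) z)\<^sup>2 + (pdy (log_cutoff n f) z)\<^sup>2 \<le> ?g z" if z: "z \<in> cball 0 r" for z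
    proof -
      have fd: "(f has_field_derivative deriv f z) (at z)"
        using holomorphic_derivI[OF assms(3,1)] z assms(5) by blast
      obtain D where
        D: "(log_cutoff n f has_derivative D) (at z)"
        "\<And>v. \<bar>D v\<bar> \<le> 2 * 4 ^ n * norm (f z) * norm (deriv f z) * norm v"
        "\<And>v. (D v)\<^sup>2 \<le> 4 * (norm (deriv f z))\<^sup>2 * (norm v)\<^sup>2 / (((norm (f z))\<^sup>2 + ?a) * ?L\<^sup>2)"
        by (rule log_cutoff_derivative[OF fd n], rule that)
      obtain \<zeta> where \<zeta>: "\<zeta> \<in> Z" "norm (deriv f z) * norm (z - \<zeta>) \<le> C * norm (f z)" using C(3)[OF z] by blast
      have "(norm (deriv f z))\<^sup>2 * (norm (z - \<zeta>))\<^sup>2 \<le> C\<^sup>2 * (norm (f z))\<^sup>2"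
        using power_mono[OF \<zeta>(2), of 2] by (simp add: power_mult_distrib)
      \<comment> \<open>The plain bound on \<open>f'\<close> pays for the shift
        \<open>(1/4)^n\<close>, the logarithmic bound for \<open>|f|^2\<close>; their sum exchanges
        \<open>|f|\<close> for the distance to \<open>\<zeta>\<close> in the denominator.\<close>
      moreover have "(norm (deriv f z))\<^sup>2 * ?a \<le> C\<^sup>2 * ?a"
        using C(2)[OF z] by (intro mult_right_mono power_mono) auto
      ultimately have "(norm (deriv f z))\<^sup>2 * ((norm (z - \<zeta>))\<^sup>2 + ?a) \<le> C\<^sup>2 * ((norm (f z))\<^sup>2 + ?a)"
        unfolding distrib_left by (rule add_mono)
      then have "(norm (deriv f z))\<^sup>2 / ((norm (f z))\<^sup>2 + ?a) \<le> C\<^sup>2 * (1 / ((norm (z - \<zeta>))\<^sup>2 + ?a))"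
        using pos[of "f z"] pos[of "z - \<zeta>"] by (simp add: field_simps)
      also have "\<dots> \<le> C\<^sup>2 * (\<Sum>\<zeta>\<in>Z. 1 / ((norm (z - \<zeta>))\<^sup>2 + ?a))"
        using less_imp_le[OF pos] by (intro mult_left_mono member_le_sum[OF \<zeta>(1)] Z) auto
      finally have *: "(norm (deriv f z))\<^sup>2 / ((norm (f z))\<^sup>2 + ?a) \<le> C\<^sup>2 * (\<Sum>\<zeta>\<in>Z. 1 / ((norm (z - \<zeta>))\<^sup>2 + ?a))" .
      have "(pdx (log_cutoff n f) z)\<^sup>2 + (pdy (log_cutoff n f) z)\<^sup>2 \<le>
          8 / ?L\<^sup>2 * ((norm (deriv f z))\<^sup>2 / ((norm (f z))\<^sup>2 + ?a))"
        using D(3)[of 1] D(3)[of \<i>] by (simp add: pd_has_derivative[OF D(1)] mult_ac)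
      also have "\<dots> \<le> 8 / ?L\<^sup>2 * (C\<^sup>2 * (\<Sum>\<zeta>\<in>Z. 1 / ((norm (z - \<zeta>))\<^sup>2 + ?a)))"
        using L by (intro mult_left_mono *) auto
      finally show ?thesis by simp
    qed
    have gi: "((\<lambda>z. 1 / ((norm (z - \<zeta>))\<^sup>2 + ?a)) has_integral
        integral (cball 0 r) (\<lambda>z. 1 / ((norm (z - \<zeta>))\<^sup>2 + ?a))) (cball 0 r)" for \<zeta> :: complex
      using pos[of "_ - \<zeta>"] by (intro integrable_integral integrable_on_compact_continuous continuous_intros) (auto simp: less_imp_neq[symmetric])
    have c: "Ck (Suc 0) S (log_cutoff n f)"
      by (intro Ck_log_cutoff Ck_holomorphic assms)
    have "integral (cball 0 r) (\<lambda>z. (pdx (log_cutoff n f) z)\<^sup>2 + (pdy (log_cutoff n f) z)\<^sup>2)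
      \<le> 8 * C\<^sup>2 / ?L\<^sup>2 * (\<Sum>\<zeta>\<in>Z. integral (cball 0 r) (\<lambda>z. 1 / ((norm (z - \<zeta>))\<^sup>2 + ?a)))"
    proof (rule has_integral_le[OF integrable_integral _ le])
      show "(\<lambda>z. (pdx (log_cutoff n f) z)\<^sup>2 + (pdy (log_cutoff n f) z)\<^sup>2) integrable_on cball 0 r"
        using Ck_Suc_continuous_pd[OF assms(1) c] assms(5)
        by (intro integrable_on_compact_continuous continuous_intros) (auto intro: continuous_on_subset)
      show "(?g has_integral 8 * C\<^sup>2 / ?L\<^sup>2 * (\<Sum>\<zeta>\<in>Z. integral (cball 0 r) (\<lambda>z. 1 / ((norm (z - \<zeta>))\<^sup>2 + ?a)))) (cball 0 r)"
        by (intro has_integral_mult_right has_integral_sum Z gi)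
    qed
    also have "\<dots> \<le> 8 * C\<^sup>2 / ?L\<^sup>2 * (\<Sum>\<zeta>\<in>Z. V * (real n + 1))"
      by (intro mult_left_mono sum_mono V) auto
    also have "\<dots> = E n"
      using n by (simp add: E_def field_simps power2_eq_square)
    finally show ?thesis .
  qed
  ultimately show ?thesis by (rule that)
qed

text \<open>In the squared product rule, Young's inequality splits the cross term into a small
  multiple of the energy of \<open>\<phi>\<close> and a large multiple of the cutoff energy. The
  former is beaten by the strict sign in \<open>neg\<close>, the latter tends to 0.\<close>

lemma cutoff_index_negative:
  assumes S: "open S" "connected S" "f holomorphic_on S" "\<exists>w\<in>S. f w \<noteq> 0" "cball 0 r \<subseteq> S"
    and \<phi>: "Ck (Suc 0) S \<phi>" and \<kappa>: "continuous_on (cball 0 r) \<kappa>"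
    and neg: "integral (cball 0 r) (\<lambda>z. (pdx \<phi> z)\<^sup>2 + (pdy \<phi> z)\<^sup>2 - \<kappa> z * (\<phi> z)\<^sup>2) < (0::real)"
  obtains n where "n > 0" "integral (cball 0 r) (\<lambda>z. (pdx (\<lambda>z. log_cutoff n f z * \<phi> z) z)\<^sup>2
     + (pdy (\<lambda>z. log_cutoff n f z * \<phi> z) z)\<^sup>2 - \<kappa> z * (log_cutoff n f z * \<phi> z)\<^sup>2) < 0"
proof -
  let ?B = "cball (0::complex) r"
  define \<xi> where "\<xi> n = log_cutoff n f" for n
  define G where "G z = (pdx \<phi> z)\<^sup>2 + (pdy \<phi> z)\<^sup>2" for z
  define F where "F z = G z - \<kappa> z * (\<phi> z)\<^sup>2" for z
  define X where "X n z = (pdx (\<xi> n) z)\<^sup>2 + (pdy (\<xi> n) z)\<^sup>2" for n z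
  define Q where "Q n z = (pdx (\<lambda>z. \<xi> n z * \<phi> z) z)\<^sup>2
     + (pdy (\<lambda>z. \<xi> n z * \<phi> z) z)\<^sup>2 - \<kappa> z * (\<xi> n z * \<phi> z)\<^sup>2" for n z
  have c\<xi>: "Ck (Suc 0) S (\<xi> n)" for n
    unfolding \<xi>_def by (intro Ck_log_cutoff Ck_holomorphic S)
  have c\<psi>: "Ck (Suc 0) S (\<lambda>z. \<xi> n z * \<phi> z)" for n
    by (intro Ck_mult S c\<xi> \<phi>)
  note sub = continuous_on_subset[OF _ S(5)]
  have cont: "continuous_on ?B \<phi>" "continuous_on ?B (\<xi> n)" "continuous_on ?B (pdx \<phi>)" "continuous_on ?B (pdy \<phi>)"
    "continuous_on ?B (pdx (\<xi> n))" "continuous_on ?B (pdy (\<xi> n))"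
    "continuous_on ?B (pdx (\<lambda>z. \<xi> n z * \<phi> z))" "continuous_on ?B (pdy (\<lambda>z. \<xi> n z * \<phi> z))" for n
    using Ck_continuous[OF \<phi>] Ck_continuous[OF c\<xi>] Ck_Suc_continuous_pd[OF S(1) \<phi>]
      Ck_Suc_continuous_pd[OF S(1) c\<xi>] Ck_Suc_continuous_pd[OF S(1) c\<psi>] by (auto intro: sub)
  have cG: "continuous_on ?B G" and cF: "continuous_on ?B F" and cX: "continuous_on ?B (X n)" and cQ: "continuous_on ?B (Q n)" for n
    unfolding G_def F_def X_def Q_def by (intro continuous_intros cont \<kappa>)+
  note int = integrable_on_compact_continuous(2)[OF compact_cball]
  have "bounded (\<phi> ` ?B)" using cont(1) compact_continuous_image compact_imp_bounded compact_cball by blast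
  then obtain b where b: "\<And>z. z \<in> ?B \<Longrightarrow> \<bar>\<phi> z\<bar> \<le> b"
    unfolding bounded_iff real_norm_def by blast
  define I where "I = integral ?B F"
  have I: "I < 0" using neg by (simp add: I_def F_def[abs_def] G_def)
  have IG: "integral ?B G \<ge> 0" by (intro integral_nonneg int cG) (simp add: G_def)
  \<comment> \<open>Chosen so that the loss \<open>\<eta> * integral ?B G\<close> is at most a
    quarter of \<open>- I\<close>; the summand 1 keeps the denominator positive.\<close>
  define \<eta> where "\<eta> = - I / (4 * (integral ?B G + 1))"
  have \<eta>: "\<eta> > 0" using I IG by (simp add: \<eta>_def divide_neg_pos)
  have "\<eta> * integral ?B G \<le> \<eta> * (integral ?B G + 1)" using \<eta> by simp
  also have "\<dots> = - I / 4"
  proof -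
    have "integral ?B G + 1 \<noteq> 0" using IG by linarith
    then show ?thesis unfolding \<eta>_def times_divide_eq_left by (rule nonzero_mult_divide_mult_cancel_right)
  qed
  finally have \<eta>G: "\<eta> * integral ?B G \<le> - I / 4" .
  obtain E where E: "E \<longlonglongrightarrow> 0" "\<And>n. n > 0 \<Longrightarrow> integral ?B (X n) \<le> E n"
    using log_cutoff_energy_tendsto_0[OF S] unfolding X_def \<xi>_def by blast
  define T where "T n = integral ?B (\<lambda>z. (\<xi> n z)\<^sup>2 * F z)" for n
  have le: "Q n z \<le> (\<xi> n z)\<^sup>2 * F z + \<eta> * G z + (1 + 1 / \<eta>) * b\<^sup>2 * X n z" if n: "n > 0" and z: "z \<in> ?B" for n z
  proof -
    have zS: "z \<in> S" using z S(5) by auto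
    have "((\<lambda>z. \<xi> n z * \<phi> z) has_derivative
        (\<lambda>v. \<xi> n z * frechet_derivative \<phi> (at z) v + frechet_derivative (\<xi> n) (at z) v * \<phi> z)) (at z)"
      by (intro has_derivative_mult Ck_Suc_has_derivative[OF S(1) c\<xi> zS] Ck_Suc_has_derivative[OF S(1) \<phi> zS])
    note pd = pd_has_derivative[OF this, folded pdx_def pdy_def]
    have \<xi>: "0 \<le> \<xi> n z" "\<xi> n z \<le> 1" using log_cutoff_bounds(1,2)[OF n] by (auto simp: \<xi>_def)
    have *: "(x * p + q * y)\<^sup>2 \<le> x\<^sup>2 * p\<^sup>2 + \<eta> * p\<^sup>2 + (1 + 1 / \<eta>) * b\<^sup>2 * q\<^sup>2"
      if "0 \<le> x" "x \<le> 1" "\<bar>y\<bar> \<le> b" for x y p q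
    proof -
      have y: "y\<^sup>2 \<le> b\<^sup>2" using that(3) by (metis abs_ge_zero order_trans power2_abs power_mono)
      \<comment> \<open>Young's inequality with weight \<open>\<eta>\<close>; the factor
        \<open>x \<le> 1\<close> is dropped from the small term only, so that
        \<open>\<xi>^2 F\<close> is kept intact.\<close>
      have "0 \<le> (\<eta> * (x * p) - q * y)\<^sup>2 / \<eta>" using \<eta> by simp
      also have "\<dots> = \<eta> * (x * p)\<^sup>2 - 2 * (x * p) * (q * y) + (q * y)\<^sup>2 / \<eta>"
        using \<eta> by (simp add: power2_eq_square field_simps)
      finally have "(x * p + q * y)\<^sup>2 \<le> x\<^sup>2 * p\<^sup>2 + \<eta> * (x\<^sup>2 * p\<^sup>2) + (1 + 1 / \<eta>) * (q * y)\<^sup>2"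
        by (simp add: power2_eq_square algebra_simps)
      moreover have "\<eta> * (x\<^sup>2 * p\<^sup>2) \<le> \<eta> * p\<^sup>2"
        using \<eta> that by (intro mult_left_mono mult_left_le_one_le power_le_one) auto
      moreover have "(1 + 1 / \<eta>) * (q * y)\<^sup>2 \<le> (1 + 1 / \<eta>) * (b\<^sup>2 * q\<^sup>2)"
        unfolding power_mult_distrib using \<eta> y by (subst mult.commute[of "q\<^sup>2"]) (intro mult_left_mono mult_right_mono, auto)
      ultimately show ?thesis by (simp add: mult.assoc)
    qed
    from *[OF \<xi> b[OF z], of "pdx \<phi> z" "pdx (\<xi> n) z"] *[OF \<xi> b[OF z], of "pdy \<phi> z" "pdy (\<xi> n) z"]
    show ?thesis
      unfolding Q_def pd F_def G_def X_def by (simp add: algebra_simps power_mult_distrib)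
  qed
  have J: "integral ?B (Q n) \<le> T n + \<eta> * integral ?B G + (1 + 1 / \<eta>) * b\<^sup>2 * E n" if n: "n > 0" for n
  proof -
    have "integral ?B (Q n) \<le> T n + \<eta> * integral ?B G + (1 + 1 / \<eta>) * b\<^sup>2 * integral ?B (X n)"
      unfolding T_def
      by (rule has_integral_le[OF integrable_integral[OF int[OF cQ]] _ le[OF n]])
         (intro has_integral_add has_integral_mult_right integrable_integral int cG cX continuous_intros cont cF)
    also have "\<dots> \<le> T n + \<eta> * integral ?B G + (1 + 1 / \<eta>) * b\<^sup>2 * E n"
      using \<eta> by (intro add_left_mono mult_left_mono E(2)[OF n]) auto
    finally show ?thesis .
  qed
  have "T \<longlonglongrightarrow> I"
  proof -
    \<comment> \<open>The cutoffs tend to 1 only off the zeros of \<open>f\<close>, which are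
      finitely many in the disc, hence negligible.\<close>
    define N where "N = {z \<in> ?B. f z = 0}"
    have "finite N"
    proof (cases "f constant_on S")
      case True
      then have "N = {}" using S(4,5) unfolding N_def constant_on_def by force
      then show ?thesis by simp
    next
      case False
      then show ?thesis unfolding N_def
        using holomorphic_compact_finite_zeros[OF S(3,1,2) compact_cball S(5)] by blast
    qed
    then have negl: "negligible N" by (rule negligible_finite)
    have i: "((g has_integral y) ?B) = ((g has_integral y) (?B - N))" for g :: "complex \<Rightarrow> real" and y
      by (rule has_integral_spike_set_eq) (auto intro: negligible_subset[OF negl])
    have eq: "integral ?B g = integral (?B - N) g" for g :: "complex \<Rightarrow> real"
      unfolding integral_def integrable_on_def i ..
    have i': "g integrable_on ?B - N" if "g integrable_on ?B" for g :: "complex \<Rightarrow> real"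
      using that i by (auto simp: integrable_on_def)
    have "(\<lambda>n. integral (?B - N) (\<lambda>z. (\<xi> (Suc n) z)\<^sup>2 * F z)) \<longlonglongrightarrow> integral (?B - N) F"
    proof (rule dominated_convergence(2))
      show "(\<lambda>z. (\<xi> (Suc n) z)\<^sup>2 * F z) integrable_on ?B - N" for n
        by (intro i' int continuous_intros cont cF)
      show "(\<lambda>z. \<bar>F z\<bar>) integrable_on ?B - N"
        by (intro i' int continuous_intros cF)
      show "norm ((\<xi> (Suc n) z)\<^sup>2 * F z) \<le> \<bar>F z\<bar>" for n z
        using log_cutoff_bounds(1,2)[of "Suc n" f z]
        by (auto simp: abs_mult \<xi>_def intro!: mult_left_le_one_le power_le_one)
      show "(\<lambda>n. (\<xi> (Suc n) z)\<^sup>2 * F z) \<longlonglongrightarrow> F z" if "z \<in> ?B - N" for z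
      proof -
        have "f z \<noteq> 0" using that by (auto simp: N_def)
        from LIMSEQ_Suc[OF log_cutoff_tendsto[of f z, OF this]]
        have "(\<lambda>n. (\<xi> (Suc n) z)\<^sup>2 * F z) \<longlonglongrightarrow> 1\<^sup>2 * F z"
          unfolding \<xi>_def by (intro tendsto_mult tendsto_power tendsto_const)
        then show ?thesis by simp
      qed
    qed
    then have "(\<lambda>n. T (Suc n)) \<longlonglongrightarrow> I" by (simp add: T_def I_def eq)
    then show ?thesis by (rule LIMSEQ_imp_Suc)
  qed
  then have "(\<lambda>n. T n + \<eta> * integral ?B G + (1 + 1 / \<eta>) * b\<^sup>2 * E n) \<longlonglongrightarrow> I + \<eta> * integral ?B G + (1 + 1 / \<eta>) * b\<^sup>2 * 0"
    by (intro tendsto_add tendsto_mult tendsto_const E)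
  moreover have "I + \<eta> * integral ?B G + (1 + 1 / \<eta>) * b\<^sup>2 * 0 < 0" using \<eta>G I by simp
  ultimately have "\<forall>\<^sub>F n in sequentially. T n + \<eta> * integral ?B G + (1 + 1 / \<eta>) * b\<^sup>2 * E n < 0"
    by (rule order_tendstoD(2))
  then have "\<forall>\<^sub>F n in sequentially. T n + \<eta> * integral ?B G + (1 + 1 / \<eta>) * b\<^sup>2 * E n < 0 \<and> n > 0"
    by (intro eventually_conj eventually_gt_at_top)
  from eventually_happens'[OF sequentially_bot this] obtain n where
    n: "T n + \<eta> * integral ?B G + (1 + 1 / \<eta>) * b\<^sup>2 * E n < 0" "n > 0" by (elim exE conjE)
  have "integral ?B (Q n) < 0" using J[OF n(2)] n(1) by (rule le_less_trans)
  then show ?thesis using that[OF n(2)] unfolding Q_def[abs_def] \<xi>_def by blast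
qed

section \<open>Second derivative of an integral of square roots\<close>

lemma has_real_derivative_quadratic_bound:
  assumes "\<delta> > 0" "\<And>x. \<bar>x - t\<bar> < \<delta> \<Longrightarrow> \<bar>F x - F t - (x - t) * D\<bar> \<le> B * (x - t)\<^sup>2"
  shows "(F has_real_derivative D) (at t)"
proof -
  have "((\<lambda>x. (F x - F t) / (x - t) - D) \<longlongrightarrow> 0) (at t)"
  proof (rule Lim_null_comparison)
    show "\<forall>\<^sub>F x in at t. norm ((F x - F t) / (x - t) - D) \<le> B * \<bar>x - t\<bar>"
      unfolding eventually_at
    proof (intro exI conjI ballI impI)
      fix x assume x: "x \<noteq> t \<and> dist x t < \<delta>"
      have "norm ((F x - F t) / (x - t) - D) = \<bar>F x - F t - (x - t) * D\<bar> / \<bar>x - t\<bar>"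
        using x by (simp add: abs_divide[symmetric] diff_divide_distrib)
      also have "\<dots> \<le> B * (x - t)\<^sup>2 / \<bar>x - t\<bar>"
        using x assms(2)[of x] by (intro divide_right_mono) (auto simp: dist_real_def)
      also have "(x - t)\<^sup>2 = \<bar>x - t\<bar> * \<bar>x - t\<bar>" by (simp add: power2_eq_square)
      also have "B * (\<bar>x - t\<bar> * \<bar>x - t\<bar>) / \<bar>x - t\<bar> = B * \<bar>x - t\<bar>"
      proof -
        have *: "B * (a * a) / a = B * a" if "a \<noteq> 0" for a :: real using that by simp
        show ?thesis by (rule *) (use x in simp)
      qed
      finally show "norm ((F x - F t) / (x - t) - D) \<le> B * \<bar>x - t\<bar>" .
    qed (use assms in auto)
    have "((\<lambda>x. B * \<bar>x - t\<bar>) \<longlongrightarrow> B * \<bar>t - t\<bar>) (at t)" by (intro tendsto_intros)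
    then show "((\<lambda>x. B * \<bar>x - t\<bar>) \<longlongrightarrow> 0) (at t)" by simp
  qed
  then show ?thesis
    unfolding has_field_derivative_iff by (rule LIM_zero_cancel)
qed

text \<open>Taylor bounds whose constants depend on \<open>C\<close> alone, so that they can be
  integrated over the disc. The range \<open>1 / (8 * C)\<close> keeps \<open>w\<close> above
  \<open>1/2\<close>, away from the singularity of the root.\<close>

lemma sqrt_quartic_estimates:
  fixes C p q s :: real
  defines "w \<equiv> \<lambda>t. 1 + t\<^sup>2 * p + t ^ 3 * q + t ^ 4 * s"
  defines "d \<equiv> \<lambda>t. (2 * t * p + 3 * t\<^sup>2 * q + 4 * t ^ 3 * s) / (2 * sqrt (w t))"
  assumes C: "C \<ge> 1" "\<bar>p\<bar> \<le> C" "\<bar>q\<bar> \<le> C" "\<bar>s\<bar> \<le> C"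
  shows "\<And>t x. \<bar>t\<bar> \<le> 1 / (8 * C) \<Longrightarrow> \<bar>x\<bar> \<le> 1 / (8 * C) \<Longrightarrow>
      \<bar>sqrt (w x) - sqrt (w t) - (x - t) * d t\<bar> \<le> 4 * C * (x - t)\<^sup>2"
    and "\<And>t. \<bar>t\<bar> \<le> 1 / (8 * C) \<Longrightarrow> \<bar>d t - t * p\<bar> \<le> 4 * C * t\<^sup>2"
proof -
  define w1 where "w1 t = 2 * t * p + 3 * t\<^sup>2 * q + 4 * t ^ 3 * s" for t
  define w2 where "w2 t = 2 * p + 6 * t * q + 12 * t\<^sup>2 * s" for t
  have t8: "\<bar>t\<bar> \<le> 1 / 8" "C * \<bar>t\<bar> \<le> 1/8" if "\<bar>t\<bar> \<le> 1 / (8 * C)" for t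
  proof -
    show *: "C * \<bar>t\<bar> \<le> 1/8" using that C by (simp add: field_simps)
    have "1 * \<bar>t\<bar> \<le> C * \<bar>t\<bar>" using C by (intro mult_right_mono) auto
    with * show "\<bar>t\<bar> \<le> 1/8" by simp
  qed
  have tri: "\<bar>a * p + b * q + c * s\<bar> \<le> C * (\<bar>a\<bar> + \<bar>b\<bar> + \<bar>c\<bar>)" for a b c
  proof -
    have "\<bar>a * p\<bar> \<le> \<bar>a\<bar> * C" "\<bar>b * q\<bar> \<le> \<bar>b\<bar> * C" "\<bar>c * s\<bar> \<le> \<bar>c\<bar> * C"
      unfolding abs_mult using C by (auto intro: mult_left_mono)
    then show ?thesis by (simp add: algebra_simps) linarith
  qed
  have pw: "t\<^sup>2 \<le> \<bar>t\<bar> / 8" "\<bar>t\<bar> ^ 3 \<le> t\<^sup>2 / 8" "t ^ 4 \<le> t\<^sup>2 / 64" if "\<bar>t\<bar> \<le> 1/8" for t :: real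
  proof -
    have "\<bar>t\<bar> * \<bar>t\<bar> \<le> \<bar>t\<bar> * (1/8)" using that by (intro mult_left_mono) auto
    then show 1: "t\<^sup>2 \<le> \<bar>t\<bar> / 8" by (simp add: power2_eq_square)
    have "t\<^sup>2 * \<bar>t\<bar> \<le> t\<^sup>2 * (1/8)" using that by (intro mult_left_mono) auto
    then show "\<bar>t\<bar> ^ 3 \<le> t\<^sup>2 / 8" by (simp add: power3_eq_cube power2_eq_square)
    have "t\<^sup>2 * t\<^sup>2 \<le> t\<^sup>2 * (1/64)" using 1 that by (intro mult_left_mono) auto
    then show "t ^ 4 \<le> t\<^sup>2 / 64" by (simp add: power4_eq_xxxx power2_eq_square)
  qed
  have w: "\<bar>w t - 1\<bar> \<le> 2 * C * t\<^sup>2" "1/2 \<le> w t" if "\<bar>t\<bar> \<le> 1 / (8 * C)" for t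
  proof -
    have "\<bar>w t - 1\<bar> \<le> C * (\<bar>t\<^sup>2\<bar> + \<bar>t ^ 3\<bar> + \<bar>t ^ 4\<bar>)" using tri[of "t\<^sup>2" "t^3" "t^4"] by (simp add: w_def add.assoc)
    also have "\<dots> \<le> C * (2 * t\<^sup>2)"
    proof (rule mult_left_mono)
      have "\<bar>t\<^sup>2\<bar> = t\<^sup>2" "\<bar>t ^ 3\<bar> = \<bar>t\<bar> ^ 3" "\<bar>t ^ 4\<bar> = t ^ 4" by (simp_all add: power_abs)
      with pw[OF t8(1)[OF that]] zero_le_power2[of t] show "\<bar>t\<^sup>2\<bar> + \<bar>t ^ 3\<bar> + \<bar>t ^ 4\<bar> \<le> 2 * t\<^sup>2" by linarith
    qed (use C in simp)
    finally show 1: "\<bar>w t - 1\<bar> \<le> 2 * C * t\<^sup>2" by simp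
    have "C * t\<^sup>2 = C * \<bar>t\<bar> * \<bar>t\<bar>" by (simp add: power2_eq_square)
    also have "\<dots> \<le> 1/8 * (1/8)" using t8[OF that] C by (intro mult_mono) auto
    finally show "1/2 \<le> w t" using 1 by linarith
  qed
  have sw: "sqrt (w t) \<ge> 1/2" if "\<bar>t\<bar> \<le> 1 / (8 * C)" for t
    using w(2)[OF that] by (intro real_le_rsqrt) (simp add: power2_eq_square)
  have w1: "\<bar>w1 t\<bar> \<le> 3 * C * \<bar>t\<bar>" if "\<bar>t\<bar> \<le> 1 / (8 * C)" for t
  proof -
    have "\<bar>w1 t\<bar> \<le> C * (\<bar>2 * t\<bar> + \<bar>3 * t\<^sup>2\<bar> + \<bar>4 * t ^ 3\<bar>)" using tri[of "2 * t" "3 * t\<^sup>2" "4 * t^3"] by (simp add: w1_def)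
    also have "\<dots> \<le> C * (3 * \<bar>t\<bar>)"
    proof (rule mult_left_mono)
      have "\<bar>2 * t\<bar> = 2 * \<bar>t\<bar>" "\<bar>3 * t\<^sup>2\<bar> = 3 * t\<^sup>2" "\<bar>4 * t ^ 3\<bar> = 4 * \<bar>t\<bar> ^ 3" by (simp_all add: power_abs abs_mult)
      with pw[OF t8(1)[OF that]] zero_le_power2[of t] show "\<bar>2 * t\<bar> + \<bar>3 * t\<^sup>2\<bar> + \<bar>4 * t ^ 3\<bar> \<le> 3 * \<bar>t\<bar>" by linarith
    qed (use C in simp)
    finally show ?thesis by simp
  qed
  have w2: "\<bar>w2 t\<bar> \<le> 3 * C" if "\<bar>t\<bar> \<le> 1 / (8 * C)" for t
  proof -
    have "\<bar>w2 t\<bar> \<le> C * (\<bar>2\<bar> + \<bar>6 * t\<bar> + \<bar>12 * t\<^sup>2\<bar>)" using tri[of 2 "6 * t" "12 * t\<^sup>2"] by (simp add: w2_def)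
    also have "\<dots> \<le> C * 3"
    proof (rule mult_left_mono)
      have "\<bar>6 * t\<bar> = 6 * \<bar>t\<bar>" "\<bar>12 * t\<^sup>2\<bar> = 12 * t\<^sup>2" by (simp_all add: abs_mult)
      with pw(1)[OF t8(1)[OF that]] t8(1)[OF that] show "\<bar>2\<bar> + \<bar>6 * t\<bar> + \<bar>12 * t\<^sup>2\<bar> \<le> (3::real)" by linarith
    qed (use C in simp)
    finally show ?thesis by simp
  qed
  have dw: "(w has_real_derivative w1 t) (at t)" for t
    unfolding w_def w1_def by (auto intro!: derivative_eq_intros simp: algebra_simps)
  have dw1: "(w1 has_real_derivative w2 t) (at t)" for t
    unfolding w1_def w2_def by (auto intro!: derivative_eq_intros simp: algebra_simps)
  have dsq: "((\<lambda>t. sqrt (w t)) has_real_derivative d t) (at t)" if "\<bar>t\<bar> \<le> 1 / (8 * C)" for t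
  proof -
    have "w t > 0" using w(2)[OF that] by linarith
    from DERIV_chain2[where f = sqrt and g = w, OF DERIV_real_sqrt[OF this] dw]
    show ?thesis by (rule DERIV_cong) (simp add: d_def w1_def field_simps)
  qed
  define d2 where "d2 t = w2 t / (2 * sqrt (w t)) - (w1 t)\<^sup>2 / (4 * w t * sqrt (w t))" for t
  have dd: "(d has_real_derivative d2 t) (at t)" if "\<bar>t\<bar> \<le> 1 / (8 * C)" for t
  proof -
    have p: "w t > 0" "sqrt (w t) > 0" "w t = sqrt (w t) * sqrt (w t)" using w(2)[OF that] by auto
    have "((\<lambda>t. w1 t / (2 * sqrt (w t))) has_real_derivative
        (w2 t * (2 * sqrt (w t)) - w1 t * (2 * d t)) / ((2 * sqrt (w t)) * (2 * sqrt (w t)))) (at t)"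
      using p by (intro DERIV_divide dw1 DERIV_cmult dsq that) auto
    moreover have "(w2 t * (2 * sqrt (w t)) - w1 t * (2 * d t)) / ((2 * sqrt (w t)) * (2 * sqrt (w t))) = d2 t"
    proof -
      have dt: "d t = w1 t / (2 * sqrt (w t))" by (simp add: d_def w1_def)
      define y where "y = sqrt (w t)"
      have "y \<noteq> 0" "w t = y * y" using p by (auto simp: y_def)
      then show ?thesis unfolding d2_def dt y_def[symmetric] \<open>w t = y * y\<close>
        by (simp add: divide_simps power2_eq_square)
    qed
    moreover have "d = (\<lambda>t. w1 t / (2 * sqrt (w t)))" by (simp add: d_def w1_def)
    ultimately show ?thesis by simp
  qed
  have d2: "\<bar>d2 t\<bar> \<le> 4 * C" if t: "\<bar>t\<bar> \<le> 1 / (8 * C)" for t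
  proof -
    have "\<bar>w2 t / (2 * sqrt (w t))\<bar> \<le> 3 * C / 1"
      unfolding abs_divide using sw[OF t] w2[OF t] C by (intro frac_le) auto
    moreover have "\<bar>(w1 t)\<^sup>2 / (4 * w t * sqrt (w t))\<bar> \<le> (3 * C * \<bar>t\<bar>)\<^sup>2 / 1"
      unfolding abs_divide
    proof (intro frac_le)
      show "\<bar>(w1 t)\<^sup>2\<bar> \<le> (3 * C * \<bar>t\<bar>)\<^sup>2" using power_mono[OF w1[OF t], of 2] by simp
      have "1 \<le> 4 * (1/2) * (1/2 :: real)" by simp
      also have "\<dots> \<le> 4 * w t * sqrt (w t)" using sw[OF t] w(2)[OF t] by (intro mult_mono) auto
      finally show "1 \<le> \<bar>4 * w t * sqrt (w t)\<bar>" by simp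
    qed auto
    moreover have "(3 * C * \<bar>t\<bar>)\<^sup>2 \<le> C"
    proof -
      have "(3 * C * \<bar>t\<bar>)\<^sup>2 = (3 * (C * \<bar>t\<bar>))\<^sup>2" by (simp only: mult.assoc)
      also have "\<dots> \<le> (3 * (1/8))\<^sup>2" using t8(2)[OF t] C by (intro power_mono mult_left_mono) auto
      also have "\<dots> \<le> C" using C by (simp add: power2_eq_square)
      finally show ?thesis .
    qed
    ultimately show ?thesis unfolding d2_def by linarith
  qed
  show "\<bar>sqrt (w x) - sqrt (w t) - (x - t) * d t\<bar> \<le> 4 * C * (x - t)\<^sup>2"
    if t: "\<bar>t\<bar> \<le> 1 / (8 * C)" and x: "\<bar>x\<bar> \<le> 1 / (8 * C)" for t x
  proof -
    \<comment> \<open>The mean value inequality is used twice: for \<open>d\<close> on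
      \<open>I\<close>, then for \<open>sqrt (w x) - x * d t\<close> on the segment, where
      \<open>|y - t|\<close> is at most \<open>|x - t|\<close>. This gives a quadratic
      error.\<close>
    define I where "I = {- (1 / (8 * C)) .. 1 / (8 * C)}"
    define J where "J = closed_segment t x"
    have seg: "y \<in> I" "\<bar>y\<bar> \<le> 1 / (8 * C)" "\<bar>y - t\<bar> \<le> \<bar>x - t\<bar>" if "y \<in> J" for y
      using that t x by (auto simp: I_def J_def closed_segment_eq_real_ivl split: if_splits)
    have I: "convex I" "t \<in> I" using t by (auto simp: I_def)
    have J: "convex J" "x \<in> J" "t \<in> J" by (auto simp: J_def)
    have 1: "(d has_real_derivative d2 z) (at z within I)" if "z \<in> I" for z
      by (rule has_field_derivative_at_within[OF dd]) (use that in \<open>auto simp: I_def\<close>)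
    have 2: "norm (d2 z) \<le> 4 * C" if "z \<in> I" for z
      using that d2[of z] by (auto simp: I_def)
    have 3: "((\<lambda>x. sqrt (w x) - x * d t) has_real_derivative (d y - 1 * d t)) (at y within J)" if "y \<in> J" for y
      by (rule has_field_derivative_at_within)
         (intro DERIV_diff dsq seg(2)[OF that] DERIV_cmult_right DERIV_ident)
    have 4: "norm (d y - 1 * d t) \<le> 4 * C * \<bar>x - t\<bar>" if "y \<in> J" for y
    proof -
      have "norm (d y - d t) \<le> 4 * C * norm (y - t)"
        by (rule field_differentiable_bound[OF I(1) 1 2 seg(1)[OF that] I(2)])
      also have "\<dots> \<le> 4 * C * \<bar>x - t\<bar>" using seg(3)[OF that] C by (intro mult_left_mono) auto
      finally show ?thesis by simp
    qed
    have "norm ((sqrt (w x) - x * d t) - (sqrt (w t) - t * d t)) \<le> (4 * C * \<bar>x - t\<bar>) * norm (x - t)"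
      by (rule field_differentiable_bound[OF J(1) 3 4 J(2,3)])
    then have "\<bar>(sqrt (w x) - x * d t) - (sqrt (w t) - t * d t)\<bar> \<le> 4 * C * (\<bar>x - t\<bar> * \<bar>x - t\<bar>)"
      by simp
    then show ?thesis by (simp add: power2_eq_square algebra_simps)
  qed
  show "\<bar>d t - t * p\<bar> \<le> 4 * C * t\<^sup>2" if t: "\<bar>t\<bar> \<le> 1 / (8 * C)" for t
  proof -
    define y where "y = sqrt (w t)"
    have y: "y \<ge> 1/2" "w t = y * y" using sw[OF t] w(2)[OF t] by (auto simp: y_def)
    have "1 - w t = (1 - y) * (1 + y)" unfolding y(2) by (simp add: algebra_simps)
    then have "\<bar>1 - w t\<bar> = \<bar>1 - y\<bar> * (1 + y)" using y(1) by (simp add: abs_mult)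
    moreover have "\<bar>1 - y\<bar> * 1 \<le> \<bar>1 - y\<bar> * (1 + y)" using y(1) by (intro mult_left_mono) auto
    ultimately have "\<bar>1 - y\<bar> \<le> \<bar>1 - w t\<bar>" by simp
    also have "\<dots> \<le> 2 * C * t\<^sup>2" using w(1)[OF t] by (simp only: abs_minus_commute)
    finally have y1: "\<bar>1 - y\<bar> \<le> 2 * C * t\<^sup>2" .
    have "d t - t * p = (2 * t * (1 - y) * p + 3 * t\<^sup>2 * q + 4 * t ^ 3 * s) / (2 * y)"
      unfolding d_def y_def[symmetric] using y by (simp add: field_simps)
    then have "\<bar>d t - t * p\<bar> = \<bar>2 * t * (1 - y) * p + 3 * t\<^sup>2 * q + 4 * t ^ 3 * s\<bar> / (2 * y)"
      using y by simp
    also have "\<dots> \<le> C * (\<bar>2 * t * (1 - y)\<bar> + \<bar>3 * t\<^sup>2\<bar> + \<bar>4 * t ^ 3\<bar>) / 1"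
    proof (rule frac_le)
      show 1: "\<bar>2 * t * (1 - y) * p + 3 * t\<^sup>2 * q + 4 * t ^ 3 * s\<bar> \<le> C * (\<bar>2 * t * (1 - y)\<bar> + \<bar>3 * t\<^sup>2\<bar> + \<bar>4 * t ^ 3\<bar>)"
        by (rule tri)
      show "0 \<le> C * (\<bar>2 * t * (1 - y)\<bar> + \<bar>3 * t\<^sup>2\<bar> + \<bar>4 * t ^ 3\<bar>)"
        by (rule order_trans[OF abs_ge_zero 1])
    qed (use y in auto)
    also have "\<dots> \<le> C * (4 * t\<^sup>2)"
    proof -
      have "2 * \<bar>t\<bar> * \<bar>1 - y\<bar> \<le> 2 * \<bar>t\<bar> * (2 * C * t\<^sup>2)" using y1 by (intro mult_left_mono) auto
      also have "\<dots> = 4 * (C * \<bar>t\<bar>) * t\<^sup>2" by simp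
      also have "\<dots> \<le> 4 * (1/8) * t\<^sup>2" using t8(2)[OF t] by (intro mult_right_mono mult_left_mono) auto
      finally have "2 * \<bar>t\<bar> * \<bar>1 - y\<bar> \<le> t\<^sup>2 / 2" by simp
      moreover have "\<bar>2 * t * (1 - y)\<bar> = 2 * \<bar>t\<bar> * \<bar>1 - y\<bar>" "\<bar>3 * t\<^sup>2\<bar> = 3 * t\<^sup>2" "\<bar>4 * t ^ 3\<bar> = 4 * \<bar>t\<bar> ^ 3"
        by (simp_all add: abs_mult power_abs)
      ultimately have "\<bar>2 * t * (1 - y)\<bar> + \<bar>3 * t\<^sup>2\<bar> + \<bar>4 * t ^ 3\<bar> \<le> 4 * t\<^sup>2"
        using pw(2)[OF t8(1)[OF t]] zero_le_power2[of t] by linarith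
      then show ?thesis using C by (simp add: mult_left_mono)
    qed
    finally show ?thesis by simp
  qed
qed

text \<open>Where \<open>L > 0\<close> the root is
  \<open>L * sqrt (1 + t^2 p + t^3 q + t^4 s)\<close> with coefficients bounded by a constant, so
  the factor \<open>L\<close> absorbs the degeneracy at its zeros and all estimates are uniform. The
  second derivative at 0 is \<open>L * p = P\<close>.\<close>

lemma second_variation_sqrt_integral:
  fixes L P S T :: "'a::euclidean_space \<Rightarrow> real"
  assumes K: "compact K" and cont: "continuous_on K L" "continuous_on K P" "continuous_on K S" "continuous_on K T"
    and L: "\<And>z. z \<in> K \<Longrightarrow> L z \<ge> 0"
    and bnd: "\<And>z. z \<in> K \<Longrightarrow> \<bar>P z\<bar> \<le> C * L z" "\<And>z. z \<in> K \<Longrightarrow> \<bar>S z\<bar> \<le> C * (L z)\<^sup>2"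
      "\<And>z. z \<in> K \<Longrightarrow> \<bar>T z\<bar> \<le> C * (L z)\<^sup>2"
    and A: "\<And>t. A t = integral K (\<lambda>z. sqrt ((L z)\<^sup>2 + t\<^sup>2 * (L z * P z) + t ^ 3 * S z + t ^ 4 * T z))"
  shows "\<exists>A'. (\<forall>\<^sub>F t in nhds 0. (A has_real_derivative A' t) (at t)) \<and> (A' has_real_derivative integral K P) (at 0)"
proof -
  define C' where "C' = max C 1"
  have C': "C' \<ge> 1" "C \<le> C'" by (auto simp: C'_def)
  define \<delta> where "\<delta> = 1 / (8 * C')"
  have \<delta>: "\<delta> > 0" using C' by (simp add: \<delta>_def)
  have "bounded (L ` K)" using compact_continuous_image[OF cont(1) K] compact_imp_bounded by blast
  then obtain B where B: "\<And>z. z \<in> K \<Longrightarrow> \<bar>L z\<bar> \<le> B" unfolding bounded_iff real_norm_def by blast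
  define \<psi> where "\<psi> t z = sqrt ((L z)\<^sup>2 + t\<^sup>2 * (L z * P z) + t ^ 3 * S z + t ^ 4 * T z)" for t z
  define \<psi>' where "\<psi>' t z = (2 * t * (L z * P z) + 3 * t\<^sup>2 * S z + 4 * t ^ 3 * T z) / (2 * \<psi> t z)" for t z
  define E where "E = 4 * C' * \<bar>B\<bar>"
  have est: "\<bar>\<psi> x z - \<psi> t z - (x - t) * \<psi>' t z\<bar> \<le> E * (x - t)\<^sup>2 \<and> \<bar>\<psi>' t z - t * P z\<bar> \<le> E * t\<^sup>2"
    if z: "z \<in> K" and t: "\<bar>t\<bar> \<le> \<delta>" and x: "\<bar>x\<bar> \<le> \<delta>" for z t x
  proof (cases "L z = 0")
    \<comment> \<open>Where \<open>L\<close> vanishes all coefficients do, and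
      \<open>\<psi>'\<close> is 0 by the convention for division by 0.\<close>
    case True
    then have "P z = 0" "S z = 0" "T z = 0" using bnd[OF z] by auto
    then show ?thesis using True C' by (simp add: \<psi>_def \<psi>'_def E_def)
  next
    case False
    then have Lz: "L z > 0" using L[OF z] by simp
    define p where "p = P z / L z"
    define q where "q = S z / (L z)\<^sup>2"
    define s where "s = T z / (L z)\<^sup>2"
    have "C * L z \<le> C' * L z" "C * (L z)\<^sup>2 \<le> C' * (L z)\<^sup>2"
      using C'(2) Lz by (auto intro!: mult_right_mono)
    then have "\<bar>P z\<bar> \<le> C' * L z" "\<bar>S z\<bar> \<le> C' * (L z)\<^sup>2" "\<bar>T z\<bar> \<le> C' * (L z)\<^sup>2"
      using bnd[OF z] by linarith+
    then have pqs: "\<bar>p\<bar> \<le> C'" "\<bar>q\<bar> \<le> C'" "\<bar>s\<bar> \<le> C'"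
      using Lz by (simp_all add: p_def q_def s_def abs_div_pos[symmetric] pos_divide_le_eq)
    have PST: "P z = L z * p" "S z = (L z)\<^sup>2 * q" "T z = (L z)\<^sup>2 * s"
      using Lz by (simp_all add: p_def q_def s_def)
    have \<psi>: "\<psi> y z = L z * sqrt (1 + y\<^sup>2 * p + y ^ 3 * q + y ^ 4 * s)" for y
    proof -
      have "(L z)\<^sup>2 + y\<^sup>2 * (L z * P z) + y ^ 3 * S z + y ^ 4 * T z = (L z)\<^sup>2 * (1 + y\<^sup>2 * p + y ^ 3 * q + y ^ 4 * s)"
        unfolding PST by (simp add: power2_eq_square algebra_simps)
      then show ?thesis using Lz by (simp add: \<psi>_def real_sqrt_mult)
    qed
    have \<psi>': "\<psi>' t z = L z * ((2 * t * p + 3 * t\<^sup>2 * q + 4 * t ^ 3 * s) / (2 * sqrt (1 + t\<^sup>2 * p + t ^ 3 * q + t ^ 4 * s)))"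
    proof -
      have "2 * t * (L z * P z) + 3 * t\<^sup>2 * S z + 4 * t ^ 3 * T z = L z * (L z * (2 * t * p + 3 * t\<^sup>2 * q + 4 * t ^ 3 * s))"
        unfolding PST by (simp add: power2_eq_square algebra_simps)
      moreover have "2 * \<psi> t z = L z * (2 * sqrt (1 + t\<^sup>2 * p + t ^ 3 * q + t ^ 4 * s))"
        unfolding \<psi> by simp
      ultimately show ?thesis unfolding \<psi>'_def using Lz by (simp only: mult_divide_mult_cancel_left times_divide_eq_right)
    qed
    have LB: "L z * (4 * C' * y\<^sup>2) \<le> E * y\<^sup>2" for y
    proof -
      have "L z \<le> \<bar>B\<bar>" using B[OF z] by simp
      then have "L z * (4 * C' * y\<^sup>2) \<le> \<bar>B\<bar> * (4 * C' * y\<^sup>2)" using C' by (intro mult_right_mono) auto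
      then show ?thesis by (simp add: E_def mult_ac)
    qed
    note e = sqrt_quartic_estimates[OF C'(1) pqs]
    let ?w = "\<lambda>t. 1 + t\<^sup>2 * p + t ^ 3 * q + t ^ 4 * s"
    let ?d = "(2 * t * p + 3 * t\<^sup>2 * q + 4 * t ^ 3 * s) / (2 * sqrt (?w t))"
    have "\<psi> x z - \<psi> t z - (x - t) * \<psi>' t z = L z * (sqrt (?w x) - sqrt (?w t) - (x - t) * ?d)"
      unfolding \<psi> \<psi>' by (simp add: algebra_simps)
    then have "\<bar>\<psi> x z - \<psi> t z - (x - t) * \<psi>' t z\<bar> = L z * \<bar>sqrt (?w x) - sqrt (?w t) - (x - t) * ?d\<bar>"
      using Lz by (simp add: abs_mult)
    also have "\<dots> \<le> L z * (4 * C' * (x - t)\<^sup>2)"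
      using e(1)[OF t[unfolded \<delta>_def] x[unfolded \<delta>_def]] Lz by (intro mult_left_mono) auto
    also note LB
    finally have 1: "\<bar>\<psi> x z - \<psi> t z - (x - t) * \<psi>' t z\<bar> \<le> E * (x - t)\<^sup>2" .
    have "\<psi>' t z - t * P z = L z * (?d - t * p)"
      unfolding \<psi>' PST by (simp add: algebra_simps)
    then have "\<bar>\<psi>' t z - t * P z\<bar> = L z * \<bar>?d - t * p\<bar>"
      using Lz by (simp add: abs_mult)
    also have "\<dots> \<le> L z * (4 * C' * t\<^sup>2)"
      using e(2)[OF t[unfolded \<delta>_def]] Lz by (intro mult_left_mono) auto
    also note LB
    finally show ?thesis using 1 by blast
  qed
  have Kl: "K \<in> sets lebesgue" "K \<in> lmeasurable" using lmeasurable_compact[OF K] fmeasurableD by auto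
  have i\<psi>: "\<psi> t integrable_on K" for t
    unfolding \<psi>_def by (intro integrable_on_compact_continuous K continuous_intros cont)
  have iP: "P integrable_on K" by (intro integrable_on_compact_continuous K cont)
  have "bounded (P ` K)" using compact_continuous_image[OF cont(2) K] compact_imp_bounded by blast
  then obtain p where p: "\<And>z. z \<in> K \<Longrightarrow> \<bar>P z\<bar> \<le> p" unfolding bounded_iff real_norm_def by blast
  \<comment> \<open>The quotient reads 0 / 0 at zeros of \<open>L\<close>, so integrability is drawn
    from measurability and the bound in \<open>est\<close>.\<close>
  have i\<psi>': "\<psi>' t integrable_on K" if t: "\<bar>t\<bar> \<le> \<delta>" for t
  proof (rule measurable_bounded_by_integrable_imp_integrable_real)
    note [measurable] = continuous_imp_measurable_on_sets_lebesgue[OF cont(1) Kl(1)]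
      continuous_imp_measurable_on_sets_lebesgue[OF cont(2) Kl(1)]
      continuous_imp_measurable_on_sets_lebesgue[OF cont(3) Kl(1)]
      continuous_imp_measurable_on_sets_lebesgue[OF cont(4) Kl(1)]
    show "\<psi>' t \<in> borel_measurable (lebesgue_on K)"
      unfolding \<psi>'_def \<psi>_def by measurable
    show "(\<lambda>z. \<bar>t\<bar> * p + E * t\<^sup>2) integrable_on K" by (rule integrable_on_const[OF Kl(2)])
    show "\<bar>\<psi>' t z\<bar> \<le> \<bar>t\<bar> * p + E * t\<^sup>2" if z: "z \<in> K" for z
    proof -
      have "\<bar>t * P z\<bar> \<le> \<bar>t\<bar> * p" unfolding abs_mult using p[OF z] by (intro mult_left_mono) auto
      then show ?thesis using conjunct2[OF est[OF z t t]] by linarith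
    qed
  qed (rule Kl)
  have bound: "\<bar>integral K g\<bar> \<le> measure lebesgue K * E * y\<^sup>2"
    if "g integrable_on K" "\<And>z. z \<in> K \<Longrightarrow> \<bar>g z\<bar> \<le> E * y\<^sup>2" for g y
  proof -
    have "norm (integral K g) \<le> integral K (\<lambda>z. E * y\<^sup>2)"
      using that by (intro integral_norm_bound_integral integrable_on_const Kl) auto
    also have "\<dots> = E * y\<^sup>2 * integral K (\<lambda>z. 1)"
      using integral_mult_right[of K "E * y\<^sup>2" "\<lambda>z. 1"] by simp
    also have "\<dots> = measure lebesgue K * E * y\<^sup>2"
      using lmeasure_integral[OF Kl(2)] by simp
    finally show ?thesis by simp
  qed
  define A' where "A' t = integral K (\<psi>' t)" for t
  have A: "A t = integral K (\<psi> t)" for t unfolding A \<psi>_def ..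
  have dA: "(A has_real_derivative A' t) (at t)" if t: "\<bar>t\<bar> < \<delta>" for t
  proof (rule has_real_derivative_quadratic_bound)
    show "0 < \<delta> - \<bar>t\<bar>" using t by simp
    fix x assume "\<bar>x - t\<bar> < \<delta> - \<bar>t\<bar>"
    then have x: "\<bar>x\<bar> \<le> \<delta>" by linarith
    have t': "\<bar>t\<bar> \<le> \<delta>" using t by simp
    have "A x - A t - (x - t) * A' t = integral K (\<lambda>z. \<psi> x z - \<psi> t z - (x - t) * \<psi>' t z)"
      unfolding A A'_def
      by (intro integral_unique[symmetric] has_integral_diff has_integral_mult_right integrable_integral i\<psi> i\<psi>'[OF t'])
    also have "\<bar>\<dots>\<bar> \<le> measure lebesgue K * E * (x - t)\<^sup>2"
      using est[OF _ t' x] by (intro bound integrable_diff integrable_on_mult_right i\<psi> i\<psi>'[OF t']) blast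
    finally show "\<bar>A x - A t - (x - t) * A' t\<bar> \<le> measure lebesgue K * E * (x - t)\<^sup>2" .
  qed
  have "(A' has_real_derivative integral K P) (at 0)"
  proof (rule has_real_derivative_quadratic_bound[OF \<delta>])
    fix x assume "\<bar>x - 0\<bar> < \<delta>"
    then have x: "\<bar>x\<bar> \<le> \<delta>" by simp
    have A0: "A' 0 = 0" by (simp add: A'_def \<psi>'_def[abs_def])
    have "A' x - A' 0 - (x - 0) * integral K P = integral K (\<lambda>z. \<psi>' x z - x * P z)"
      unfolding A0 unfolding A'_def diff_zero
      by (intro integral_unique[symmetric] has_integral_diff has_integral_mult_right integrable_integral iP i\<psi>'[OF x])
    also have "\<bar>\<dots>\<bar> \<le> measure lebesgue K * E * x\<^sup>2"
      using est[OF _ x x] by (intro bound integrable_diff integrable_on_mult_right iP i\<psi>'[OF x]) blast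
    finally show "\<bar>A' x - A' 0 - (x - 0) * integral K P\<bar> \<le> measure lebesgue K * E * (x - 0)\<^sup>2" by simp
  qed
  moreover have "\<forall>\<^sub>F t in nhds 0. (A has_real_derivative A' t) (at t)"
    unfolding eventually_nhds_metric using \<delta> dA by (intro exI[of _ \<delta>]) (auto simp: dist_real_def)
  ultimately show ?thesis by blast
qed

section \<open>The Weierstrass frame and normal variations\<close>

text \<open>Twice the real part of the Weierstrass vector
  \<open>((1 - x^2) / 2, \<i> (1 + x^2) / 2, x)\<close>; \<open>frame_e2\<close> is the same for
  \<open>\<i>\<close> times that vector. With \<open>f\<close> left out, the frame does not
  degenerate at branch points.\<close>

definition frame_e1 :: "complex \<Rightarrow> real^3" where
  "frame_e1 x = vector [1 - Re (x\<^sup>2), - Im (x\<^sup>2), 2 * Re x]"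
definition frame_e2 :: "complex \<Rightarrow> real^3" where
  "frame_e2 x = vector [Im (x\<^sup>2), - 1 - Re (x\<^sup>2), - 2 * Im x]"
text \<open>Inverse stereographic projection from the north pole.\<close>

definition normal :: "complex \<Rightarrow> real^3" where
  "normal x = (1 / (1 + (norm x)\<^sup>2)) *\<^sub>R vector [2 * Re x, 2 * Im x, (norm x)\<^sup>2 - 1]"

lemma one_plus_norm_square_pos: "1 + (norm x)\<^sup>2 > 0" "1 + (norm x)\<^sup>2 \<noteq> 0" for x :: complex
proof -
  show "1 + (norm x)\<^sup>2 > 0" by (intro add_pos_nonneg) auto
  then show "1 + (norm x)\<^sup>2 \<noteq> 0" by linarith
qed

lemma frame_inner:
  "frame_e1 x \<bullet> frame_e1 x = (1 + (norm x)\<^sup>2)\<^sup>2" "frame_e2 x \<bullet> frame_e2 x = (1 + (norm x)\<^sup>2)\<^sup>2"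
  "frame_e1 x \<bullet> frame_e2 x = 0" "frame_e1 x \<bullet> normal x = 0" "frame_e2 x \<bullet> normal x = 0"
  "normal x \<bullet> normal x = 1"
proof -
  have nx: "(norm x)\<^sup>2 = Re x * Re x + Im x * Im x" unfolding cmod_power2 by (simp only: power2_eq_square)
  show "frame_e1 x \<bullet> frame_e1 x = (1 + (norm x)\<^sup>2)\<^sup>2" "frame_e2 x \<bullet> frame_e2 x = (1 + (norm x)\<^sup>2)\<^sup>2"
    "frame_e1 x \<bullet> frame_e2 x = 0"
    unfolding nx by (simp_all add: frame_e1_def frame_e2_def inner_vec_def sum_3 power2_eq_square algebra_simps)
  define v :: "real^3" where "v = vector [2 * Re x, 2 * Im x, (norm x)\<^sup>2 - 1]"
  have n: "normal x = (1 / (1 + (norm x)\<^sup>2)) *\<^sub>R v" by (simp add: normal_def v_def)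
  have "frame_e1 x \<bullet> v = 0" "frame_e2 x \<bullet> v = 0"
    unfolding v_def nx by (simp_all add: frame_e1_def frame_e2_def inner_vec_def sum_3 power2_eq_square algebra_simps)
  then show "frame_e1 x \<bullet> normal x = 0" "frame_e2 x \<bullet> normal x = 0" by (simp_all add: n)
  have "v \<bullet> v = (1 + (norm x)\<^sup>2)\<^sup>2"
    unfolding v_def nx by (simp add: inner_vec_def sum_3 power2_eq_square algebra_simps)
  then show "normal x \<bullet> normal x = 1" using one_plus_norm_square_pos(2)[of x] by (simp add: n power2_eq_square)
qed

text \<open>By Lagrange's identity for the cross product only inner products enter, so no
  orientation of the frame has to be checked.\<close>

lemma norm_cross_frame:
  fixes e f n :: "real^3"
  assumes "e \<bullet> e = s" "f \<bullet> f = s" "e \<bullet> f = 0" "e \<bullet> n = 0" "f \<bullet> n = 0" "n \<bullet> n = 1"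
  shows "norm (cross3 (p1 *\<^sub>R e + p2 *\<^sub>R f + p3 *\<^sub>R n) (q1 *\<^sub>R e + q2 *\<^sub>R f + q3 *\<^sub>R n))
    = sqrt (s\<^sup>2 * (p1 * q2 - p2 * q1)\<^sup>2 + s * ((q3 * p1 - p3 * q1)\<^sup>2 + (q3 * p2 - p3 * q2)\<^sup>2))"
proof -
  define X where "X = p1 *\<^sub>R e + p2 *\<^sub>R f + p3 *\<^sub>R n"
  define Y where "Y = q1 *\<^sub>R e + q2 *\<^sub>R f + q3 *\<^sub>R n"
  have c: "f \<bullet> e = 0" "n \<bullet> e = 0" "n \<bullet> f = 0" using assms by (auto simp: inner_commute)
  have "X \<bullet> X = s * (p1\<^sup>2 + p2\<^sup>2) + p3\<^sup>2" "Y \<bullet> Y = s * (q1\<^sup>2 + q2\<^sup>2) + q3\<^sup>2"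
    "X \<bullet> Y = s * (p1 * q1 + p2 * q2) + p3 * q3"
    by (simp_all add: X_def Y_def inner_add_left inner_add_right assms c power2_eq_square algebra_simps)
  moreover have "(norm (cross3 X Y))\<^sup>2 = (X \<bullet> X) * (Y \<bullet> Y) - (X \<bullet> Y)\<^sup>2"
    using norm_cross_dot[of X Y] by (simp add: power_mult_distrib dot_square_norm)
  ultimately have "(norm (cross3 X Y))\<^sup>2 = s\<^sup>2 * (p1 * q2 - p2 * q1)\<^sup>2 + s * ((q3 * p1 - p3 * q1)\<^sup>2 + (q3 * p2 - p3 * q2)\<^sup>2)"
    by (simp add: power2_eq_square algebra_simps)
  then show ?thesis unfolding X_def Y_def by (metis norm_ge_zero real_sqrt_unique)
qed

text \<open>Inverse stereographic projection is conformal and the frame spans the tangent plane of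
  the sphere, so \<open>dN\<close> lives in the frame already used for \<open>dh\<close>. The frame
  vectors have length \<open>1 + |g|^2\<close>, whence
  \<open>|\<nabla>N|^2 = 8 |g'|^2 / (1 + |g|^2)^2\<close>.\<close>

lemma has_derivative_normal:
  assumes "(g has_field_derivative g') (at z)"
  shows "((\<lambda>z. normal (g z)) has_derivative (\<lambda>v. (2 / (1 + (norm (g z))\<^sup>2)\<^sup>2) *\<^sub>R
    (Re (g' * v) *\<^sub>R frame_e1 (g z) - Im (g' * v) *\<^sub>R frame_e2 (g z)))) (at z)"
proof -
  define w where "w z = 1 + ((Re (g z))\<^sup>2 + (Im (g z))\<^sup>2)" for z
  have w: "w z = 1 + (norm (g z))\<^sup>2" for z by (simp add: w_def cmod_power2)
  have wn: "w z \<noteq> 0" for z using one_plus_norm_square_pos(2)[of "g z"] by (simp add: w)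
  have gd: "(g has_derivative (\<lambda>v. g' * v)) (at z)"
    using assms by (simp add: has_field_derivative_def)
  note R = has_derivative_Re[OF gd] and I = has_derivative_Im[OF gd]
  have dw: "(w has_derivative (\<lambda>v. 2 * Re (g z) * Re (g' * v) + 2 * Im (g z) * Im (g' * v))) (at z)"
    unfolding w_def by (rule R I derivative_eq_intros refl)+ (simp add: fun_eq_iff algebra_simps)
  have n: "normal (g z) = (2 * Re (g z) / w z) *\<^sub>R axis 1 1 + (2 * Im (g z) / w z) *\<^sub>R axis 2 1
    + ((w z - 2) / w z) *\<^sub>R axis 3 1" for z
    by (simp add: vec_eq_iff forall_3 normal_def axis_def w[symmetric])
  have D: "((\<lambda>z. F z / w z) has_derivative (\<lambda>v. (F' v * w z - F z * (2 * Re (g z) * Re (g' * v) + 2 * Im (g z) * Im (g' * v))) / (w z)\<^sup>2)) (at z)"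
    if "(F has_derivative F') (at z)" for F F'
    using has_derivative_divide[OF that dw wn]
    by (rule has_derivative_eq_rhs) (use wn in \<open>simp add: fun_eq_iff field_simps power2_eq_square\<close>)
  have 1: "((\<lambda>z. 2 * Re (g z)) has_derivative (\<lambda>v. 2 * Re (g' * v))) (at z)"
    and 2: "((\<lambda>z. 2 * Im (g z)) has_derivative (\<lambda>v. 2 * Im (g' * v))) (at z)"
    and 3: "((\<lambda>z. w z - 2) has_derivative (\<lambda>v. 2 * Re (g z) * Re (g' * v) + 2 * Im (g z) * Im (g' * v))) (at z)"
    using has_derivative_mult_right[OF R, of 2] has_derivative_mult_right[OF I, of 2]
      has_derivative_diff[OF dw has_derivative_const[of 2]] by simp_all
  show ?thesis
    unfolding n
  proof (rule has_derivative_eq_rhs[OF has_derivative_add[OF has_derivative_add[OF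
          has_derivative_scaleR_left[OF D[OF 1]] has_derivative_scaleR_left[OF D[OF 2]]] has_derivative_scaleR_left[OF D[OF 3]]]], rule ext)
    fix v
    define x y where "x = Re (g z)" and "y = Im (g z)"
    define p q where "p = Re (g' * v)" and "q = Im (g' * v)"
    have W: "w z = 1 + (x\<^sup>2 + y\<^sup>2)" by (simp add: w_def x_def y_def)
    have sq: "Re ((g z)\<^sup>2) = x\<^sup>2 - y\<^sup>2" "Im ((g z)\<^sup>2) = 2 * x * y"
      by (simp_all add: x_def y_def power2_eq_square)
    have c1: "(2 * p * w z - 2 * x * (2 * x * p + 2 * y * q)) / (w z)\<^sup>2 = 2 / (w z)\<^sup>2 * (p * (1 - (x\<^sup>2 - y\<^sup>2)) - q * (2 * x * y))"
      unfolding W by (simp add: divide_inverse power2_eq_square algebra_simps)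
    have c2: "(2 * q * w z - 2 * y * (2 * x * p + 2 * y * q)) / (w z)\<^sup>2 = 2 / (w z)\<^sup>2 * (p * (- (2 * x * y)) - q * (- 1 - (x\<^sup>2 - y\<^sup>2)))"
      unfolding W by (simp add: divide_inverse power2_eq_square algebra_simps)
    have c3: "((2 * x * p + 2 * y * q) * w z - (w z - 2) * (2 * x * p + 2 * y * q)) / (w z)\<^sup>2 = 2 / (w z)\<^sup>2 * (p * (2 * x) - q * (- 2 * y))"
      unfolding W by (simp add: divide_inverse power2_eq_square algebra_simps)
    show "((2 * Re (g' * v) * w z - 2 * Re (g z) * (2 * Re (g z) * Re (g' * v) + 2 * Im (g z) * Im (g' * v))) / (w z)\<^sup>2) *\<^sub>R axis 1 1
       + ((2 * Im (g' * v) * w z - 2 * Im (g z) * (2 * Re (g z) * Re (g' * v) + 2 * Im (g z) * Im (g' * v))) / (w z)\<^sup>2) *\<^sub>R axis 2 1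
       + (((2 * Re (g z) * Re (g' * v) + 2 * Im (g z) * Im (g' * v)) * w z - (w z - 2) * (2 * Re (g z) * Re (g' * v) + 2 * Im (g z) * Im (g' * v))) / (w z)\<^sup>2) *\<^sub>R axis 3 1
       = (2 / (1 + (norm (g z))\<^sup>2)\<^sup>2) *\<^sub>R (Re (g' * v) *\<^sub>R frame_e1 (g z) - Im (g' * v) *\<^sub>R frame_e2 (g z))"
      unfolding w[symmetric] p_def[symmetric] q_def[symmetric] x_def[symmetric] y_def[symmetric] c1 c2 c3
      by (simp add: vec_eq_iff forall_3 axis_def frame_e1_def frame_e2_def sq x_def[symmetric] y_def[symmetric])
  qed
qed

lemma WE_frame:
  assumes "WE_rep r h f g" "norm z \<le> r"
  shows "pdx h z = Re (f z) *\<^sub>R frame_e1 (g z) + Im (f z) *\<^sub>R frame_e2 (g z)"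
    "pdy h z = - Im (f z) *\<^sub>R frame_e1 (g z) + Re (f z) *\<^sub>R frame_e2 (g z)"
proof -
  have c: "pdx h z $ j = 2 * Re (dz h j z)" "pdy h z $ j = - 2 * Im (dz h j z)" for j
    by (simp_all add: dz_def)
  have "dz h 1 z = f z * (1 - (g z)\<^sup>2) / 2" "dz h 2 z = \<i> / 2 * f z * (1 + (g z)\<^sup>2)" "dz h 3 z = f z * g z"
    using assms by (auto simp: WE_rep_def)
  note d = this
  show "pdx h z = Re (f z) *\<^sub>R frame_e1 (g z) + Im (f z) *\<^sub>R frame_e2 (g z)"
    "pdy h z = - Im (f z) *\<^sub>R frame_e1 (g z) + Re (f z) *\<^sub>R frame_e2 (g z)"
    unfolding vec_eq_iff forall_3 c d
    by (simp_all add: frame_e1_def frame_e2_def field_simps)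
qed

text \<open>The tangential determinant is \<open>F - t^2 y^2 \<beta>\<close>. Its linear term
  cancels because the shape operator is traceless, which is minimality; so the expansion starts at
  \<open>t^2\<close>.\<close>

lemma area_integrand_expansion:
  fixes f1 f2 b1 b2 w y yx yy t :: real
  defines "F \<equiv> f1\<^sup>2 + f2\<^sup>2" and "\<beta> \<equiv> b1\<^sup>2 + b2\<^sup>2" and "G \<equiv> yx\<^sup>2 + yy\<^sup>2"
  shows "(w\<^sup>2)\<^sup>2 * ((f1 + t * y * b1) * (f1 - t * y * b1) - (f2 - t * y * b2) * (- f2 - t * y * b2))\<^sup>2
    + w\<^sup>2 * ((t * yy * (f1 + t * y * b1) - t * yx * (- f2 - t * y * b2))\<^sup>2 + (t * yy * (f2 - t * y * b2) - t * yx * (f1 - t * y * b1))\<^sup>2)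
    = (w\<^sup>2 * F)\<^sup>2 + t\<^sup>2 * (w\<^sup>2 * F * (G - 2 * w\<^sup>2 * \<beta> * y\<^sup>2))
      + t ^ 3 * (2 * w\<^sup>2 * y * ((yy * f1 + yx * f2) * (yy * b1 + yx * b2) + (yy * f2 - yx * f1) * (yx * b1 - yy * b2)))
      + t ^ 4 * (w ^ 4 * y ^ 4 * \<beta>\<^sup>2 + w\<^sup>2 * y\<^sup>2 * \<beta> * G)"
  unfolding F_def \<beta>_def G_def by algebra

text \<open>Counting degrees: \<open>y\<close>, \<open>yx\<close>, \<open>yy\<close>,
  \<open>f1\<close>, \<open>f2\<close> are all \<open>O(n)\<close>. The first expression has degree
  2 in them, the other two have degree 4, and \<open>n^2 \<le> w^2 (f1^2 + f2^2)\<close> as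
  \<open>w \<ge> 1\<close>.\<close>

lemma area_coefficient_bounds:
  fixes c B W :: real
  assumes "c \<ge> 0" "B \<ge> 0"
  obtains C where "C \<ge> 0"
    "\<And>f1 f2 b1 b2 w y yx yy n. \<lbrakk>n = sqrt (f1\<^sup>2 + f2\<^sup>2); 1 \<le> w; w \<le> W; \<bar>b1\<bar> \<le> B; \<bar>b2\<bar> \<le> B;
      \<bar>y\<bar> \<le> c * n; \<bar>yx\<bar> \<le> c * n; \<bar>yy\<bar> \<le> c * n\<rbrakk> \<Longrightarrow>
      \<bar>(yx\<^sup>2 + yy\<^sup>2) - 2 * w\<^sup>2 * (b1\<^sup>2 + b2\<^sup>2) * y\<^sup>2\<bar> \<le> C * (w\<^sup>2 * (f1\<^sup>2 + f2\<^sup>2)) \<and>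
      \<bar>2 * w\<^sup>2 * y * ((yy * f1 + yx * f2) * (yy * b1 + yx * b2) + (yy * f2 - yx * f1) * (yx * b1 - yy * b2))\<bar>
        \<le> C * (w\<^sup>2 * (f1\<^sup>2 + f2\<^sup>2))\<^sup>2 \<and>
      \<bar>w ^ 4 * y ^ 4 * (b1\<^sup>2 + b2\<^sup>2)\<^sup>2 + w\<^sup>2 * y\<^sup>2 * (b1\<^sup>2 + b2\<^sup>2) * (yx\<^sup>2 + yy\<^sup>2)\<bar>
        \<le> C * (w\<^sup>2 * (f1\<^sup>2 + f2\<^sup>2))\<^sup>2"
proof -
  define CP where "CP = 2 * c\<^sup>2 + 4 * W\<^sup>2 * B\<^sup>2 * c\<^sup>2"
  define CS where "CS = 16 * W\<^sup>2 * c ^ 3 * B"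
  define CT where "CT = 4 * W ^ 4 * c ^ 4 * B ^ 4 + 4 * W\<^sup>2 * c ^ 4 * B\<^sup>2"
  define C where "C = CP + CS + CT"
  have nonneg: "CP \<ge> 0" "CS \<ge> 0" "CT \<ge> 0" using assms by (auto simp: CP_def CS_def CT_def)
  show ?thesis
  proof (rule that[of C])
    show "C \<ge> 0" using nonneg by (simp add: C_def)
    fix f1 f2 b1 b2 w y yx yy n :: real
    assume n: "n = sqrt (f1\<^sup>2 + f2\<^sup>2)" and w: "1 \<le> w" "w \<le> W" and b: "\<bar>b1\<bar> \<le> B" "\<bar>b2\<bar> \<le> B"
      and y: "\<bar>y\<bar> \<le> c * n" "\<bar>yx\<bar> \<le> c * n" "\<bar>yy\<bar> \<le> c * n"
    have n0: "n \<ge> 0" and nn: "n\<^sup>2 = f1\<^sup>2 + f2\<^sup>2" by (auto simp: n)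
    have f: "\<bar>f1\<bar> \<le> n" "\<bar>f2\<bar> \<le> n" unfolding n by (auto intro!: real_le_rsqrt simp: power2_abs)
    have cn: "c * n \<ge> 0" using assms n0 by simp
    have sq: "u\<^sup>2 \<le> (c * n)\<^sup>2" if "\<bar>u\<bar> \<le> c * n" for u
      using power_mono[OF that, of 2] by simp
    have \<beta>: "b1\<^sup>2 + b2\<^sup>2 \<le> 2 * B\<^sup>2" "0 \<le> b1\<^sup>2 + b2\<^sup>2"
      using power_mono[OF b(1), of 2] power_mono[OF b(2), of 2] by simp_all
    have G: "yx\<^sup>2 + yy\<^sup>2 \<le> 2 * (c * n)\<^sup>2" "0 \<le> yx\<^sup>2 + yy\<^sup>2" using sq[OF y(2)] sq[OF y(3)] by simp_all
    have w2: "w\<^sup>2 \<le> W\<^sup>2" "w ^ 4 \<le> W ^ 4" "w\<^sup>2 \<ge> 1" using w by (auto intro: power_mono one_le_power)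
    have y4: "y ^ 4 \<le> (c * n) ^ 4" using power_mono[OF y(1), of 4] by simp
    have L: "n\<^sup>2 \<le> w\<^sup>2 * (f1\<^sup>2 + f2\<^sup>2)" unfolding nn[symmetric] using w2(3) by (simp add: mult_le_cancel_right1)
    have L2: "n ^ 4 \<le> (w\<^sup>2 * (f1\<^sup>2 + f2\<^sup>2))\<^sup>2" using power_mono[OF L, of 2] by simp
    have P: "w\<^sup>2 * (b1\<^sup>2 + b2\<^sup>2) * y\<^sup>2 \<le> W\<^sup>2 * (2 * B\<^sup>2) * (c * n)\<^sup>2" "0 \<le> w\<^sup>2 * (b1\<^sup>2 + b2\<^sup>2) * y\<^sup>2"
      using w2 \<beta> sq[OF y(1)] by (auto intro!: mult_mono mult_nonneg_nonneg)
    have "\<bar>(yx\<^sup>2 + yy\<^sup>2) - 2 * w\<^sup>2 * (b1\<^sup>2 + b2\<^sup>2) * y\<^sup>2\<bar> \<le> 2 * (c * n)\<^sup>2 + 2 * (W\<^sup>2 * (2 * B\<^sup>2) * (c * n)\<^sup>2)"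
    proof -
      define q where "q = w\<^sup>2 * (b1\<^sup>2 + b2\<^sup>2) * y\<^sup>2"
      define q' where "q' = W\<^sup>2 * (2 * B\<^sup>2) * (c * n)\<^sup>2"
      have e: "2 * w\<^sup>2 * (b1\<^sup>2 + b2\<^sup>2) * y\<^sup>2 = 2 * q" by (simp add: q_def)
      show ?thesis
        using G P zero_le_power2[of "c * n"] unfolding e q_def[symmetric] q'_def[symmetric] by linarith
    qed
    also have "\<dots> = CP * n\<^sup>2" by (simp add: CP_def power_mult_distrib algebra_simps)
    also have "\<dots> \<le> C * (w\<^sup>2 * (f1\<^sup>2 + f2\<^sup>2))"
      using nonneg L by (intro mult_mono) (auto simp: C_def)
    finally have 1: "\<bar>(yx\<^sup>2 + yy\<^sup>2) - 2 * w\<^sup>2 * (b1\<^sup>2 + b2\<^sup>2) * y\<^sup>2\<bar> \<le> C * (w\<^sup>2 * (f1\<^sup>2 + f2\<^sup>2))" .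
    have pr: "\<bar>u * v\<bar> \<le> (c * n) * m" if "\<bar>u\<bar> \<le> c * n" "\<bar>v\<bar> \<le> m" for u v m
      unfolding abs_mult using that cn by (intro mult_mono) auto
    have s1: "\<bar>yy * f1 + yx * f2\<bar> \<le> 2 * (c * n * n)" "\<bar>yy * f2 - yx * f1\<bar> \<le> 2 * (c * n * n)"
      using pr[OF y(3) f(1)] pr[OF y(2) f(2)] pr[OF y(3) f(2)] pr[OF y(2) f(1)] by linarith+
    have s2: "\<bar>yy * b1 + yx * b2\<bar> \<le> 2 * (c * n * B)" "\<bar>yx * b1 - yy * b2\<bar> \<le> 2 * (c * n * B)"
      using pr[OF y(3) b(1)] pr[OF y(2) b(2)] pr[OF y(2) b(1)] pr[OF y(3) b(2)] by linarith+
    have cnn: "0 \<le> 2 * (c * n * n)" using cn n0 by simp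
    have "\<bar>(yy * f1 + yx * f2) * (yy * b1 + yx * b2)\<bar> \<le> 2 * (c * n * n) * (2 * (c * n * B))"
      "\<bar>(yy * f2 - yx * f1) * (yx * b1 - yy * b2)\<bar> \<le> 2 * (c * n * n) * (2 * (c * n * B))"
      unfolding abs_mult[of "yy * f1 + yx * f2"] abs_mult[of "yy * f2 - yx * f1"]
      by (rule mult_mono[OF s1(1) s2(1) cnn abs_ge_zero] mult_mono[OF s1(2) s2(2) cnn abs_ge_zero])+
    then have s3: "\<bar>(yy * f1 + yx * f2) * (yy * b1 + yx * b2) + (yy * f2 - yx * f1) * (yx * b1 - yy * b2)\<bar> \<le> 2 * (2 * (c * n * n) * (2 * (c * n * B)))"
      by linarith
    have "\<bar>2 * w\<^sup>2 * y * ((yy * f1 + yx * f2) * (yy * b1 + yx * b2) + (yy * f2 - yx * f1) * (yx * b1 - yy * b2))\<bar>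
      \<le> 2 * W\<^sup>2 * (c * n) * (2 * (2 * (c * n * n) * (2 * (c * n * B))))"
      unfolding abs_mult[of "2 * w\<^sup>2 * y"] abs_mult[of "2 * w\<^sup>2"]
      using s3 y(1) w2 cn by (intro mult_mono) auto
    also have "\<dots> = CS * n ^ 4" by (simp add: CS_def power_mult_distrib power4_eq_xxxx power3_eq_cube algebra_simps)
    also have "\<dots> \<le> C * (w\<^sup>2 * (f1\<^sup>2 + f2\<^sup>2))\<^sup>2"
      using nonneg L2 by (intro mult_mono) (auto simp: C_def)
    finally have 2: "\<bar>2 * w\<^sup>2 * y * ((yy * f1 + yx * f2) * (yy * b1 + yx * b2) + (yy * f2 - yx * f1) * (yx * b1 - yy * b2))\<bar>
      \<le> C * (w\<^sup>2 * (f1\<^sup>2 + f2\<^sup>2))\<^sup>2" .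
    have t1: "w ^ 4 * y ^ 4 * (b1\<^sup>2 + b2\<^sup>2)\<^sup>2 \<le> W ^ 4 * (c * n) ^ 4 * (2 * B\<^sup>2)\<^sup>2"
      using w2 y4 power_mono[OF \<beta>, of 2] by (intro mult_mono) auto
    have t2: "w\<^sup>2 * y\<^sup>2 * (b1\<^sup>2 + b2\<^sup>2) * (yx\<^sup>2 + yy\<^sup>2) \<le> W\<^sup>2 * (c * n)\<^sup>2 * (2 * B\<^sup>2) * (2 * (c * n)\<^sup>2)"
      using w2 sq[OF y(1)] \<beta> G by (intro mult_mono) auto
    have "0 \<le> w ^ 4 * y ^ 4 * (b1\<^sup>2 + b2\<^sup>2)\<^sup>2 + w\<^sup>2 * y\<^sup>2 * (b1\<^sup>2 + b2\<^sup>2) * (yx\<^sup>2 + yy\<^sup>2)"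
      by (intro add_nonneg_nonneg mult_nonneg_nonneg) auto
    then have "\<bar>w ^ 4 * y ^ 4 * (b1\<^sup>2 + b2\<^sup>2)\<^sup>2 + w\<^sup>2 * y\<^sup>2 * (b1\<^sup>2 + b2\<^sup>2) * (yx\<^sup>2 + yy\<^sup>2)\<bar>
      \<le> W ^ 4 * (c * n) ^ 4 * (2 * B\<^sup>2)\<^sup>2 + W\<^sup>2 * (c * n)\<^sup>2 * (2 * B\<^sup>2) * (2 * (c * n)\<^sup>2)"
      using t1 t2 by linarith
    also have "\<dots> = CT * n ^ 4"
      by (simp add: CT_def power_mult_distrib power4_eq_xxxx power2_eq_square algebra_simps)
    also have "\<dots> \<le> C * (w\<^sup>2 * (f1\<^sup>2 + f2\<^sup>2))\<^sup>2"
      using nonneg L2 by (intro mult_mono) (auto simp: C_def)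
    finally show "\<bar>(yx\<^sup>2 + yy\<^sup>2) - 2 * w\<^sup>2 * (b1\<^sup>2 + b2\<^sup>2) * y\<^sup>2\<bar> \<le> C * (w\<^sup>2 * (f1\<^sup>2 + f2\<^sup>2)) \<and>
      \<bar>2 * w\<^sup>2 * y * ((yy * f1 + yx * f2) * (yy * b1 + yx * b2) + (yy * f2 - yx * f1) * (yx * b1 - yy * b2))\<bar>
        \<le> C * (w\<^sup>2 * (f1\<^sup>2 + f2\<^sup>2))\<^sup>2 \<and>
      \<bar>w ^ 4 * y ^ 4 * (b1\<^sup>2 + b2\<^sup>2)\<^sup>2 + w\<^sup>2 * y\<^sup>2 * (b1\<^sup>2 + b2\<^sup>2) * (yx\<^sup>2 + yy\<^sup>2)\<bar>
        \<le> C * (w\<^sup>2 * (f1\<^sup>2 + f2\<^sup>2))\<^sup>2"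
      using 1 2 by blast
  qed
qed

lemma continuous_on_compact_bound:
  fixes f :: "'a::topological_space \<Rightarrow> 'b::real_normed_vector"
  assumes "compact A" "continuous_on A f"
  obtains B where "B \<ge> 0" "\<And>x. x \<in> A \<Longrightarrow> norm (f x) \<le> B"
proof -
  have "bounded (f ` A)" using compact_continuous_image[OF assms(2,1)] compact_imp_bounded by blast
  then obtain b where "\<And>x. x \<in> A \<Longrightarrow> norm (f x) \<le> b" unfolding bounded_iff by blast
  then show ?thesis using that[of "max b 0"] by fastforce
qed

text \<open>\<open>L\<close> is the area density of \<open>h\<close>, and the \<open>t^2\<close>
  coefficient under the root is \<open>L\<close> times the index integrand. The root divides
  \<open>L\<close> out again, which is why the second variation depends on \<open>g\<close>
  alone.\<close>

lemma normal_second_variation: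
  assumes U: "open U" "cball 0 r \<subseteq> U" and hol: "f holomorphic_on U" "g holomorphic_on U"
    and \<psi>: "Ck (Suc 0) U \<psi>" and h: "\<And>z. norm z \<le> r \<Longrightarrow> h differentiable at z" and WE: "WE_rep r h f g"
    and c: "c \<ge> 0" "\<And>z. norm z \<le> r \<Longrightarrow> \<bar>\<psi> z\<bar> \<le> c * norm (f z)"
      "\<And>z. norm z \<le> r \<Longrightarrow> \<bar>pdx \<psi> z\<bar> \<le> c * norm (f z)" "\<And>z. norm z \<le> r \<Longrightarrow> \<bar>pdy \<psi> z\<bar> \<le> c * norm (f z)"
  shows "\<exists>A'. (\<forall>\<^sub>F t in nhds 0. ((\<lambda>s. area r (\<lambda>z. h z + s *\<^sub>R (\<psi> z *\<^sub>R normal (g z)))) has_real_derivative A' t) (at t)) \<and>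
    (A' has_real_derivative integral (cball 0 r) (\<lambda>z. (pdx \<psi> z)\<^sup>2 + (pdy \<psi> z)\<^sup>2
      - 8 * (norm (deriv g z))\<^sup>2 / (1 + (norm (g z))\<^sup>2)\<^sup>2 * (\<psi> z)\<^sup>2)) (at 0)"
proof -
  let ?B = "cball (0::complex) r"
  define w where "w z = 1 + (norm (g z))\<^sup>2" for z
  define b1 where "b1 z = 2 / (w z)\<^sup>2 * Re (deriv g z)" for z
  define b2 where "b2 z = 2 / (w z)\<^sup>2 * Im (deriv g z)" for z
  define f1 where "f1 z = Re (f z)" for z
  define f2 where "f2 z = Im (f z)" for z
  define yx where "yx = pdx \<psi>"
  define yy where "yy = pdy \<psi>"
  define L where "L z = (w z)\<^sup>2 * ((f1 z)\<^sup>2 + (f2 z)\<^sup>2)" for z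
  define P where "P z = ((yx z)\<^sup>2 + (yy z)\<^sup>2) - 2 * (w z)\<^sup>2 * ((b1 z)\<^sup>2 + (b2 z)\<^sup>2) * (\<psi> z)\<^sup>2" for z
  define S where "S z = 2 * (w z)\<^sup>2 * \<psi> z * ((yy z * f1 z + yx z * f2 z) * (yy z * b1 z + yx z * b2 z)
      + (yy z * f2 z - yx z * f1 z) * (yx z * b1 z - yy z * b2 z))" for z
  define T where "T z = (w z) ^ 4 * \<psi> z ^ 4 * ((b1 z)\<^sup>2 + (b2 z)\<^sup>2)\<^sup>2
      + (w z)\<^sup>2 * (\<psi> z)\<^sup>2 * ((b1 z)\<^sup>2 + (b2 z)\<^sup>2) * ((yx z)\<^sup>2 + (yy z)\<^sup>2)" for z
  have w0: "w z \<ge> 1" "w z \<noteq> 0" for z using one_plus_norm_square_pos(2)[of "g z"] by (auto simp: w_def)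
  have integrand: "norm (cross3 (pdx (\<lambda>z. h z + t *\<^sub>R (\<psi> z *\<^sub>R normal (g z))) z) (pdy (\<lambda>z. h z + t *\<^sub>R (\<psi> z *\<^sub>R normal (g z))) z))
      = sqrt ((L z)\<^sup>2 + t\<^sup>2 * (L z * P z) + t ^ 3 * S z + t ^ 4 * T z)" if z: "norm z \<le> r" for t z
  proof -
    have zU: "z \<in> U" using z U(2) by auto
    have dg: "(g has_field_derivative deriv g z) (at z)" by (rule holomorphic_derivI[OF hol(2) U(1) zU])
    have dh: "(h has_derivative frechet_derivative h (at z)) (at z)" using h[OF z] frechet_derivative_works by blast
    have D: "((\<lambda>z. h z + t *\<^sub>R (\<psi> z *\<^sub>R normal (g z))) has_derivative (\<lambda>v. frechet_derivative h (at z) v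
       + t *\<^sub>R (\<psi> z *\<^sub>R ((2 / (1 + (norm (g z))\<^sup>2)\<^sup>2) *\<^sub>R (Re (deriv g z * v) *\<^sub>R frame_e1 (g z) - Im (deriv g z * v) *\<^sub>R frame_e2 (g z)))
         + frechet_derivative \<psi> (at z) v *\<^sub>R normal (g z)))) (at z)"
      by (intro has_derivative_add dh has_derivative_scaleR_right has_derivative_scaleR
          Ck_Suc_has_derivative[OF U(1) \<psi> zU] has_derivative_normal[OF dg])
    note WEz = WE_frame[OF WE z]
    have px: "pdx (\<lambda>z. h z + t *\<^sub>R (\<psi> z *\<^sub>R normal (g z))) z = (f1 z + t * \<psi> z * b1 z) *\<^sub>R frame_e1 (g z)
      + (f2 z - t * \<psi> z * b2 z) *\<^sub>R frame_e2 (g z) + (t * yx z) *\<^sub>R normal (g z)"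
      unfolding pd_has_derivative(1)[OF D] yx_def b1_def b2_def f1_def f2_def w_def[symmetric]
      unfolding pdx_def[symmetric] WEz
      by (simp add: algebra_simps)
    have py: "pdy (\<lambda>z. h z + t *\<^sub>R (\<psi> z *\<^sub>R normal (g z))) z = (- f2 z - t * \<psi> z * b2 z) *\<^sub>R frame_e1 (g z)
      + (f1 z - t * \<psi> z * b1 z) *\<^sub>R frame_e2 (g z) + (t * yy z) *\<^sub>R normal (g z)"
      unfolding pd_has_derivative(2)[OF D] yy_def b1_def b2_def f1_def f2_def w_def[symmetric]
      unfolding pdy_def[symmetric] WEz
      by (simp add: algebra_simps)
    show ?thesis
      unfolding px py norm_cross_frame[OF frame_inner, of "f1 z + t * \<psi> z * b1 z" "g z"] w_def[symmetric]
        area_integrand_expansion L_def P_def S_def T_def ..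
  qed
  have sub: "continuous_on ?B u" if "continuous_on U u" for u :: "complex \<Rightarrow> 'z::topological_space"
    using continuous_on_subset[OF that U(2)] .
  have cf: "continuous_on ?B f" and cg: "continuous_on ?B g" and cg': "continuous_on ?B (deriv g)"
    by (rule sub[OF holomorphic_on_imp_continuous_on] hol holomorphic_deriv U(1))+
  have c\<psi>: "continuous_on ?B \<psi>" "continuous_on ?B yx" "continuous_on ?B yy"
    using Ck_continuous[OF \<psi>] Ck_Suc_continuous_pd[OF U(1) \<psi>] by (auto intro: sub simp: yx_def yy_def)
  have cw: "continuous_on ?B w" unfolding w_def by (intro continuous_intros cg)
  have cb: "continuous_on ?B b1" "continuous_on ?B b2"
    unfolding b1_def b2_def using w0 by (auto intro!: continuous_intros cw cg')
  have cff: "continuous_on ?B f1" "continuous_on ?B f2"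
    unfolding f1_def f2_def by (intro continuous_intros cf)+
  obtain B1 where B1: "B1 \<ge> 0" "\<And>z. z \<in> ?B \<Longrightarrow> norm (b1 z) \<le> B1" using continuous_on_compact_bound[OF compact_cball cb(1)] by blast
  obtain B2 where B2: "B2 \<ge> 0" "\<And>z. z \<in> ?B \<Longrightarrow> norm (b2 z) \<le> B2" using continuous_on_compact_bound[OF compact_cball cb(2)] by blast
  obtain W where W: "W \<ge> 0" "\<And>z. z \<in> ?B \<Longrightarrow> norm (w z) \<le> W" using continuous_on_compact_bound[OF compact_cball cw] by blast
  have BB: "B1 + B2 \<ge> 0" using B1 B2 by simp
  obtain C where C: "C \<ge> 0"
    "\<And>f1 f2 b1 b2 w y yx yy n. \<lbrakk>n = sqrt (f1\<^sup>2 + f2\<^sup>2); 1 \<le> w; w \<le> W; \<bar>b1\<bar> \<le> B1 + B2; \<bar>b2\<bar> \<le> B1 + B2;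
      \<bar>y\<bar> \<le> c * n; \<bar>yx\<bar> \<le> c * n; \<bar>yy\<bar> \<le> c * n\<rbrakk> \<Longrightarrow>
      \<bar>(yx\<^sup>2 + yy\<^sup>2) - 2 * w\<^sup>2 * (b1\<^sup>2 + b2\<^sup>2) * y\<^sup>2\<bar> \<le> C * (w\<^sup>2 * (f1\<^sup>2 + f2\<^sup>2)) \<and>
      \<bar>2 * w\<^sup>2 * y * ((yy * f1 + yx * f2) * (yy * b1 + yx * b2) + (yy * f2 - yx * f1) * (yx * b1 - yy * b2))\<bar>
        \<le> C * (w\<^sup>2 * (f1\<^sup>2 + f2\<^sup>2))\<^sup>2 \<and>
      \<bar>w ^ 4 * y ^ 4 * (b1\<^sup>2 + b2\<^sup>2)\<^sup>2 + w\<^sup>2 * y\<^sup>2 * (b1\<^sup>2 + b2\<^sup>2) * (yx\<^sup>2 + yy\<^sup>2)\<bar>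
        \<le> C * (w\<^sup>2 * (f1\<^sup>2 + f2\<^sup>2))\<^sup>2"
    using area_coefficient_bounds[OF c(1) BB, of W] by metis
  have bnd: "\<bar>P z\<bar> \<le> C * L z \<and> \<bar>S z\<bar> \<le> C * (L z)\<^sup>2 \<and> \<bar>T z\<bar> \<le> C * (L z)\<^sup>2" if z: "z \<in> ?B" for z
  proof -
    have nf: "norm (f z) = sqrt ((f1 z)\<^sup>2 + (f2 z)\<^sup>2)" by (simp add: f1_def f2_def cmod_def)
    show ?thesis
    unfolding P_def S_def T_def L_def
  proof (rule C(2)[OF nf])
    show "w z \<le> W" using W(2)[OF z] by simp
    show "\<bar>b1 z\<bar> \<le> B1 + B2" "\<bar>b2 z\<bar> \<le> B1 + B2" using B1 B2 z by (smt (verit) real_norm_def)+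
    show "\<bar>\<psi> z\<bar> \<le> c * norm (f z)" "\<bar>yx z\<bar> \<le> c * norm (f z)" "\<bar>yy z\<bar> \<le> c * norm (f z)"
      using c z by (auto simp: yx_def yy_def)
  qed (rule w0)
  qed
  have "\<exists>A'. (\<forall>\<^sub>F t in nhds 0. ((\<lambda>s. area r (\<lambda>z. h z + s *\<^sub>R (\<psi> z *\<^sub>R normal (g z)))) has_real_derivative A' t) (at t)) \<and>
    (A' has_real_derivative integral ?B P) (at 0)"
  proof (rule second_variation_sqrt_integral)
    show "continuous_on ?B L" "continuous_on ?B P" "continuous_on ?B S" "continuous_on ?B T"
      unfolding L_def P_def S_def T_def by (intro continuous_intros cw cb cff c\<psi>)+
    show "\<bar>P z\<bar> \<le> C * L z" "\<bar>S z\<bar> \<le> C * (L z)\<^sup>2" "\<bar>T z\<bar> \<le> C * (L z)\<^sup>2" if "z \<in> ?B" for z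
      using bnd[OF that] by auto
    show "area r (\<lambda>z. h z + t *\<^sub>R (\<psi> z *\<^sub>R normal (g z)))
        = integral ?B (\<lambda>z. sqrt ((L z)\<^sup>2 + t\<^sup>2 * (L z * P z) + t ^ 3 * S z + t ^ 4 * T z))" for t
      unfolding area_def by (rule integral_cong, rule integrand) simp
  qed (auto simp: L_def)
  moreover have "P = (\<lambda>z. (pdx \<psi> z)\<^sup>2 + (pdy \<psi> z)\<^sup>2 - 8 * (norm (deriv g z))\<^sup>2 / (1 + (norm (g z))\<^sup>2)\<^sup>2 * (\<psi> z)\<^sup>2)"
  proof
    fix z
    have "2 * (w z)\<^sup>2 * ((b1 z)\<^sup>2 + (b2 z)\<^sup>2) = 8 * (norm (deriv g z))\<^sup>2 / (w z)\<^sup>2"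
      unfolding b1_def b2_def cmod_power2 using w0(2)[of z]
      by (simp add: power_mult_distrib power_divide field_simps power2_eq_square)
    then show "P z = (pdx \<psi> z)\<^sup>2 + (pdy \<psi> z)\<^sup>2 - 8 * (norm (deriv g z))\<^sup>2 / (1 + (norm (g z))\<^sup>2)\<^sup>2 * (\<psi> z)\<^sup>2"
      unfolding P_def yx_def yy_def by (simp add: w_def)
  qed
  ultimately show ?thesis by simp
qed

section \<open>Power series and the polynomial\<close>

lemma powser_shift:
  fixes a :: "nat \<Rightarrow> complex"
  assumes "summable (\<lambda>j. a j * z ^ j)"
  shows "summable (\<lambda>j. a (j + k) * z ^ j)"
proof (induction k)
  case (Suc k)
  then show ?case using powser_split_head(3)[of "\<lambda>j. a (j + k)" z] by simp
qed (use assms in simp)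

lemma powser_holomorphic:
  fixes a :: "nat \<Rightarrow> complex"
  assumes "\<And>z. norm z < R \<Longrightarrow> summable (\<lambda>j. a j * z ^ j)"
  shows "(\<lambda>z. \<Sum>j. a j * z ^ j) holomorphic_on ball 0 R"
proof (rule power_series_holomorphic)
  show "(\<lambda>n. a n * (w - 0) ^ n) sums (\<Sum>j. a j * w ^ j)" if "w \<in> ball 0 R" for w
    using assms[of w] that by (simp add: summable_sums)
qed

lemma powser_split:
  fixes a :: "nat \<Rightarrow> complex"
  assumes "summable (\<lambda>j. a j * z ^ j)"
  shows "(\<Sum>j. a j * z ^ j) = (\<Sum>j<k. a j * z ^ j) + z ^ k * (\<Sum>j. a (j + k) * z ^ j)"
proof -
  have "(\<Sum>j. a j * z ^ j) = (\<Sum>j. a (j + k) * z ^ (j + k)) + (\<Sum>j<k. a j * z ^ j)"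
    by (rule suminf_split_initial_segment[OF assms])
  also have "(\<Sum>j. a (j + k) * z ^ (j + k)) = z ^ k * (\<Sum>j. a (j + k) * z ^ j)"
    using suminf_mult[OF powser_shift[OF assms, of k], of "z ^ k"] by (simp add: power_add mult_ac)
  finally show ?thesis by simp
qed

lemma powser_nonzero:
  fixes b :: "nat \<Rightarrow> complex"
  assumes R: "R > 0" "\<And>z. norm z < R \<Longrightarrow> summable (\<lambda>j. b j * z ^ j)" and b: "\<forall>j<k. b j = 0" "b k \<noteq> 0"
  shows "\<exists>z\<in>ball 0 R. (\<Sum>j. b j * z ^ j) \<noteq> 0"
proof -
  define q where "q z = (\<Sum>j. b (j + k) * z ^ j)" for z
  have "q holomorphic_on ball 0 R"
    unfolding q_def by (intro powser_holomorphic powser_shift R)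
  then have "continuous_on (ball 0 R) q" by (rule holomorphic_on_imp_continuous_on)
  then have "continuous (at 0) q" using R(1) by (simp add: continuous_on_eq_continuous_at)
  moreover have "q 0 = b k" by (simp add: q_def powser_zero)
  ultimately obtain e where e: "e > 0" "\<And>z. dist 0 z < e \<Longrightarrow> q z \<noteq> 0"
    using continuous_at_avoid[of 0 q 0] b(2) by auto
  define z :: complex where "z = of_real (min e R / 2)"
  have z: "norm z < e" "norm z < R" "z \<noteq> 0"
    using e(1) R(1) by (auto simp: z_def)
  have "(\<Sum>j. b j * z ^ j) = z ^ k * q z"
    using powser_split[OF R(2)[OF z(2)], of k] b(1) by (simp add: q_def)
  also have "\<dots> \<noteq> 0" using e(2)[of z] z by simp
  finally show ?thesis using z(2) by auto
qed

lemma smallest_pos_root_bound: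
  assumes "smallest_pos_root (Pm m k a b) \<rho>" "\<rho> < r" "m > 0" "b k \<noteq> 0" "a m \<noteq> 0"
  shows "1 + (norm (a 0))\<^sup>2 < norm (a m) * r ^ m"
proof -
  have \<rho>: "\<rho> > 0" "Pm m k a b \<rho> = 0" using assms(1) by (auto simp: smallest_pos_root_def)
  define K where "K = 1 + (norm (a 0))\<^sup>2"
  define s where "s j = real (m - j) * (cmod (b (k + j)))\<^sup>2 * K\<^sup>2 * \<rho> ^ (2 * j)" for j
  have "s 0 \<le> (\<Sum>j<m. s j)"
    by (rule member_le_sum) (use assms(3) \<rho>(1) in \<open>auto simp: s_def\<close>)
  then have "real m * (norm (b k))\<^sup>2 * K\<^sup>2 \<le> (\<Sum>j<m. s j)" by (simp add: s_def)
  also have "\<dots> = real m * (cmod (b k * a m))\<^sup>2 * \<rho> ^ (2 * m)"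
    using \<rho>(2) by (simp add: Pm_def K_def s_def)
  also have "\<dots> = real m * (norm (b k))\<^sup>2 * (norm (a m) * \<rho> ^ m)\<^sup>2"
    by (simp add: norm_mult power_mult_distrib power_mult[symmetric] mult_ac)
  finally have "K\<^sup>2 \<le> (norm (a m) * \<rho> ^ m)\<^sup>2"
    by (rule mult_left_le_imp_le) (use assms(3,4) in simp)
  then have "K \<le> norm (a m) * \<rho> ^ m"
    by (rule power2_le_imp_le) (use \<rho>(1) in simp)
  also have "\<dots> < norm (a m) * r ^ m"
    using assms \<rho>(1) by (intro mult_strict_left_mono power_strict_mono) auto
  finally show ?thesis by (simp add: K_def)
qed

section \<open>Assembling the destabilising variation\<close>

lemma Ck_normal:
  assumes "open U" "Ck n U g"
  shows "Ck n U (\<lambda>z. normal (g z))"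
proof (rule Ck_vec3[OF assms(1)])
  note R = Ck_bounded_linear[OF assms(1) bounded_linear_Re assms(2)]
    and I = Ck_bounded_linear[OF assms(1) bounded_linear_Im assms(2)]
    and N = Ck_norm_square[OF assms]
  have W: "Ck n U (\<lambda>z. 1 + (norm (g z))\<^sup>2)" by (intro Ck_add Ck_const assms N)
  have "Ck n U (\<lambda>z. (2 * Re (g z)) / (1 + (norm (g z))\<^sup>2))" "Ck n U (\<lambda>z. (2 * Im (g z)) / (1 + (norm (g z))\<^sup>2))"
    "Ck n U (\<lambda>z. ((norm (g z))\<^sup>2 - 1) / (1 + (norm (g z))\<^sup>2))"
    by (intro Ck_divide Ck_mult Ck_diff Ck_const assms(1) R I N W one_plus_norm_square_pos)+
  then show "Ck n U (\<lambda>z. normal (g z) $ i)" for i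
    using exhaust_3[of i] by (auto simp: normal_def)
qed

lemma (in gauss_map) wirt_phi_pd:
  assumes "norm z < R"
  shows "((\<lambda>z. Re (\<phi> z)) has_derivative (\<lambda>v. 2 * Re (P z * v))) (at z)"
    "pdx (\<lambda>z. Re (\<phi> z)) z = 2 * Re (P z)" "pdy (\<lambda>z. Re (\<phi> z)) z = - 2 * Im (P z)"
proof -
  have "((\<lambda>z. Re (\<phi> z)) has_derivative (\<lambda>v. Re (P z * v + cnj (P z) * cnj v))) (at z)"
    using has_derivative_Re[OF wirt_phi[OF assms, unfolded has_wirt_def]] .
  then show *: "((\<lambda>z. Re (\<phi> z)) has_derivative (\<lambda>v. 2 * Re (P z * v))) (at z)"
    by (rule has_derivative_eq_rhs) (simp add: fun_eq_iff)
  show "pdx (\<lambda>z. Re (\<phi> z)) z = 2 * Re (P z)" "pdy (\<lambda>z. Re (\<phi> z)) z = - 2 * Im (P z)"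
    using pd_has_derivative[OF *] by simp_all
qed

text \<open>The cutoff is at most \<open>4^n |f|^2\<close> and its gradient at most
  \<open>2 * 4^n |f| |f'|\<close>. On the disc one factor \<open>|f|\<close> is kept and the rest is
  bounded; the two summands of \<open>c\<close> correspond to the two terms of the product
  rule.\<close>

lemma log_cutoff_mult_bounds:
  assumes U: "open U" "cball 0 r \<subseteq> U" "f holomorphic_on U" and \<phi>: "Ck (Suc 0) U \<phi>" and n: "n > 0"
  shows "\<exists>c\<ge>0. \<forall>z\<in>cball 0 r. \<bar>log_cutoff n f z * \<phi> z\<bar> \<le> c * norm (f z) \<and>
    \<bar>pdx (\<lambda>z. log_cutoff n f z * \<phi> z) z\<bar> \<le> c * norm (f z) \<and>
    \<bar>pdy (\<lambda>z. log_cutoff n f z * \<phi> z) z\<bar> \<le> c * norm (f z)"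
proof -
  have sub: "continuous_on (cball 0 r) u" if "continuous_on U u" for u :: "complex \<Rightarrow> 'z::topological_space"
    using continuous_on_subset[OF that U(2)] .
  obtain F where F: "F \<ge> 0" "\<And>z. z \<in> cball 0 r \<Longrightarrow> norm (f z) \<le> F"
    using continuous_on_compact_bound[OF compact_cball sub[OF holomorphic_on_imp_continuous_on[OF U(3)]]] by blast
  obtain F' where F': "F' \<ge> 0" "\<And>z. z \<in> cball 0 r \<Longrightarrow> norm (deriv f z) \<le> F'"
    using continuous_on_compact_bound[OF compact_cball sub[OF holomorphic_on_imp_continuous_on[OF holomorphic_deriv[OF U(3,1)]]]] by blast
  obtain q where q: "q \<ge> 0" "\<And>z. z \<in> cball 0 r \<Longrightarrow> norm (\<phi> z) \<le> q"
    using continuous_on_compact_bound[OF compact_cball sub[OF Ck_continuous[OF \<phi>]]] by blast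
  obtain qx where qx: "qx \<ge> 0" "\<And>z. z \<in> cball 0 r \<Longrightarrow> norm (pdx \<phi> z) \<le> qx"
    using continuous_on_compact_bound[OF compact_cball sub[OF Ck_Suc_continuous_pd(1)[OF U(1) \<phi>]]] by blast
  obtain qy where qy: "qy \<ge> 0" "\<And>z. z \<in> cball 0 r \<Longrightarrow> norm (pdy \<phi> z) \<le> qy"
    using continuous_on_compact_bound[OF compact_cball sub[OF Ck_Suc_continuous_pd(2)[OF U(1) \<phi>]]] by blast
  define c where "c = 4 ^ n * F * (q + qx + qy) + 2 * 4 ^ n * F' * q"
  have main: "\<bar>log_cutoff n f z * \<phi> z\<bar> \<le> c * norm (f z)"
     "\<bar>pdx (\<lambda>z. log_cutoff n f z * \<phi> z) z\<bar> \<le> c * norm (f z)"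
     "\<bar>pdy (\<lambda>z. log_cutoff n f z * \<phi> z) z\<bar> \<le> c * norm (f z)" if "norm z \<le> r" for z
  proof -
    have z: "z \<in> cball 0 r" and zU: "z \<in> U" using that U(2) by auto
    define N where "N = norm (f z)"
    have N: "N \<ge> 0" by (simp add: N_def)
    have "\<bar>log_cutoff n f z\<bar> \<le> 4 ^ n * N\<^sup>2"
      using log_cutoff_bounds(1,3)[OF n, of f z] by (simp add: N_def)
    also have "\<dots> \<le> 4 ^ n * (F * N)"
      using F(2)[OF z] N unfolding power2_eq_square by (intro mult_left_mono mult_right_mono) (auto simp: N_def)
    finally have \<xi>: "\<bar>log_cutoff n f z\<bar> \<le> 4 ^ n * F * N" by simp
    have fd: "(f has_field_derivative deriv f z) (at z)" by (rule holomorphic_derivI[OF U(3,1) zU])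
    obtain D where D: "(log_cutoff n f has_derivative D) (at z)"
      "\<And>v. \<bar>D v\<bar> \<le> 2 * 4 ^ n * norm (f z) * norm (deriv f z) * norm v"
      "\<And>v. (D v)\<^sup>2 \<le> 4 * (norm (deriv f z))\<^sup>2 * (norm v)\<^sup>2 / (((norm (f z))\<^sup>2 + (1/4) ^ n) * (real n * ln 4)\<^sup>2)"
      by (rule log_cutoff_derivative[OF fd n], rule that)
    have Dv: "\<bar>D v\<bar> \<le> 2 * 4 ^ n * F' * N" if "norm v = 1" for v
    proof -
      have "\<bar>D v\<bar> \<le> 2 * 4 ^ n * N * norm (deriv f z)" using D(2)[of v] that by (simp add: N_def)
      also have "\<dots> \<le> 2 * 4 ^ n * N * F'" using F'(2)[OF z] N by (intro mult_left_mono) auto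
      finally show ?thesis by (simp add: mult_ac)
    qed
    have pd: "pdx (\<lambda>z. log_cutoff n f z * \<phi> z) z = log_cutoff n f z * pdx \<phi> z + D 1 * \<phi> z"
      "pdy (\<lambda>z. log_cutoff n f z * \<phi> z) z = log_cutoff n f z * pdy \<phi> z + D \<i> * \<phi> z"
      using pd_has_derivative[OF has_derivative_mult[OF D(1) Ck_Suc_has_derivative[OF U(1) \<phi> zU]]]
      by (auto simp: pdx_def pdy_def)
    have le: "\<bar>u * x + v * y\<bar> \<le> c * N"
      if "\<bar>u\<bar> \<le> 4 ^ n * F * N" "\<bar>x\<bar> \<le> q + qx + qy" "\<bar>v\<bar> \<le> 2 * 4 ^ n * F' * N" "\<bar>y\<bar> \<le> q" for u v x y
    proof -
      have "\<bar>u * x\<bar> \<le> (4 ^ n * F * N) * (q + qx + qy)"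
        unfolding abs_mult using that F N by (intro mult_mono) auto
      moreover have "\<bar>v * y\<bar> \<le> (2 * 4 ^ n * F' * N) * q"
        unfolding abs_mult using that F' N by (intro mult_mono) auto
      ultimately have "\<bar>u * x + v * y\<bar> \<le> (4 ^ n * F * N) * (q + qx + qy) + (2 * 4 ^ n * F' * N) * q"
        by linarith
      then show ?thesis by (simp add: c_def algebra_simps)
    qed
    have D0: "0 \<le> 2 * 4 ^ n * F' * N" using F' N by simp
    have b: "\<bar>\<phi> z\<bar> \<le> q" "\<bar>\<phi> z\<bar> \<le> q + qx + qy" "\<bar>pdx \<phi> z\<bar> \<le> q + qx + qy" "\<bar>pdy \<phi> z\<bar> \<le> q + qx + qy"
      using q(1) q(2)[OF z] qx(1) qx(2)[OF z] qy(1) qy(2)[OF z] unfolding real_norm_def by linarith+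
    show "\<bar>log_cutoff n f z * \<phi> z\<bar> \<le> c * norm (f z)"
      using le[OF \<xi> b(2), of 0 0] q(1) D0 by (simp add: N_def)
    show "\<bar>pdx (\<lambda>z. log_cutoff n f z * \<phi> z) z\<bar> \<le> c * norm (f z)"
      unfolding pd N_def[symmetric] by (rule le[OF \<xi> b(3) Dv b(1)]) simp
    show "\<bar>pdy (\<lambda>z. log_cutoff n f z * \<phi> z) z\<bar> \<le> c * norm (f z)"
      unfolding pd N_def[symmetric] by (rule le[OF \<xi> b(4) Dv b(1)]) simp
  qed
  have c0: "c \<ge> 0" unfolding c_def using F(1) F'(1) q(1) qx(1) qy(1) by simp
  show ?thesis
    using c0 main by (intro exI[of _ c]) simp
qed

theorem theorem1p4:
  fixes r :: real and h :: "complex \<Rightarrow> real^3" and a b :: "nat \<Rightarrow> complex" and k m :: nat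
  assumes "r > 0"
    and "branched_minimal_immersion r h"
    and "\<exists>R>r. \<forall>z. norm z < R \<longrightarrow> summable (\<lambda>j. b j * z ^ j) \<and> summable (\<lambda>j. a j * z ^ j)"
    and "\<forall>j<k. b j = 0" and "b k \<noteq> 0"
    and "m > 0" and "\<forall>j. 0 < j \<and> j < m \<longrightarrow> a j = 0" and "a m \<noteq> 0"
    and "WE_rep r h (\<lambda>z. \<Sum>j. b j * z ^ j) (\<lambda>z. \<Sum>j. a j * z ^ j)"
    and "\<exists>\<rho>. smallest_pos_root (Pm m k a b) \<rho> \<and> \<rho> < r"
  shows "unstable_cdisk r h"
proof -
  obtain R where R: "R > r"
    and sab: "\<forall>z. norm z < R \<longrightarrow> summable (\<lambda>j. b j * z ^ j) \<and> summable (\<lambda>j. a j * z ^ j)"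
    using assms(3) by blast
  then have sb: "summable (\<lambda>j. b j * z ^ j)" and sa: "summable (\<lambda>j. a j * z ^ j)" if "norm z < R" for z
    using that by auto
  define f where "f z = (\<Sum>j. b j * z ^ j)" for z
  define g where "g z = (\<Sum>j. a j * z ^ j)" for z
  define c where "c z = (\<Sum>j. a (j + m) * z ^ j)" for z
  define d where "d z = (\<Sum>j. a (j + Suc m) * z ^ j)" for z
  let ?U = "ball (0::complex) R"
  have holfg: "f holomorphic_on ?U" "g holomorphic_on ?U" "c holomorphic_on ?U" "d holomorphic_on ?U"
    unfolding f_def g_def c_def d_def
    by (rule powser_holomorphic, erule sb, rule powser_holomorphic, erule sa,
        (rule powser_holomorphic, rule powser_shift, erule sa)+)
  have sub: "cball 0 r \<subseteq> ?U" using R by auto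
  have sum_a: "(\<Sum>j<m. a j * z ^ j) = a 0" for z
  proof -
    have "(\<Sum>j<m. a j * z ^ j) = (\<Sum>j\<in>{0}. a j * z ^ j)"
      by (rule sum.mono_neutral_right) (use assms(6,7) in auto)
    then show ?thesis by simp
  qed
  have g_eq: "g z = a 0 + z ^ m * c z" if "norm z < R" for z
    using powser_split[OF sa[OF that], of m] sum_a by (simp add: g_def c_def)
  have c_eq: "c z = a m + z * d z" if "norm z < R" for z
    using powser_split[OF powser_shift[OF sa[OF that], of m], of 1] by (simp add: c_def d_def)
  \<comment> \<open>The conjugate phase of \<open>a m\<close>; it makes
    \<open>\<epsilon>^2 * am^2\<close> equal to \<open>|am|^2\<close>, the largest real part
    possible.\<close>
  define \<epsilon> where "\<epsilon> = cnj (sgn (a m))"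
  have eps: "norm \<epsilon> = 1" "\<epsilon> * a m = of_real (norm (a m))"
  proof -
    show "norm \<epsilon> = 1" using assms(8) by (simp add: \<epsilon>_def norm_sgn)
    have "\<epsilon> * a m = of_real (inverse (norm (a m))) * (a m * cnj (a m))"
      by (simp add: \<epsilon>_def sgn_div_norm scaleR_conv_of_real)
    also have "\<dots> = of_real (inverse (norm (a m)) * (norm (a m))\<^sup>2)"
      by (simp only: complex_norm_square[symmetric] of_real_mult)
    also have "inverse (norm (a m)) * (norm (a m))\<^sup>2 = norm (a m)"
      using assms(8) by (simp add: power2_eq_square)
    finally show "\<epsilon> * a m = of_real (norm (a m))" .
  qed
  interpret gauss_map g c d "a 0" "a m" \<epsilon> m r R
    by unfold_locales (use assms(1,6) R holfg g_eq c_eq eps in auto)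
  define \<phi>' where "\<phi>' z = Re (\<phi> z)" for z
  define \<kappa> where "\<kappa> z = 8 * (norm (deriv g z))\<^sup>2 / (1 + (norm (g z))\<^sup>2)\<^sup>2" for z
  have C\<phi>': "Ck n ?U \<phi>'" for n
    unfolding \<phi>'_def[abs_def] by (rule Ck_bounded_linear[OF open_ball bounded_linear_Re Ck_phi])
  have "1 + (norm (a 0))\<^sup>2 < norm (a m) * r ^ m"
    using assms(10,6,5,8) smallest_pos_root_bound by blast
  from index_negative[OF this] have "integral (cball 0 r) index_integrand < 0" .
  also have "integral (cball 0 r) index_integrand
      = integral (cball 0 r) (\<lambda>z. (pdx \<phi>' z)\<^sup>2 + (pdy \<phi>' z)\<^sup>2 - \<kappa> z * (\<phi>' z)\<^sup>2)"
  proof (rule integral_cong)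
    fix z :: complex assume "z \<in> cball 0 r"
    then have "norm z < R" using R by auto
    from wirt_phi_pd(2,3)[OF this]
    show "index_integrand z = (pdx \<phi>' z)\<^sup>2 + (pdy \<phi>' z)\<^sup>2 - \<kappa> z * (\<phi>' z)\<^sup>2"
      unfolding \<phi>'_def[abs_def] index_integrand_def \<kappa>_def cmod_power2 by (simp add: power_mult_distrib)
  qed
  finally have neg: "integral (cball 0 r) (\<lambda>z. (pdx \<phi>' z)\<^sup>2 + (pdy \<phi>' z)\<^sup>2 - \<kappa> z * (\<phi>' z)\<^sup>2) < 0" .
  have c\<kappa>: "continuous_on (cball 0 r) \<kappa>"
  proof -
    have "continuous_on ?U g" "continuous_on ?U (deriv g)"
      by (rule holomorphic_on_imp_continuous_on holfg holomorphic_deriv open_ball)+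
    then have "continuous_on ?U \<kappa>"
      unfolding \<kappa>_def using one_plus_norm_square_pos(2) by (intro continuous_intros) auto
    then show ?thesis by (rule continuous_on_subset[OF _ sub])
  qed
  have fnz: "\<exists>w\<in>?U. f w \<noteq> 0"
    unfolding f_def by (rule powser_nonzero) (use sb assms(1,4,5) R in auto)
  \<comment> \<open>\<open>n\<close> is fixed before the constant \<open>C\<close> is obtained, so
    the growth of \<open>C\<close> with \<open>n\<close> does no harm.\<close>
  obtain n where n: "n > 0" and Q: "integral (cball 0 r) (\<lambda>z. (pdx (\<lambda>z. log_cutoff n f z * \<phi>' z) z)\<^sup>2
     + (pdy (\<lambda>z. log_cutoff n f z * \<phi>' z) z)\<^sup>2 - \<kappa> z * (log_cutoff n f z * \<phi>' z)\<^sup>2) < 0"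
    by (rule cutoff_index_negative[OF open_ball connected_ball holfg(1) fnz sub C\<phi>' c\<kappa> neg])
  define \<psi> where "\<psi> z = log_cutoff n f z * \<phi>' z" for z
  have C\<psi>: "Ck i ?U \<psi>" for i
    unfolding \<psi>_def[abs_def] by (intro Ck_mult Ck_log_cutoff Ck_holomorphic holfg C\<phi>' open_ball)
  obtain C where C: "C \<ge> 0" "\<forall>z\<in>cball 0 r. \<bar>\<psi> z\<bar> \<le> C * norm (f z) \<and>
      \<bar>pdx \<psi> z\<bar> \<le> C * norm (f z) \<and> \<bar>pdy \<psi> z\<bar> \<le> C * norm (f z)"
    using log_cutoff_mult_bounds[OF open_ball sub holfg(1) C\<phi>' n, folded \<psi>_def] by blast
  have h: "h differentiable at z" if "norm z \<le> r" for z
  proof -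
    obtain V where V: "open V" "cball 0 r \<subseteq> V" "Ck (Suc 0) V h"
      using assms(2) unfolding branched_minimal_immersion_def smooth_cdisk_def by blast
    then have "z \<in> V" using that by auto
    then show ?thesis by (rule differentiableI[OF Ck_Suc_has_derivative[OF V(1,3)]])
  qed
  obtain A' where A': "\<forall>\<^sub>F t in nhds 0. ((\<lambda>s. area r (\<lambda>z. h z + s *\<^sub>R (\<psi> z *\<^sub>R normal (g z)))) has_real_derivative A' t) (at t)"
    "(A' has_real_derivative integral (cball 0 r) (\<lambda>z. (pdx \<psi> z)\<^sup>2 + (pdy \<psi> z)\<^sup>2
      - 8 * (norm (deriv g z))\<^sup>2 / (1 + (norm (g z))\<^sup>2)\<^sup>2 * (\<psi> z)\<^sup>2)) (at 0)"
  proof -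
    have "\<exists>A'. (\<forall>\<^sub>F t in nhds 0. ((\<lambda>s. area r (\<lambda>z. h z + s *\<^sub>R (\<psi> z *\<^sub>R normal (g z)))) has_real_derivative A' t) (at t)) \<and>
      (A' has_real_derivative integral (cball 0 r) (\<lambda>z. (pdx \<psi> z)\<^sup>2 + (pdy \<psi> z)\<^sup>2
        - 8 * (norm (deriv g z))\<^sup>2 / (1 + (norm (g z))\<^sup>2)\<^sup>2 * (\<psi> z)\<^sup>2)) (at 0)"
      by (rule normal_second_variation[OF open_ball sub holfg(1,2) C\<psi> h _ C(1)])
         (use assms(9) C(2) in \<open>simp_all add: f_def[abs_def] g_def[abs_def]\<close>)
    then show thesis using that by blast
  qed
  have "smooth_cdisk r (\<lambda>z. \<psi> z *\<^sub>R normal (g z))"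
    unfolding smooth_cdisk_def
    by (intro exI[of _ ?U] conjI allI open_ball sub Ck_scaleR Ck_normal C\<psi> Ck_holomorphic holfg)
  moreover have "\<psi> z *\<^sub>R normal (g z) = 0" if "norm z = r" for z
    using rho_0[OF that] by (simp add: \<psi>_def \<phi>'_def \<phi>_def \<Psi>_def)
  moreover have "integral (cball 0 r) (\<lambda>z. (pdx \<psi> z)\<^sup>2 + (pdy \<psi> z)\<^sup>2
      - 8 * (norm (deriv g z))\<^sup>2 / (1 + (norm (g z))\<^sup>2)\<^sup>2 * (\<psi> z)\<^sup>2) < 0"
    using Q unfolding \<psi>_def[abs_def] \<kappa>_def .
  ultimately show ?thesis
    unfolding unstable_cdisk_def using A' by blast
qed

end
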